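(* Let $d\ge 1$ be an integer, $p>d$ and $q\ge 0$ real, and let $\theta=\frac{pd}{dp+(p-d)(q+1)}$. If $u\in L^{q+1}(\mathbb{R}^d)$ and $\nabla u\in L^{p}(\mathbb{R}^d)$, then $u\in L^{\infty}(\mathbb{R}^d)$ and $$\|u\|_{L^{\infty}}\le C_{q,\infty,p}\,\|u\|_{L^{q+1}}^{1-\theta}\,\|\nabla u\|_{L^p}^{\theta},$$ where the best (smallest possible) constant is $$C_{q,\infty,p}=\theta^{-\frac{\theta}{p}}(1-\theta)^{\frac{\theta}{p}}M_c^{-\frac{\theta}{d}},\qquad M_c=\int_{\mathbb{R}^d}|u_{c,\infty}|^{q+1}\,dx.$$ Here $u_{c,\infty}$ is the radial function on $\mathbb{R}^d$ described as follows: (1) if $q<p-1$, $u_{c,\infty}$ is the unique non-increasing solution of the free boundary problem (FBP$_\infty$) of the context, extended by $u_{c,\infty}(r)=0$ for $r\ge R$; (2) if $q\ge p-1$, $u_{c,\infty}$ is the unique positive (decreasing) solution of the problem (P$_\infty$) of the context. Moreover, equality holds if $u(x)=u_{c,\infty}(\lambda|x-x_0|)$ for any $\lambda>0$ and $x_0\in\mathbb{R}^d$.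
   Context: A radial function is written $u(x)=u(r)$ with $r=|x|$, and $'$ denotes $d/dr$. (FBP$_\infty$): find $R\in(0,\infty)$ and $u=u(r)\ge 0$ with $u>0$ on $[0,R)$ such that $$(|u'|^{p-2}u')'+\frac{d-1}{r}|u'|^{p-2}u'=u^{q}\quad (0<r<R),\qquad u(0)=1,\quad u(R)=u'(R)=0.$$ The free boundary point $R$ is part of the unknown. (P$_\infty$): find $u=u(r)$ such that $$(|u'|^{p-2}u')'+\frac{d-1}{r}|u'|^{p-2}u'=u^{q}\quad (0<r<\infty),\qquad u(0)=1,\quad \lim_{r\to\infty}u(r)=0.$$ In both problems $u(0)=1$ means $\lim_{r\to0^+}u(r)=1$; no condition is imposed on $u'$ at $r=0$. *)

theory Defs
  imports "HOL-Analysis.Analysis" "HOL-Probability.Essential_Supremum"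
begin

definition in_Lp :: "real \<Rightarrow> ('a::euclidean_space \<Rightarrow> 'b::euclidean_space) \<Rightarrow> bool" where
  "in_Lp p f \<longleftrightarrow>
     f \<in> borel_measurable lebesgue \<and> integrable lebesgue (\<lambda>x. norm (f x) powr p)"

definition Lp_norm :: "real \<Rightarrow> ('a::euclidean_space \<Rightarrow> 'b::euclidean_space) \<Rightarrow> real" where
  "Lp_norm p f = (LINT x|lebesgue. norm (f x) powr p) powr (1 / p)"

definition in_Linf :: "('a::euclidean_space \<Rightarrow> 'b::euclidean_space) \<Rightarrow> bool" where
  "in_Linf f \<longleftrightarrow>
     f \<in> borel_measurable lebesgue \<and> esssup lebesgue (\<lambda>x. ereal (norm (f x))) < \<infinity>"

definition Linf_norm :: "('a::euclidean_space \<Rightarrow> 'b::euclidean_space) \<Rightarrow> real" where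
  "Linf_norm f = real_of_ereal (esssup lebesgue (\<lambda>x. ereal (norm (f x))))"

fun k_times_cont_diff :: "nat \<Rightarrow> ('a::euclidean_space \<Rightarrow> real) \<Rightarrow> bool" where
  "k_times_cont_diff 0 f \<longleftrightarrow> continuous_on UNIV f"
| "k_times_cont_diff (Suc k) f \<longleftrightarrow>
     (\<forall>x. f differentiable (at x)) \<and>
     (\<forall>b\<in>Basis. k_times_cont_diff k (\<lambda>x. frechet_derivative f (at x) b))"

definition test_function :: "('a::euclidean_space \<Rightarrow> real) \<Rightarrow> bool" where
  "test_function \<phi> \<longleftrightarrow>
     (\<forall>k. k_times_cont_diff k \<phi>) \<and> compact (closure {x. \<phi> x \<noteq> 0})"

definition locally_integrable ::
    "('a::euclidean_space \<Rightarrow> 'b::euclidean_space) \<Rightarrow> bool" where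
  "locally_integrable f \<longleftrightarrow> (\<forall>K. compact K \<longrightarrow> f absolutely_integrable_on K)"

definition weak_gradient ::
    "('a::euclidean_space \<Rightarrow> real) \<Rightarrow> ('a \<Rightarrow> 'a) \<Rightarrow> bool" where
  "weak_gradient u g \<longleftrightarrow>
     locally_integrable u \<and> locally_integrable g \<and>
     (\<forall>\<phi>. test_function \<phi> \<longrightarrow> (\<forall>b\<in>Basis.
        (LINT x|lebesgue. u x * frechet_derivative \<phi> (at x) b)
          = - (LINT x|lebesgue. (g x \<bullet> b) * \<phi> x)))"

text \<open>Where \<open>deriv u r = 0\<close> the flux is \<open>0\<close>, also for \<open>p < 2\<close>, because of the convention
  \<open>0 powr a = 0\<close>.\<close>

definition radial_flux :: "real \<Rightarrow> (real \<Rightarrow> real) \<Rightarrow> real \<Rightarrow> real" where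
  "radial_flux p u r = \<bar>deriv u r\<bar> powr (p - 2) * deriv u r"

text \<open>The set \<open>I\<close> is meant to be open, and \<open>u\<close> positive on it, so that
  \<open>u r powr q\<close> is the ordinary power, with value \<open>1\<close> for \<open>q = 0\<close>.\<close>

definition radial_ode_on ::
    "nat \<Rightarrow> real \<Rightarrow> real \<Rightarrow> real set \<Rightarrow> (real \<Rightarrow> real) \<Rightarrow> bool" where
  "radial_ode_on d p q I u \<longleftrightarrow> (\<forall>r\<in>I.
     u differentiable (at r) \<and> radial_flux p u differentiable (at r) \<and>
     deriv (radial_flux p u) r + (real d - 1) / r * radial_flux p u r = u r powr q)"

text \<open>The condition \<open>u(0) = 1\<close> is the limit condition at \<open>0+\<close>; the value of the profile at the
  point \<open>0\<close> is by convention that limit. Nothing is required for \<open>r < 0\<close>, nor, in the free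
  boundary problem, for \<open>r > R\<close>; accordingly the derivative at \<open>R\<close> is the left one.\<close>

definition FBP_inf ::
    "nat \<Rightarrow> real \<Rightarrow> real \<Rightarrow> real \<Rightarrow> (real \<Rightarrow> real) \<Rightarrow> bool" where
  "FBP_inf d p q R u \<longleftrightarrow>
     0 < R \<and> (\<forall>r\<in>{0..<R}. 0 < u r) \<and>
     radial_ode_on d p q {0<..<R} u \<and>
     u 0 = 1 \<and> (u \<longlongrightarrow> 1) (at_right 0) \<and>
     u R = 0 \<and> (u has_real_derivative 0) (at_left R)"

definition P_inf :: "nat \<Rightarrow> real \<Rightarrow> real \<Rightarrow> (real \<Rightarrow> real) \<Rightarrow> bool" where
  "P_inf d p q u \<longleftrightarrow>
     radial_ode_on d p q {0<..} u \<and>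
     u 0 = 1 \<and> (u \<longlongrightarrow> 1) (at_right 0) \<and> (u \<longlongrightarrow> 0) at_top"

text \<open>The profile \<open>u\<^sub>c\<close> of the optimal functions, including its uniqueness. For
  \<open>q < p - 1\<close> uniqueness concerns the pair \<open>(R, u)\<close>; for \<open>q \<ge> p - 1\<close> it holds among all
  positive solutions, and monotonicity is part of the claim. Profiles are compared on the
  domain on which they are prescribed.\<close>

definition unique_profile :: "nat \<Rightarrow> real \<Rightarrow> real \<Rightarrow> (real \<Rightarrow> real) \<Rightarrow> bool" where
  "unique_profile d p q u \<longleftrightarrow>
     (q < p - 1 \<longrightarrow>
        (\<exists>R. FBP_inf d p q R u \<and> antimono_on {0..R} u \<and> (\<forall>r\<ge>R. u r = 0) \<and>
           (\<forall>S v. FBP_inf d p q S v \<and> antimono_on {0..S} v \<longrightarrow>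
              S = R \<and> (\<forall>r\<in>{0..R}. v r = u r)))) \<and>
     (q \<ge> p - 1 \<longrightarrow>
        P_inf d p q u \<and> (\<forall>r\<ge>0. 0 < u r) \<and> strict_antimono_on {0..} u \<and>
        (\<forall>v. P_inf d p q v \<and> (\<forall>r\<ge>0. 0 < v r) \<longrightarrow> (\<forall>r\<ge>0. v r = u r)))"

end

(* The flux field |grad uc|^(p-2) grad uc of the extremal function, which has a point source of
   strength k at the origin and divergence uc^q elsewhere, serves as a calibration: integrating an
   arbitrary u against its divergence expresses k u(0), up to averaging over small balls, by
   integrals of u uc^q and grad u . flux. Young's inequality bounds these by the two energies of u,
   with equality for u = uc. Hence the sum of the energies is bounded below when the supremum is 1;
   the product form follows by rescaling, and since the dilates of uc all have supremum 1,
   minimality at dilation 1 is the Pohozaev identity, which turns the constant into the stated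
   expression in M_c alone. The profile itself is found by shooting for the flux at the origin,
   and it is unique because the product of the differences of two solutions and of their fluxes
   is monotone in r. *)

theory Submission
  imports Defs
begin

section \<open>The shooting problem\<close>

text \<open>The obstacle in the construction is degeneracy: neither \<open>u powr q\<close> nor the
  inverse flux map \<open>t powr (1 / (p - 1))\<close> need be Lipschitz at 0, and that is where the
  profile has to arrive, with u and its flux vanishing together. The initial value problem therefore
  cannot be treated as uniquely solvable. Solutions come from a monotone scheme, and in the
  construction uniqueness is used only while u and its flux stay away from 0; the critical parameter
  is approached from both sides and the two limits are compared. The condition p > d makes the
  origin a regular point: in a suitable power of r the flux starts from a prescribed value k while
  u(0) = 1.

  The calibration has a different obstacle: the flux is singular at 0, may have a kink at the free
  boundary and is not compactly supported, whereas weak gradients are tested with smooth functions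
  of compact support. So it is made linear on a small ball, brought to 0 at a large radius and
  mollified; the linear piece turns the point source into an average over the ball.

  The value q = 0 recurs as an exception because \<open>0 powr 0 = 0\<close>.\<close>

lemma powr_lip:
  fixes m e k :: real
  assumes "0 < m" "0 < e"
  shows "\<exists>C\<ge>0. \<forall>x\<in>{e..k}. \<forall>y\<in>{e..k}. x \<le> y \<longrightarrow> y powr m - x powr m \<le> C * (y - x)"
proof -
  define C where "C = max (e powr (m - 1)) (k powr (m - 1))"
  have "y powr m - x powr m \<le> m * C * (y - x)" if "x \<in> {e..k}" "y \<in> {e..k}" "x < y" for x y
  proof -
    have "\<exists>z. x < z \<and> z < y \<and> y powr m - x powr m = (y - x) * (m * z powr (m - 1))"
      by (rule MVT2) (use that assms(2) in \<open>auto intro!: derivative_eq_intros\<close>)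
    then obtain z where z: "x < z" "z < y" "y powr m - x powr m = (y - x) * (m * z powr (m - 1))" by blast
    have "z powr (m - 1) \<le> C"
    proof (cases "m \<ge> 1")
      case True then have "z powr (m - 1) \<le> k powr (m - 1)"
        using z that assms by (intro powr_mono2) auto
      then show ?thesis by (simp add: C_def)
    next
      case False then have "z powr (m - 1) \<le> e powr (m - 1)"
        using z that assms by (intro powr_mono2') auto
      then show ?thesis by (simp add: C_def)
    qed
    then have "(y - x) * (m * z powr (m - 1)) \<le> (y - x) * (m * C)"
      using z assms(1) by (intro mult_left_mono) auto
    then show ?thesis using z by (simp add: mult_ac)
  qed
  moreover have "m * C \<ge> 0" using assms(1) by (simp add: C_def le_max_iff_disj)
  ultimately show ?thesis
    by (intro exI[of _ "m * C"]) (metis diff_self le_less mult_zero_right)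
qed

lemma at_top_exists_ge:
  fixes P :: "real \<Rightarrow> bool"
  assumes "eventually P at_top" obtains t where "a \<le> t" "P t"
  using assms unfolding eventually_at_top_linorder by (metis linear order_refl)

text \<open>In the variable \<open>s = r powr \<alpha> / \<alpha>\<close>, \<open>\<alpha> = (p - d) / (p - 1)\<close>, the radial equation is the system
  \<open>U' = - V powr m\<close>, \<open>V' = - h s * G U\<close> with \<open>U 0 = 1\<close>, \<open>V 0 = k\<close>, whose integral form is \<open>u = S k u\<close>.
  Existence for the critical shooting parameter \<open>k\<close> only uses monotone iteration: \<open>S k\<close> is monotone
  in \<open>u\<close>, and antitone in \<open>k\<close>.\<close>

locale shooting =
  fixes h G :: "real \<Rightarrow> real" and m :: real
  assumes h_cont: "continuous_on {0..} h"
    and h_mono: "\<And>s t. 0 \<le> s \<Longrightarrow> s \<le> t \<Longrightarrow> h s \<le> h t"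
    and h_nonneg: "\<And>s. 0 \<le> s \<Longrightarrow> 0 \<le> h s"
    and h_pos: "\<And>s. 0 < s \<Longrightarrow> 0 < h s"
    and G_cont: "continuous_on UNIV G"
    and G_mono: "\<And>x y. x \<le> y \<Longrightarrow> G x \<le> G y"
    and G_nonneg: "\<And>x. 0 \<le> G x"
    and G_le1: "\<And>x. x \<le> 1 \<Longrightarrow> G x \<le> 1"
    and G_pos: "\<And>x. 0 < x \<Longrightarrow> 0 < G x"
    and G_lip: "\<And>e. 0 < e \<Longrightarrow> \<exists>C. \<forall>x\<in>{e..1}. \<forall>y\<in>{e..1}. \<bar>G x - G y\<bar> \<le> C * \<bar>x - y\<bar>"
    and m_pos: "0 < m"
begin

text \<open>This is the flux before truncation, and it may become negative. The cut-off at 0 in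
  \<open>S\<close> freezes a fixed point once its flux is used up, so that it never turns
  upward.\<close>

definition W :: "real \<Rightarrow> (real \<Rightarrow> real) \<Rightarrow> real \<Rightarrow> real" where
  "W k u t = k - integral {0..t} (\<lambda>\<tau>. h \<tau> * G (u \<tau>))"

definition S :: "real \<Rightarrow> (real \<Rightarrow> real) \<Rightarrow> real \<Rightarrow> real" where
  "S k u s = 1 - integral {0..s} (\<lambda>t. max 0 (W k u t) powr m)"

text \<open>Integrability is required rather than continuity of \<open>u\<close>, because pointwise
  limits of iterates must be admissible before they are known to be continuous.\<close>

definition adm :: "(real \<Rightarrow> real) \<Rightarrow> bool" where
  "adm u \<longleftrightarrow> (\<forall>s\<ge>0. u s \<le> 1) \<and> (\<forall>T. (\<lambda>\<tau>. h \<tau> * G (u \<tau>)) integrable_on {0..T})"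

section \<open>Continuity and order properties of the shooting operator\<close>

lemma h_int: "h integrable_on {0..T}"
  by (intro integrable_continuous_real continuous_on_subset[OF h_cont]) auto

lemma adm_cont:
  assumes "continuous_on {0..} u" "\<And>s. 0 \<le> s \<Longrightarrow> u s \<le> 1"
  shows "adm u"
proof -
  have "continuous_on {0..T} (\<lambda>\<tau>. h \<tau> * G (u \<tau>))" for T
    by (intro continuous_intros continuous_on_subset[OF h_cont] continuous_on_compose2[OF G_cont]
        continuous_on_subset[OF assms(1)]) auto
  then show ?thesis using assms(2) unfolding adm_def by (auto intro: integrable_continuous_real)
qed

lemma W_cont: assumes "adm u" shows "continuous_on {0..} (W k u)"
proof -
  have "continuous_on {0..T} (\<lambda>t. W k u t)" for T
    unfolding W_def using assms unfolding adm_def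
    by (intro continuous_intros indefinite_integral_continuous_1) auto
  then have "isCont (W k u) t" if "t > 0" for t
    by (rule continuous_on_interior[of "{0..t+1}"]) (use that in auto)
  moreover have "continuous (at 0 within {0..}) (W k u)"
  proof -
    have "continuous (at 0 within {0..1}) (W k u)"
      using \<open>\<And>T. continuous_on {0..T} (\<lambda>t. W k u t)\<close>[of 1] by (auto simp: continuous_on_eq_continuous_within)
    moreover have "at (0::real) within {0..1} = at 0 within {0..}"
      by (rule at_within_nhd[of _ "{..<1}"]) auto
    ultimately show ?thesis by simp
  qed
  ultimately show ?thesis
    unfolding continuous_on_eq_continuous_within
    by (metis atLeast_iff continuous_at_imp_continuous_at_within order_le_less)
qed

lemma W_antimono: assumes "adm u" "0 \<le> s" "s \<le> t" shows "W k u t \<le> W k u s"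
  unfolding W_def using assms h_nonneg G_nonneg unfolding adm_def
  by (auto intro!: integral_subset_le)

lemma W_le: assumes "adm u" "0 \<le> t" shows "W k u t \<le> k"
  using W_antimono[OF assms(1) order_refl assms(2), of k] by (simp add: W_def)

lemma W_ge: assumes "adm u" "0 \<le> t" shows "k - integral {0..t} h \<le> W k u t"
proof -
  have "integral {0..t} (\<lambda>\<tau>. h \<tau> * G (u \<tau>)) \<le> integral {0..t} h"
    using assms unfolding adm_def
    by (intro integral_le h_int) (auto intro!: mult_left_le G_le1 h_nonneg)
  then show ?thesis by (simp add: W_def)
qed

text \<open>Flux is absorbed at the rate \<open>h * G u\<close>, so a larger function leaves less of
  it. One more change of sign makes \<open>S\<close> monotone in the function and antitone in the
  parameter.\<close>

lemma W_mono: assumes "adm u" "adm v" "\<And>s. 0 \<le> s \<Longrightarrow> v s \<le> u s" "k \<le> l" "0 \<le> t"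
  shows "W k u t \<le> W l v t"
proof -
  have "integral {0..t} (\<lambda>\<tau>. h \<tau> * G (v \<tau>)) \<le> integral {0..t} (\<lambda>\<tau>. h \<tau> * G (u \<tau>))"
    using assms unfolding adm_def
    by (intro integral_le) (auto intro!: mult_left_mono G_mono h_nonneg)
  then show ?thesis using assms by (simp add: W_def)
qed

lemma Wp_cont: assumes "adm u" shows "continuous_on {0..} (\<lambda>t. max 0 (W k u t) powr m)"
  by (intro continuous_on_powr' continuous_intros W_cont assms) (use m_pos in auto)

lemma Wp_int: assumes "adm u" "0 \<le> a" shows "(\<lambda>t. max 0 (W k u t) powr m) integrable_on {a..b}"
  by (intro integrable_continuous_real continuous_on_subset[OF Wp_cont[OF assms(1)]]) (use assms in auto)

lemma S_cont: assumes "adm u" shows "continuous_on {0..} (S k u)"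
proof -
  have *: "continuous_on {0..T} (\<lambda>t. S k u t)" for T
    unfolding S_def by (intro continuous_intros indefinite_integral_continuous_1 Wp_int assms) auto
  then have "isCont (S k u) t" if "t > 0" for t
    by (rule continuous_on_interior[of "{0..t+1}"]) (use that in auto)
  moreover have "continuous (at 0 within {0..}) (S k u)"
  proof -
    have "continuous (at 0 within {0..1}) (S k u)"
      using *[of 1] by (auto simp: continuous_on_eq_continuous_within)
    moreover have "at (0::real) within {0..1} = at 0 within {0..}"
      by (rule at_within_nhd[of _ "{..<1}"]) auto
    ultimately show ?thesis by simp
  qed
  ultimately show ?thesis
    unfolding continuous_on_eq_continuous_within
    by (metis atLeast_iff continuous_at_imp_continuous_at_within order_le_less)
qed

lemma S_antimono: assumes "adm u" "0 \<le> s" "s \<le> t" shows "S k u t \<le> S k u s"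
  unfolding S_def using assms by (auto intro!: integral_subset_le Wp_int)

lemma S_le1: assumes "adm u" "0 \<le> s" shows "S k u s \<le> 1"
  using S_antimono[OF assms(1) order_refl assms(2), of k] by (simp add: S_def)

lemma S_adm: "adm u \<Longrightarrow> adm (S k u)"
  by (rule adm_cont[OF S_cont S_le1])

lemma S_mono: assumes "adm u" "adm v" "\<And>s. 0 \<le> s \<Longrightarrow> u s \<le> v s" "l \<le> k" "0 \<le> s"
  shows "S k u s \<le> S l v s"
proof -
  have "integral {0..s} (\<lambda>t. max 0 (W l v t) powr m) \<le> integral {0..s} (\<lambda>t. max 0 (W k u t) powr m)"
    by (intro integral_le Wp_int assms powr_mono2 max.mono order_refl W_mono) (use assms m_pos in auto)
  then show ?thesis by (simp add: S_def)
qed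

lemma S_ge: assumes "adm u" "0 \<le> s" "0 \<le> k" shows "1 - k powr m * s \<le> S k u s"
proof -
  have "integral {0..s} (\<lambda>t. max 0 (W k u t) powr m) \<le> integral {0..s} (\<lambda>t. k powr m)"
    by (intro integral_le Wp_int assms powr_mono2) (use assms m_pos W_le in auto)
  then show ?thesis using assms by (simp add: S_def mult.commute)
qed

section \<open>Stability of the operator under pointwise limits\<close>

lemma W_limit:
  assumes u: "\<And>n. adm (u n)" and lim: "\<And>s. 0 \<le> s \<Longrightarrow> (\<lambda>n. u n s) \<longlonglongrightarrow> v s"
    and k: "kk \<longlonglongrightarrow> k"
  shows "adm v" and "0 \<le> t \<Longrightarrow> (\<lambda>n. W (kk n) (u n) t) \<longlonglongrightarrow> W k v t"
proof -
  have G: "(\<lambda>n. G (u n s)) \<longlonglongrightarrow> G (v s)" if "0 \<le> s" for s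
    using G_cont by (intro isCont_tendsto_compose[OF _ lim[OF that]]) (simp add: continuous_on_eq_continuous_at)
  have hG: "(\<lambda>n. h s * G (u n s)) \<longlonglongrightarrow> h s * G (v s)" if "0 \<le> s" for s
    by (intro tendsto_intros G that)
  \<comment> \<open>The upper bound 1 on admissible functions is what makes \<open>h\<close> itself
    an integrable majorant.\<close>
  have bd: "norm (h s * G (u n s)) \<le> h s" if "0 \<le> s" for n s
    using u[of n] that h_nonneg[OF that] G_nonneg[of "u n s"] G_le1[of "u n s"]
    by (auto simp: adm_def abs_mult intro!: mult_left_le)
  have D: "(\<lambda>\<tau>. h \<tau> * G (v \<tau>)) integrable_on {0..T}"
    "(\<lambda>n. integral {0..T} (\<lambda>\<tau>. h \<tau> * G (u n \<tau>))) \<longlonglongrightarrow> integral {0..T} (\<lambda>\<tau>. h \<tau> * G (v \<tau>))" for T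
    using dominated_convergence[of "\<lambda>n \<tau>. h \<tau> * G (u n \<tau>)" "{0..T}" h "\<lambda>\<tau>. h \<tau> * G (v \<tau>)"]
      u bd hG h_int unfolding adm_def by auto
  show "adm v" unfolding adm_def
    using D(1) LIMSEQ_le_const2[OF lim] u unfolding adm_def by blast
  show "(\<lambda>n. W (kk n) (u n) t) \<longlonglongrightarrow> W k v t" if "0 \<le> t"
    unfolding W_def by (intro tendsto_intros k D(2))
qed

lemma S_limit:
  assumes u: "\<And>n. adm (u n)" and lim: "\<And>s. 0 \<le> s \<Longrightarrow> (\<lambda>n. u n s) \<longlonglongrightarrow> v s"
    and k: "kk \<longlonglongrightarrow> k" and s: "0 \<le> s"
  shows "(\<lambda>n. S (kk n) (u n) s) \<longlonglongrightarrow> S k v s"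
proof -
  obtain K where K: "\<And>n. kk n \<le> K"
    using convergent_imp_Bseq[OF convergentI[OF k]] unfolding Bseq_def real_norm_def by (metis abs_le_D1)
  note W = W_limit[OF u lim k]
  have c: "(\<lambda>n. max 0 (W (kk n) (u n) t) powr m) \<longlonglongrightarrow> max 0 (W k v t) powr m" if "0 \<le> t" for t
    by (intro tendsto_powr' tendsto_intros W that) (use m_pos in auto)
  have "(\<lambda>n. integral {0..s} (\<lambda>t. max 0 (W (kk n) (u n) t) powr m)) \<longlonglongrightarrow>
     integral {0..s} (\<lambda>t. max 0 (W k v t) powr m)"
  proof (rule dominated_convergence(2)[where h = "\<lambda>_. max 0 K powr m"])
    fix n t assume "t \<in> {0..s}"
    then show "norm (max 0 (W (kk n) (u n) t) powr m) \<le> max 0 K powr m"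
      using W_le[OF u, of t "kk n" n] K[of n] m_pos by (auto intro!: powr_mono2)
  qed (use u c in \<open>auto intro: Wp_int\<close>)
  then show ?thesis unfolding S_def by (intro tendsto_intros)
qed

section \<open>Monotone iteration from above\<close>

definition it :: "real \<Rightarrow> nat \<Rightarrow> real \<Rightarrow> real" where
  "it k n = (S k ^^ n) (\<lambda>_. 1)"

lemma it_simps: "it k 0 = (\<lambda>_. 1)" "it k (Suc n) = S k (it k n)"
  by (auto simp: it_def)

lemma it_adm: "adm (it k n)"
  by (induction n) (auto simp: it_simps intro: S_adm adm_cont)

lemma it_Suc_le: "0 \<le> s \<Longrightarrow> it k (Suc n) s \<le> it k n s"
proof (induction n arbitrary: s)
  case 0 then show ?case using S_le1[OF it_adm[of k 0], of s k] by (simp add: it_simps)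
next
  case (Suc n) then show ?case
    by (subst it_simps, subst (2) it_simps) (intro S_mono it_adm Suc.IH order_refl)
qed

lemma it_decreasing: "0 \<le> s \<Longrightarrow> decseq (\<lambda>n. it k n s)"
  by (intro decseq_SucI it_Suc_le)

text \<open>A lower bound uniform in \<open>n\<close> is what the decreasing iterates need in order
  to converge.\<close>

lemma it_ge: assumes "0 \<le> s" "0 \<le> k" shows "1 - k powr m * s \<le> it k n s"
proof (cases n)
  case (Suc n') then show ?thesis using S_ge[OF it_adm assms] by (simp add: it_simps)
qed (use assms in \<open>auto simp: it_simps\<close>)

definition sol :: "real \<Rightarrow> real \<Rightarrow> real" where
  "sol k s = lim (\<lambda>n. it k n s)"

lemma it_lim: assumes "0 \<le> s" "0 \<le> k" shows "(\<lambda>n. it k n s) \<longlonglongrightarrow> sol k s"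
proof -
  have "convergent (\<lambda>n. it k n s)"
    using decseq_convergent[OF it_decreasing[OF assms(1), of k], of "1 - k powr m * s"] it_ge[OF assms]
    unfolding convergent_def by blast
  then show ?thesis by (simp add: sol_def convergent_LIMSEQ_iff)
qed

lemma sol_adm: "0 \<le> k \<Longrightarrow> adm (sol k)"
  by (rule W_limit(1)[OF it_adm[of k] it_lim tendsto_const]) auto

lemma sol_fix: assumes "0 \<le> k" "0 \<le> s" shows "S k (sol k) s = sol k s"
proof -
  have "(\<lambda>n. S k (it k n) s) \<longlonglongrightarrow> S k (sol k) s"
    by (rule S_limit[OF it_adm[of k] it_lim tendsto_const]) (use assms in auto)
  moreover have "(\<lambda>n. S k (it k n) s) \<longlonglongrightarrow> sol k s"
    using LIMSEQ_Suc[OF it_lim[OF assms(2,1)]] by (simp add: it_simps)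
  ultimately show ?thesis by (rule LIMSEQ_unique)
qed

lemma sol_mono: assumes "0 \<le> k" "k \<le> l" "0 \<le> s" shows "sol l s \<le> sol k s"
proof -
  have "it l n s \<le> it k n s" if "0 \<le> s" for n s
    using that
    by (induction n arbitrary: s) (auto simp: it_simps assms intro!: S_mono it_adm)
  then show ?thesis using assms by (intro LIMSEQ_le[OF it_lim it_lim]) auto
qed

definition isfix :: "real \<Rightarrow> (real \<Rightarrow> real) \<Rightarrow> bool" where
  "isfix k u \<longleftrightarrow> adm u \<and> (\<forall>s\<ge>0. S k u s = u s)"

lemma sol_isfix: "0 \<le> k \<Longrightarrow> isfix k (sol k)"
  by (auto simp: isfix_def sol_adm sol_fix)

text \<open>Used for parameters increasing and for parameters decreasing to the critical one, where
  the two limits cannot be identified in advance.\<close>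

lemma fix_limit:
  assumes "\<And>n. isfix (kk n) (u n)" "\<And>s. 0 \<le> s \<Longrightarrow> (\<lambda>n. u n s) \<longlonglongrightarrow> v s" "kk \<longlonglongrightarrow> k"
  shows "isfix k v"
proof -
  have a: "\<And>n. adm (u n)" using assms(1) by (auto simp: isfix_def)
  have "S k v s = v s" if "0 \<le> s" for s
    using S_limit[OF a assms(2,3) that] assms(1) that
    by (intro LIMSEQ_unique[OF _ assms(2)[OF that]]) (auto simp: isfix_def)
  then show ?thesis using W_limit(1)[OF a assms(2,3)] by (auto simp: isfix_def)
qed

lemma fix_props:
  assumes "isfix k u"
  shows "adm u" "continuous_on {0..} u" "u 0 = 1" "\<And>s t. 0 \<le> s \<Longrightarrow> s \<le> t \<Longrightarrow> u t \<le> u s"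
    "\<And>s. 0 \<le> s \<Longrightarrow> u s \<le> 1"
proof -
  show a: "adm u" using assms by (simp add: isfix_def)
  have e: "\<And>s. 0 \<le> s \<Longrightarrow> u s = S k u s" using assms by (simp add: isfix_def)
  show "continuous_on {0..} u" using S_cont[OF a, of k] e by (subst continuous_on_cong[OF refl e]) auto
  show "u 0 = 1" using e[of 0] by (simp add: S_def)
  show "\<And>s t. 0 \<le> s \<Longrightarrow> s \<le> t \<Longrightarrow> u t \<le> u s" using S_antimono[OF a, of _ _ k] e by auto
  show "\<And>s. 0 \<le> s \<Longrightarrow> u s \<le> 1" using S_le1[OF a, of _ k] e by auto
qed

lemma fix_diff:
  assumes "isfix k u" "0 \<le> s" "s \<le> t"
  shows "u s - u t = integral {s..t} (\<lambda>r. max 0 (W k u r) powr m)"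
proof -
  have e: "\<And>s. 0 \<le> s \<Longrightarrow> u s = S k u s" using assms by (simp add: isfix_def)
  have "integral {0..s} (\<lambda>r. max 0 (W k u r) powr m) + integral {s..t} (\<lambda>r. max 0 (W k u r) powr m)
    = integral {0..t} (\<lambda>r. max 0 (W k u r) powr m)"
    by (intro Henstock_Kurzweil_Integration.integral_combine Wp_int fix_props(1)[OF assms(1)])
      (use assms in auto)
  then show ?thesis using e[of s] e[of t] assms by (simp add: S_def)
qed

lemma W_diff:
  assumes "adm u" "0 \<le> s" "s \<le> t"
  shows "W k u s - W k u t = integral {s..t} (\<lambda>\<tau>. h \<tau> * G (u \<tau>))"
proof -
  have "integral {0..s} (\<lambda>\<tau>. h \<tau> * G (u \<tau>)) + integral {s..t} (\<lambda>\<tau>. h \<tau> * G (u \<tau>))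
    = integral {0..t} (\<lambda>\<tau>. h \<tau> * G (u \<tau>))"
    using assms unfolding adm_def by (intro Henstock_Kurzweil_Integration.integral_combine) auto
  then show ?thesis by (simp add: W_def)
qed

lemma hG_int: assumes "adm u" "0 \<le> s" shows "(\<lambda>\<tau>. h \<tau> * G (u \<tau>)) integrable_on {s..t}"
  using assms unfolding adm_def by (meson atLeastatMost_subset_iff integrable_on_subinterval order_refl)

text \<open>The flux only decreases, so after it has reached 0 the truncated integrand
  vanishes.\<close>

lemma const_after:
  assumes "isfix k u" "W k u a \<le> 0" "0 \<le> a" "a \<le> s"
  shows "u s = u a"
proof -
  have "integral {a..s} (\<lambda>r. max 0 (W k u r) powr m) = integral {a..s} (\<lambda>r. 0)"
  proof (rule integral_cong)
    fix r assume "r \<in> {a..s}"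
    then have "W k u r \<le> 0" using W_antimono[OF fix_props(1)[OF assms(1)], of a r k] assms by auto
    then show "max 0 (W k u r) powr m = 0" using m_pos by simp
  qed
  then show ?thesis using fix_diff[OF assms(1,3,4)] by simp
qed

text \<open>Away from 0 both nonlinearities are Lipschitz, so two solutions that agree up to a point
  agree a little further: on an interval of length \<delta> the gap \<open>D\<close> is at most
  \<delta> * \<delta> * B times its own final value. The order of the two solutions makes
  \<open>D\<close> nondecreasing, which takes the place of a Gronwall argument.\<close>

lemma unique_while_positive:
  assumes u: "isfix k u" and v: "isfix k v" and le: "\<And>s. 0 \<le> s \<Longrightarrow> v s \<le> u s"
    and l: "0 < l" "\<And>s. 0 \<le> s \<Longrightarrow> l \<le> u s"
    and W: "\<And>s. 0 \<le> s \<Longrightarrow> s < s0 \<Longrightarrow> 0 < W k u s"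
    and s1: "0 \<le> s1" "s1 < s0"
  shows "v s1 = u s1"
proof (rule ccontr)
  assume neq: "v s1 \<noteq> u s1"
  note pu = fix_props[OF u] and pv = fix_props[OF v]
  define D where "D s = u s - v s" for s
  have Wle: "W k u t \<le> W k v t" if "0 \<le> t" for t
    using W_mono[OF pu(1) pv(1) le order_refl that] by simp
  have Ddiff: "D t - D s = integral {s..t} (\<lambda>r. max 0 (W k v r) powr m - max 0 (W k u r) powr m)"
    if "0 \<le> s" "s \<le> t" for s t
    using fix_diff[OF u that] fix_diff[OF v that]
    by (subst Henstock_Kurzweil_Integration.integral_diff)
      (use that pu(1) pv(1) in \<open>auto simp: D_def intro!: Wp_int\<close>)
  have Dmono: "D s \<le> D t" if "0 \<le> s" "s \<le> t" for s t
  proof -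
    have "0 \<le> integral {s..t} (\<lambda>r. max 0 (W k v r) powr m - max 0 (W k u r) powr m)"
      by (intro Henstock_Kurzweil_Integration.integral_nonneg integrable_diff Wp_int pu(1) pv(1))
        (use that m_pos Wle in \<open>auto intro!: powr_mono2 max.mono\<close>)
    then show ?thesis using Ddiff[OF that] by simp
  qed
  \<comment> \<open>Its maximum \<open>a\<close> is the last point up to \<open>s1\<close> where the
    solutions agree.\<close>
  define Z where "Z = {s\<in>{0..s1}. D s = 0}"
  have "continuous_on {0..s1} D" unfolding D_def
    by (intro continuous_intros continuous_on_subset[OF pu(2)] continuous_on_subset[OF pv(2)]) auto
  then have "closedin (top_of_set {0..s1}) Z"
    unfolding Z_def by (rule continuous_closedin_preimage_constant)
  then have "compact Z" using closedin_compact compact_Icc by blast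
  moreover have "0 \<in> Z" using s1 pu(3) pv(3) by (simp add: Z_def D_def)
  ultimately obtain a where a: "a \<in> Z" "\<And>z. z \<in> Z \<Longrightarrow> z \<le> a"
    using compact_attains_sup[of Z] by blast
  have a1: "0 \<le> a" "a < s1" "D a = 0"
    using a(1) neq unfolding Z_def D_def by (auto simp: order_le_less)
  have D0: "D s = 0" if "0 \<le> s" "s \<le> a" for s
    using Dmono[OF that] a1 le[OF that(1)] by (simp add: D_def)
  have Weq: "W k v a = W k u a"
    unfolding W_def using D0 by (auto simp: D_def intro!: integral_cong)
  \<comment> \<open>Both fluxes lie between \<open>e\<close> and \<open>k\<close> up to
    \<open>s1\<close>, a range on which the power \<open>m\<close> is Lipschitz.\<close>
  define e where "e = W k u s1"
  have e: "0 < e" using W[OF s1] by (simp add: e_def)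
  obtain Cm where Cm: "0 \<le> Cm" "\<And>x y. x \<in> {e..k} \<Longrightarrow> y \<in> {e..k} \<Longrightarrow> x \<le> y \<Longrightarrow> y powr m - x powr m \<le> Cm * (y - x)"
    using powr_lip[OF m_pos e, of k] by blast
  have "0 < l / 2" using l by simp
  from G_lip[OF this] obtain CG
    where CG: "\<And>x y. x \<in> {l/2..1} \<Longrightarrow> y \<in> {l/2..1} \<Longrightarrow> \<bar>G x - G y\<bar> \<le> CG * \<bar>x - y\<bar>"
    by blast
  define C where "C = max CG 0"
  have C: "0 \<le> C" by (simp add: C_def)
  have C2: "G x - G y \<le> C * (x - y)" if "x \<in> {l/2..1}" "y \<in> {l/2..1}" "y \<le> x" for x y
  proof -
    have "G x - G y \<le> CG * (x - y)" using CG[OF that(1,2)] that(3) by simp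
    also have "\<dots> \<le> C * (x - y)" using that by (intro mult_right_mono) (auto simp: C_def)
    finally show ?thesis .
  qed
  have va: "l \<le> v a" using l(2)[of a] a1 by (simp add: D_def)
  have "continuous (at a within {0..}) v" using pv(2) a1 by (auto simp: continuous_on_eq_continuous_within)
  then obtain d1 where d1: "0 < d1" "\<And>s. 0 \<le> s \<Longrightarrow> \<bar>s - a\<bar> < d1 \<Longrightarrow> \<bar>v s - v a\<bar> < l / 2"
    using l unfolding continuous_within_eps_delta dist_real_def by (metis atLeast_iff half_gt_zero)
  define B where "B = Cm * h s1 * C"
  have B: "0 \<le> B" unfolding B_def using Cm C h_nonneg s1 by simp
  \<comment> \<open>The three terms keep \<open>v\<close> above \<open>l / 2\<close>, keep the
    interval to the left of \<open>s1\<close>, and make \<delta> * \<delta> * B smaller than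
    1.\<close>
  define \<delta> where "\<delta> = min (min (d1/2) (s1 - a)) (1 / (B + 1))"
  have dl: "0 < \<delta>" "\<delta> < d1" "a + \<delta> \<le> s1" using d1 a1 B by (auto simp: \<delta>_def)
  have "\<delta> * (B + 1) \<le> 1" using B by (auto simp: \<delta>_def min_def field_simps)
  moreover have "\<delta> \<le> 1"
  proof -
    have "\<delta> \<le> 1 / (B + 1)" by (simp add: \<delta>_def)
    also have "\<dots> \<le> 1" using B by simp
    finally show ?thesis .
  qed
  ultimately have dB: "\<delta> * \<delta> * B < 1"
  proof -
    have "\<delta> * B < 1" using dl(1) \<open>\<delta> * (B + 1) \<le> 1\<close> by (simp add: distrib_left)
    moreover have "\<delta> * (\<delta> * B) \<le> 1 * (\<delta> * B)" using dl(1) B \<open>\<delta> \<le> 1\<close> by (intro mult_right_mono) auto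
    ultimately show ?thesis by (simp add: mult.assoc)
  qed
  define s where "s = a + \<delta>"
  have Ds: "0 < D s"
  proof (rule ccontr)
    assume "\<not> 0 < D s"
    then have "s \<in> Z" using Dmono[of a s] a1 dl by (simp add: Z_def s_def)
    then show False using a(2)[of s] dl by (simp add: s_def)
  qed
  have vl: "l / 2 \<le> v t" "v t \<le> 1" if "a \<le> t" "t \<le> s" for t
  proof -
    have "\<bar>v t - v a\<bar> < l / 2" using d1(2)[of t] that a1 dl by (auto simp: s_def)
    then show "l / 2 \<le> v t" using va unfolding abs_less_iff by linarith
    show "v t \<le> 1" using pv(5)[of t] that a1 by simp
  qed
  have Wd: "W k v t - W k u t \<le> \<delta> * (h s1 * C * D s)" if t: "a \<le> t" "t \<le> s" for t
  proof -
    have "W k v t - W k u t = integral {a..t} (\<lambda>\<tau>. h \<tau> * G (u \<tau>)) - integral {a..t} (\<lambda>\<tau>. h \<tau> * G (v \<tau>))"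
      using W_diff[OF pu(1) a1(1) t(1), of k] W_diff[OF pv(1) a1(1) t(1), of k] Weq by simp
    also have "\<dots> = integral {a..t} (\<lambda>\<tau>. h \<tau> * G (u \<tau>) - h \<tau> * G (v \<tau>))"
      by (subst Henstock_Kurzweil_Integration.integral_diff) (use a1 pu(1) pv(1) in \<open>auto intro!: hG_int\<close>)
    also have "\<dots> \<le> integral {a..t} (\<lambda>\<tau>. h s1 * (C * D s))"
    proof (intro integral_le integrable_diff hG_int pu(1) pv(1) a1)
      fix \<tau> assume \<tau>: "\<tau> \<in> {a..t}"
      have "G (u \<tau>) - G (v \<tau>) \<le> C * (u \<tau> - v \<tau>)"
        using vl[of \<tau>] \<tau> t a1 le[of \<tau>] pu(5)[of \<tau>] by (intro C2) auto
      also have "\<dots> \<le> C * D s"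
        using Dmono[of \<tau> s] \<tau> t a1 C by (intro mult_left_mono) (auto simp: D_def)
      finally have "h \<tau> * (G (u \<tau>) - G (v \<tau>)) \<le> h s1 * (C * D s)"
        using \<tau> t a1 dl Ds C by (intro mult_mono h_mono h_nonneg) (auto simp: s_def G_mono le)
      then show "h \<tau> * G (u \<tau>) - h \<tau> * G (v \<tau>) \<le> h s1 * (C * D s)" by (simp add: algebra_simps)
    qed auto
    also have "\<dots> = (t - a) * (h s1 * C * D s)" using t by (simp add: mult.assoc)
    also have "\<dots> \<le> \<delta> * (h s1 * C * D s)"
      using t h_nonneg[of s1] s1 C Ds by (intro mult_right_mono) (auto simp: s_def)
    finally show ?thesis .
  qed
  have "D s = integral {a..s} (\<lambda>r. max 0 (W k v r) powr m - max 0 (W k u r) powr m)"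
    using Ddiff[of a s] a1 dl by (simp add: s_def)
  also have "\<dots> \<le> integral {a..s} (\<lambda>r. Cm * (\<delta> * (h s1 * C * D s)))"
  proof (intro integral_le integrable_diff Wp_int pu(1) pv(1) a1)
    fix r assume r: "r \<in> {a..s}"
    have "e \<le> W k u r" unfolding e_def using r a1 dl by (intro W_antimono pu(1)) (auto simp: s_def)
    moreover have "W k v r \<le> k" using r a1 by (intro W_le pv(1)) auto
    ultimately have "W k v r powr m - W k u r powr m \<le> Cm * (W k v r - W k u r)"
      using Wle[of r] r a1 by (intro Cm(2)) auto
    also have "\<dots> \<le> Cm * (\<delta> * (h s1 * C * D s))"
      using r Cm(1) by (intro mult_left_mono Wd) auto
    finally show "max 0 (W k v r) powr m - max 0 (W k u r) powr m \<le> Cm * (\<delta> * (h s1 * C * D s))"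
      using \<open>e \<le> W k u r\<close> Wle[of r] r a1 e by (simp add: max_def)
  qed auto
  also have "\<dots> = (\<delta> * \<delta> * B) * D s" using dl by (simp add: s_def B_def)
  also have "\<dots> < D s" using dB Ds by simp
  finally show False by simp
qed

section \<open>The critical shooting parameter\<close>

lemma hG_ge:
  assumes "adm u" "0 \<le> s" "s \<le> t" "\<And>r. r \<in> {s..t} \<Longrightarrow> l \<le> u r"
  shows "(t - s) * (h s * G l) \<le> integral {s..t} (\<lambda>\<tau>. h \<tau> * G (u \<tau>))"
proof -
  have "integral {s..t} (\<lambda>\<tau>. h s * G l) \<le> integral {s..t} (\<lambda>\<tau>. h \<tau> * G (u \<tau>))"
    using assms by (intro integral_le hG_int) (auto intro!: mult_mono h_mono G_mono h_nonneg G_nonneg)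
  then show ?thesis using assms by (simp add: mult_ac)
qed

text \<open>Exhaustion of the flux ends the descent, so nonnegativity on the whole half-line can be
  read off at one finite point.\<close>

lemma pos_beyond:
  assumes "isfix k u" "0 \<le> a" "W k u a \<le> 0" "0 \<le> u a" "0 \<le> s"
  shows "0 \<le> u s"
  using const_after[OF assms(1,3,2), of s] fix_props(4)[OF assms(1,5), of a] assms by (cases "a \<le> s") auto

text \<open>For small \<open>k\<close> the flux is exhausted while the solution is still positive;
  for large \<open>k\<close> the solution crosses 0. The critical value is the supremum of the
  parameters with nonnegative solution: exhaustion at a positive level survives a small increase of
  the parameter, so it cannot happen there, and the solution has to decay to 0.\<close>

lemma critical_exists:
  obtains k u where "0 < k" "isfix k u" "\<And>s. 0 \<le> s \<Longrightarrow> 0 \<le> u s" "(u \<longlongrightarrow> 0) at_top"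
proof -
  \<comment> \<open>\<open>H\<close> bounds the flux that can be absorbed on [0, 1].\<close>
  define H where "H = integral {0..1} h"
  have H: "0 < H"
  proof -
    have one: "adm (\<lambda>_. 1)" by (rule adm_cont) auto
    have "0 < (1 - 1/2) * (h (1/2) * G 1)" using h_pos[of "1/2"] G_pos[of 1] by simp
    also have "\<dots> \<le> integral {1/2..1} (\<lambda>\<tau>. h \<tau> * G 1)"
      by (rule hG_ge[OF one]) auto
    also have "\<dots> \<le> integral {1/2..1} h"
    proof (rule integral_le)
      show "h integrable_on {1/2..1}"
        by (intro integrable_continuous_real continuous_on_subset[OF h_cont]) auto
      show "h x * G 1 \<le> h x" if "x \<in> {1/2..1}" for x
        using that by (intro mult_left_le G_le1 h_nonneg) auto
    qed (rule hG_int[OF one], simp)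
    also have "\<dots> \<le> H" unfolding H_def
      by (intro integral_subset_le integrable_continuous_real continuous_on_subset[OF h_cont]) (auto intro: h_nonneg)
    finally show ?thesis .
  qed
  define K where "K = {k. 0 \<le> k \<and> (\<forall>s\<ge>0. 0 \<le> sol k s)}"
  \<comment> \<open>The second term keeps the solution above 1/2 on [0, 1]; the first then lets it
    exhaust its flux there.\<close>
  define k0 where "k0 = min (G (1/2) * H) ((1/2) powr (1/m))"
  have k0: "0 < k0" using H G_pos[of "1/2"] by (simp add: k0_def)
  have "k0 \<in> K"
  proof -
    have f: "isfix k0 (sol k0)" using k0 by (intro sol_isfix) simp
    have "k0 powr m \<le> ((1/2) powr (1/m)) powr m" using k0 m_pos by (intro powr_mono2) (auto simp: k0_def)
    then have km: "k0 powr m \<le> 1/2" using m_pos by (simp add: powr_powr)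
    have half: "1/2 \<le> sol k0 s" if "0 \<le> s" "s \<le> 1" for s
    proof -
      have "1 - k0 powr m * s \<le> sol k0 s"
        using S_ge[OF fix_props(1)[OF f] that(1), of k0] sol_fix[of k0 s] k0 that by simp
      moreover have "k0 powr m * s \<le> 1/2 * 1" using km that by (intro mult_mono) auto
      ultimately show ?thesis by simp
    qed
    have "G (1/2) * H = integral {0..1} (\<lambda>\<tau>. h \<tau> * G (1/2))" by (simp add: H_def)
    also have "\<dots> \<le> integral {0..1} (\<lambda>\<tau>. h \<tau> * G (sol k0 \<tau>))"
      using half by (intro integral_le hG_int fix_props(1)[OF f] integrable_on_mult_left h_int)
        (auto intro!: mult_left_mono h_nonneg G_mono)
    finally have "W k0 (sol k0) 1 \<le> 0" by (auto simp: W_def k0_def)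
    then show ?thesis using pos_beyond[OF f, of 1] half[of 1] k0 by (auto simp: K_def)
  qed
  \<comment> \<open>At most \<open>H\<close> of the flux is lost on [0, 1], so for
    \<open>k > H + 1\<close> the solution falls by more than 1 there.\<close>
  have Kbd: "k \<le> H + 1" if "k \<in> K" for k
  proof (rule ccontr)
    assume k: "\<not> k \<le> H + 1"
    have f: "isfix k (sol k)" using that by (intro sol_isfix) (simp add: K_def)
    have "1 < (k - H) powr m" using k m_pos by (intro gr_one_powr) auto
    also have "(k - H) powr m = integral {0..1::real} (\<lambda>r. (k - H) powr m)" by simp
    also have "\<dots> \<le> integral {0..1} (\<lambda>r. max 0 (W k (sol k) r) powr m)"
    proof (intro integral_le Wp_int fix_props(1)[OF f] powr_mono2)
      fix r :: real assume r: "r \<in> {0..1}"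
      have "integral {0..r} h \<le> H" unfolding H_def
        using r by (intro integral_subset_le h_int) (auto intro: h_nonneg)
      then show "k - H \<le> max 0 (W k (sol k) r)"
        using W_ge[OF fix_props(1)[OF f], of r k] r by auto
    qed (use k m_pos H in auto)
    also have "\<dots> = 1 - sol k 1" using fix_diff[OF f, of 0 1] fix_props(3)[OF f] by simp
    finally have "sol k 1 < 0" by simp
    moreover have "0 \<le> sol k 1" using that zero_le_one unfolding K_def by blast
    ultimately show False by simp
  qed
  have bdd: "bdd_above K" by (rule bdd_aboveI[OF Kbd])
  define ks where "ks = Sup K"
  have ks: "k0 \<le> ks" "0 < ks" using cSup_upper[OF \<open>k0 \<in> K\<close> bdd] k0 by (auto simp: ks_def)
  have below: "k \<in> K" if "0 \<le> k" "k < ks" for k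
  proof -
    obtain k' where "k' \<in> K" "k < k'"
      using \<open>k < ks\<close> \<open>k0 \<in> K\<close> less_cSup_iff[OF _ bdd, of k] unfolding ks_def by blast
    then have "0 \<le> sol k s" if "0 \<le> s" for s
      using sol_mono[of k k' s] that \<open>0 \<le> k\<close> by (auto simp: K_def intro: order_trans[of 0 "sol k' s"])
    then show ?thesis using that by (simp add: K_def)
  qed
  \<comment> \<open>The \<open>a n\<close> lie in \<open>K\<close> and increase to
    \<open>ks\<close>; the \<open>b n\<close> lie outside \<open>K\<close> and decrease to it. The
    limits \<open>v\<close> and \<open>w\<close> of their solutions both solve the critical problem,
    but may differ.\<close>
  define a where "a n = ks - ks * inverse (real (Suc n))" for n
  define b where "b n = ks + inverse (real (Suc n))" for n
  have aK: "a n \<in> K" for n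
    using ks by (intro below) (auto simp: a_def field_simps)
  have a0: "0 \<le> a n" for n using aK by (simp add: K_def)
  have amono: "a n \<le> a (Suc n)" for n
    unfolding a_def using ks by (intro diff_left_mono mult_left_mono le_imp_inverse_le) auto
  have alim: "a \<longlonglongrightarrow> ks"
  proof -
    have "(\<lambda>n. ks - ks * inverse (real (Suc n))) \<longlonglongrightarrow> ks - ks * 0"
      by (intro tendsto_intros LIMSEQ_inverse_real_of_nat)
    then show ?thesis by (simp add: a_def[abs_def])
  qed
  have blim: "b \<longlonglongrightarrow> ks"
  proof -
    have "(\<lambda>n. ks + inverse (real (Suc n))) \<longlonglongrightarrow> ks + 0"
      by (intro tendsto_intros LIMSEQ_inverse_real_of_nat)
    then show ?thesis by (simp add: b_def[abs_def])
  qed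
  have bK: "b n \<notin> K" for n
    using cSup_upper[OF _ bdd, of "b n"] by (auto simp: b_def ks_def[symmetric])
  have b0: "0 \<le> b n" "ks \<le> b n" for n using ks by (auto simp: b_def)
  have bmono: "b (Suc n) \<le> b n" for n unfolding b_def by (intro add_left_mono le_imp_inverse_le) auto
  define v where "v s = lim (\<lambda>n. sol (a n) s)" for s
  define w where "w s = lim (\<lambda>n. sol (b n) s)" for s
  have v: "(\<lambda>n. sol (a n) s) \<longlonglongrightarrow> v s" if "0 \<le> s" for s
  proof -
    have "decseq (\<lambda>n. sol (a n) s)" by (intro decseq_SucI sol_mono amono a0 that)
    moreover have "\<And>n. 0 \<le> sol (a n) s" using aK that by (simp add: K_def)
    ultimately have "convergent (\<lambda>n. sol (a n) s)"
      unfolding convergent_def by (metis decseq_convergent)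
    then show ?thesis by (simp add: v_def convergent_LIMSEQ_iff)
  qed
  have w: "(\<lambda>n. sol (b n) s) \<longlonglongrightarrow> w s" if "0 \<le> s" for s
  proof -
    have "incseq (\<lambda>n. sol (b n) s)" by (intro incseq_SucI sol_mono bmono b0 that)
    moreover have "\<And>n. sol (b n) s \<le> 1" using fix_props(5)[OF sol_isfix[OF b0(1)] that] .
    ultimately have "convergent (\<lambda>n. sol (b n) s)"
      unfolding convergent_def by (metis incseq_convergent)
    then show ?thesis by (simp add: w_def convergent_LIMSEQ_iff)
  qed
  have fv: "isfix ks v" by (rule fix_limit[OF sol_isfix[OF a0] v alim])
  have fw: "isfix ks w" by (rule fix_limit[OF sol_isfix[OF b0(1)] w blim])
  have wv: "w s \<le> v s" if "0 \<le> s" for s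
  proof (rule LIMSEQ_le[OF w[OF that] v[OF that]])
    have "a n \<le> b n" for n
    proof -
      have "0 \<le> ks * inverse (real (Suc n))" using ks by simp
      then show ?thesis using b0(2)[of n] unfolding a_def by linarith
    qed
    then show "\<exists>N. \<forall>n\<ge>N. sol (b n) s \<le> sol (a n) s" by (auto intro!: sol_mono a0 that)
  qed
  have v0: "0 \<le> v s" if "0 \<le> s" for s
    using aK that by (intro LIMSEQ_le_const[OF v[OF that]]) (auto simp: K_def)
  note pv = fix_props[OF fv] and pw = fix_props[OF fw]
  \<comment> \<open>If \<open>v\<close> stayed above \<open>l\<close>, its flux would be exhausted
    at a first point \<open>s0\<close>. Local uniqueness gives \<open>w = v\<close> up to
    \<open>s0\<close>, and one unit later the untruncated flux of \<open>w\<close> is strictly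
    negative at a positive level. This open condition passes to the solutions for \<open>b n\<close>
    and would put some \<open>b n\<close> into \<open>K\<close>.\<close>
  have "\<exists>s\<ge>0. v s < l" if l: "0 < l" for l
  proof (rule ccontr)
    assume "\<not> ?thesis"
    then have vl: "\<And>s. 0 \<le> s \<Longrightarrow> l \<le> v s" by force
    define c where "c = h 1 * G l"
    have c: "0 < c" using h_pos[of 1] G_pos[OF l] by (simp add: c_def)
    \<comment> \<open>From 1 on the flux is absorbed at a rate of at least \<open>c\<close>, so
      \<open>ks\<close> is used up by \<open>T\<close>.\<close>
    define T where "T = 1 + ks / c"
    have T: "1 \<le> T" using ks c by (simp add: T_def)
    have "ks \<le> (T - 1) * (h 1 * G l)" using c by (simp add: T_def c_def[symmetric])
    also have "\<dots> \<le> integral {1..T} (\<lambda>\<tau>. h \<tau> * G (v \<tau>))"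
      by (rule hG_ge[OF pv(1)]) (use T vl in auto)
    also have "\<dots> = W ks v 1 - W ks v T" using W_diff[OF pv(1) _ T, of ks] by simp
    also have "\<dots> \<le> ks - W ks v T" using W_le[OF pv(1), of 1 ks] by simp
    finally have WT: "W ks v T \<le> 0" by simp
    define Z where "Z = {s\<in>{0..T}. W ks v s \<in> {..0}}"
    have "closedin (top_of_set {0..T}) ({0..T} \<inter> W ks v -` {..0})"
      by (intro continuous_closedin_preimage continuous_on_subset[OF W_cont[OF pv(1)]]) auto
    also have "{0..T} \<inter> W ks v -` {..0} = Z" by (auto simp: Z_def)
    finally have "closedin (top_of_set {0..T}) Z" .
    then have "compact Z" using closedin_compact compact_Icc by blast
    moreover have "T \<in> Z" using WT T by (simp add: Z_def)
    ultimately obtain s0 where s0: "s0 \<in> Z" "\<And>z. z \<in> Z \<Longrightarrow> s0 \<le> z"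
      using compact_attains_inf[of Z] by blast
    have W0: "0 < W ks v s" if "0 \<le> s" "s < s0" for s
      using s0(2)[of s] s0(1) that by (force simp: Z_def)
    have s0p: "0 < s0" using s0(1) ks by (cases "s0 = 0") (auto simp: Z_def W_def)
    have eq: "w s = v s" if "0 \<le> s" "s < s0" for s
      using unique_while_positive[OF fv fw wv l vl W0 that] by simp
    have eq': "w s = v s" if "0 \<le> s" "s \<le> s0" for s
    proof (cases "s = s0")
      case True
      have cont: "continuous_on {0..s0} (\<lambda>s. w s - v s)"
        by (intro continuous_intros continuous_on_subset[OF pv(2)] continuous_on_subset[OF pw(2)]) auto
      have "w s0 - v s0 = 0"
        by (rule continuous_constant_on_closure[of "{0..<s0}"])
          (use s0p eq cont in auto)
      then show ?thesis using True by simp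
    qed (use eq that in auto)
    have "W ks w s0 = W ks v s0" unfolding W_def using eq' by (auto intro!: integral_cong)
    then have Ws0: "W ks w s0 \<le> 0" using s0(1) by (simp add: Z_def)
    have wl: "l \<le> w s" if "s0 \<le> s" for s
      using const_after[OF fw Ws0 _ that] s0p eq'[of s0] vl[of s0] by simp
    have "0 < (s0 + 1 - s0) * (h s0 * G l)" using h_pos[OF s0p] G_pos[OF l] by simp
    also have "\<dots> \<le> integral {s0..s0+1} (\<lambda>\<tau>. h \<tau> * G (w \<tau>))"
      by (rule hG_ge[OF pw(1)]) (use wl s0p in auto)
    also have "\<dots> = W ks w s0 - W ks w (s0+1)" using W_diff[OF pw(1), of s0 "s0+1" ks] s0p by simp
    finally have neg: "W ks w (s0+1) < 0" using Ws0 by simp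
    have "(\<lambda>n. W (b n) (sol (b n)) (s0+1)) \<longlonglongrightarrow> W ks w (s0+1)"
      by (rule W_limit(2)[OF sol_adm[OF b0(1)] w blim]) (use s0p in auto)
    then have "\<forall>\<^sub>F n in sequentially. W (b n) (sol (b n)) (s0+1) < 0"
      using neg by (rule order_tendstoD)
    moreover have "\<forall>\<^sub>F n in sequentially. 0 < sol (b n) (s0+1)"
      using order_tendstoD(1)[OF w[of "s0+1"], of 0] wl[of "s0+1"] l s0p by simp
    ultimately have "\<forall>\<^sub>F n in sequentially. W (b n) (sol (b n)) (s0+1) < 0 \<and> 0 < sol (b n) (s0+1)"
      by eventually_elim simp
    then obtain n where n: "W (b n) (sol (b n)) (s0+1) < 0" "0 < sol (b n) (s0+1)"
      by (auto simp: eventually_sequentially)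
    then have "b n \<in> K"
      using pos_beyond[OF sol_isfix[OF b0(1)], of "s0+1" n] s0p b0(1)[of n] by (auto simp: K_def)
    then show False using bK by simp
  qed
  then have "(v \<longlongrightarrow> 0) at_top"
  proof (intro tendstoI)
    fix e :: real assume "0 < e"
    then obtain s where s: "0 \<le> s" "v s < e" using \<open>\<And>l. 0 < l \<Longrightarrow> \<exists>s\<ge>0. v s < l\<close> by blast
    then have "dist (v t) 0 < e" if "s \<le> t" for t
      using pv(4)[OF s(1) that] v0[of t] that by auto
    then show "\<forall>\<^sub>F x in at_top. dist (v x) 0 < e" by (auto simp: eventually_at_top_linorder)
  qed
  then show thesis using that[OF ks(2) fv v0] by blast
qed

text \<open>The truncated flux \<open>V\<close> is positive exactly where \<open>U\<close> is:
  exhaustion at a positive level would freeze \<open>U\<close> and contradict its decay.\<close>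

lemma critical_profile:
  obtains k U V where "0 < k" "U 0 = 1" "V 0 = k"
    "continuous_on {0..} U" "continuous_on {0..} V"
    "\<And>s t. 0 \<le> s \<Longrightarrow> s \<le> t \<Longrightarrow> U t \<le> U s" "\<And>s t. 0 \<le> s \<Longrightarrow> s \<le> t \<Longrightarrow> V t \<le> V s"
    "\<And>s. 0 \<le> s \<Longrightarrow> 0 \<le> U s" "\<And>s. 0 \<le> s \<Longrightarrow> 0 \<le> V s"
    "(U \<longlongrightarrow> 0) at_top" "(V \<longlongrightarrow> 0) at_top"
    "\<And>s. 0 < s \<Longrightarrow> (U has_real_derivative - (V s powr m)) (at s)"
    "\<And>s. 0 \<le> s \<Longrightarrow> 0 < U s \<Longrightarrow> 0 < V s"
    "\<And>s. 0 < s \<Longrightarrow> 0 < U s \<Longrightarrow> (V has_real_derivative - (h s * G (U s))) (at s)"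
    "\<And>s. 0 \<le> s \<Longrightarrow> U s = 0 \<Longrightarrow> V s = 0"
proof -
  obtain k U where k: "0 < k" and f: "isfix k U" and U0: "\<And>s. 0 \<le> s \<Longrightarrow> 0 \<le> U s"
    and Ulim: "(U \<longlongrightarrow> 0) at_top" by (rule critical_exists) blast
  note pU = fix_props[OF f]
  define V where "V s = max 0 (W k U s)" for s
  have Vcont: "continuous_on {0..} V" unfolding V_def
    by (intro continuous_intros W_cont pU(1))
  have Vanti: "V t \<le> V s" if "0 \<le> s" "s \<le> t" for s t
    using W_antimono[OF pU(1) that, of k] by (auto simp: V_def)
  have V0: "0 \<le> V s" for s by (simp add: V_def)
  have dU: "(U has_real_derivative - (V s powr m)) (at s)" if s: "0 < s" for s
  proof -
    have "continuous_on {0..s+1} (\<lambda>t. max 0 (W k U t) powr m)"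
      by (rule continuous_on_subset[OF Wp_cont[OF pU(1)]]) auto
    from integral_has_real_derivative[OF this, of s] s
    have "((\<lambda>x. 1 - integral {0..x} (\<lambda>t. max 0 (W k U t) powr m)) has_real_derivative 0 - V s powr m) (at s)"
      by (intro derivative_intros) (auto simp: V_def at_within_Icc_at)
    then show ?thesis unfolding diff_0
      by (rule has_field_derivative_transform_within_open[where S = "{0<..}"])
        (use s f in \<open>auto simp: isfix_def S_def\<close>)
  qed
  have UV: "0 < W k U s" if s: "0 \<le> s" "0 < U s" for s
  proof (rule ccontr)
    assume "\<not> 0 < W k U s"
    moreover obtain t where t: "s \<le> t" "U t < U s"
      by (rule at_top_exists_ge[OF order_tendstoD(2)[OF Ulim s(2)]])
    ultimately show False using const_after[OF f _ s(1) t(1)] by simp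
  qed
  have dV: "(V has_real_derivative - (h s * G (U s))) (at s)" if s: "0 < s" "0 < U s" for s
  proof -
    have "continuous_on {0..s+1} (\<lambda>\<tau>. h \<tau> * G (U \<tau>))"
      by (intro continuous_intros continuous_on_subset[OF h_cont] continuous_on_compose2[OF G_cont]
        continuous_on_subset[OF pU(2)]) auto
    from integral_has_real_derivative[OF this, of s] s
    have *: "(W k U has_real_derivative 0 - h s * G (U s)) (at s)"
      unfolding W_def[abs_def] by (intro derivative_intros) (auto simp: at_within_Icc_at)
    have "\<forall>\<^sub>F x in nhds s. 0 < W k U x"
      using DERIV_isCont[OF *] UV[of s] s unfolding continuous_at
      by (intro order_tendstoD(1)[OF tendsto_at_iff_tendsto_nhds[THEN iffD1]]) auto
    then have "\<forall>\<^sub>F x in nhds s. W k U x = V x"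
      by eventually_elim (simp add: V_def)
    from DERIV_cong_ev[OF refl this refl] * show ?thesis by simp
  qed
  \<comment> \<open>Past a zero \<open>U\<close> is constant, so its derivative
    \<open>- (V powr m)\<close> vanishes; continuity of \<open>V\<close> extends this to the zero
    itself.\<close>
  have VU: "V s = 0" if s: "0 \<le> s" "U s = 0" for s
  proof -
    have sp: "0 < s" using s pU(3) by (cases "s = 0") auto
    have "V t = 0" if t: "s < t" for t
    proof -
      have "\<And>x. s < x \<Longrightarrow> U x = 0" using pU(4)[of s] U0 s sp by (smt (verit))
      then have "(U has_real_derivative 0) (at t)"
        by (intro has_field_derivative_transform_within_open[OF DERIV_const, where S = "{s<..}"]) (use t in auto)
      from DERIV_unique[OF dU this] have "V t powr m = 0" using t sp by simp
      then show ?thesis by simp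
    qed
    then have "V (s + 1 / real (Suc n)) = 0" for n by simp
    moreover have "(\<lambda>n. V (s + 1 / real (Suc n))) \<longlonglongrightarrow> V s"
    proof (rule continuous_on_tendsto_compose[OF Vcont])
      have "(\<lambda>n. s + inverse (real (Suc n))) \<longlonglongrightarrow> s + 0"
        by (intro tendsto_intros LIMSEQ_inverse_real_of_nat)
      then show "(\<lambda>n. s + 1 / real (Suc n)) \<longlonglongrightarrow> s" by (simp add: inverse_eq_divide)
    qed (use sp in auto)
    ultimately show ?thesis by (simp add: LIMSEQ_const_iff)
  qed
  have Vlim: "(V \<longlongrightarrow> 0) at_top"
  proof (rule tendstoI)
    fix e :: real assume e: "0 < e"
    \<comment> \<open>A flux of at least \<open>e\<close> on [0, t] would make \<open>U\<close> fall
      by \<open>t * e powr m = 2\<close>, more than its initial height 1.\<close>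
    define t where "t = 2 / e powr m"
    have t: "0 < t" using e by (simp add: t_def)
    have "V t < e"
    proof (rule ccontr)
      assume "\<not> V t < e"
      then have ge: "e \<le> V r" if "r \<in> {0..t}" for r using Vanti[of r t] that by auto
      have "integral {0..t} (\<lambda>_. e powr m) \<le> integral {0..t} (\<lambda>r. max 0 (W k U r) powr m)"
        by (intro integral_le Wp_int pU(1) powr_mono2) (use ge m_pos e in \<open>auto simp: V_def\<close>)
      also have "\<dots> = 1 - U t" using fix_diff[OF f, of 0 t] pU(3) t by simp
      finally have "2 \<le> 1 - U t" using t e by (simp add: t_def)
      then show False using U0[of t] t by simp
    qed
    then have "dist (V s) 0 < e" if "t \<le> s" for s
      using Vanti[of t s] V0[of s] that t by auto
    then show "\<forall>\<^sub>F x in at_top. dist (V x) 0 < e" by (auto simp: eventually_at_top_linorder)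
  qed
  show thesis
    by (rule that[of k U V])
      (use k pU Vcont Vanti U0 V0 Ulim Vlim dU UV dV VU in \<open>auto simp: V_def W_def\<close>)
qed

end

section \<open>Existence of the profile\<close>

text \<open>Let \<open>R\<close> be the first zero. At distance \<delta> before it, the mean value
  theorem bounds \<open>U\<close> by \<delta> times \<open>V powr m\<close> and \<open>V\<close> by
  \<delta> * h R times \<open>U powr q\<close>. Since q * m is at least 1 and \<open>U\<close> at
  most 1, together they give \<open>U s \<le> U s / 2\<close>.\<close>

lemma critical_positive:
  fixes h U V :: "real \<Rightarrow> real" and m q :: real
  assumes m: "0 < m" and qm: "1 \<le> q * m" and q: "0 \<le> q"
    and hm: "\<And>s t. 0 \<le> s \<Longrightarrow> s \<le> t \<Longrightarrow> h s \<le> h t" and h0: "\<And>s. 0 \<le> s \<Longrightarrow> 0 \<le> h s"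
    and U: "U 0 = 1" "continuous_on {0..} U" "continuous_on {0..} V"
    "\<And>s t. 0 \<le> s \<Longrightarrow> s \<le> t \<Longrightarrow> U t \<le> U s" "\<And>s t. 0 \<le> s \<Longrightarrow> s \<le> t \<Longrightarrow> V t \<le> V s"
    "\<And>s. 0 \<le> s \<Longrightarrow> 0 \<le> U s" "\<And>s. 0 \<le> s \<Longrightarrow> 0 \<le> V s"
    and dU: "\<And>s. 0 < s \<Longrightarrow> (U has_real_derivative - (V s powr m)) (at s)"
    and dV: "\<And>s. 0 < s \<Longrightarrow> 0 < U s \<Longrightarrow> (V has_real_derivative - (h s * U s powr q)) (at s)"
    and VU: "\<And>s. 0 \<le> s \<Longrightarrow> U s = 0 \<Longrightarrow> V s = 0"
    and t: "0 \<le> t"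
  shows "0 < U t"
proof (rule ccontr)
  assume "\<not> 0 < U t"
  then have Ut: "U t = 0" using U(6)[OF t] by simp
  define Z where "Z = {s\<in>{0..t}. U s = 0}"
  have "closedin (top_of_set {0..t}) Z" unfolding Z_def
    by (rule continuous_closedin_preimage_constant[OF continuous_on_subset[OF U(2)]]) auto
  then have "compact Z" using closedin_compact compact_Icc by blast
  moreover have "t \<in> Z" using Ut t by (simp add: Z_def)
  ultimately obtain R where R: "R \<in> Z" "\<And>z. z \<in> Z \<Longrightarrow> R \<le> z"
    using compact_attains_inf[of Z] by blast
  have R0: "0 < R" "U R = 0" "V R = 0" using R(1) U(1) VU by (auto simp: Z_def order_le_less)
  have pos: "0 < U s" if "0 \<le> s" "s < R" for s
    using R(2)[of s] R(1) that U(6)[of s] by (force simp: Z_def)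
  \<comment> \<open>Small enough that \<delta> * h R \<le> 1, with a factor 1/2 left for the
    contradiction.\<close>
  define \<delta> where "\<delta> = min (R / 2) (min (1/2) (1 / (h R + 1)))"
  have hR: "0 \<le> h R" using h0 R0 by simp
  have d: "0 < \<delta>" "\<delta> < R" "\<delta> \<le> 1/2" using R0 hR by (auto simp: \<delta>_def)
  have "\<delta> \<le> 1 / (h R + 1)" by (simp add: \<delta>_def)
  then have "\<delta> * (h R + 1) \<le> 1" using hR by (simp add: field_simps)
  then have dh: "\<delta> * h R \<le> 1" using d by (simp add: distrib_left)
  define s where "s = R - \<delta>"
  have s: "0 < s" "s < R" "R - s = \<delta>" using d by (auto simp: s_def)
  have "\<exists>z. s < z \<and> z < R \<and> U R - U s = (R - s) * (- (V z powr m))"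
    by (rule MVT2[OF s(2)]) (use dU s in auto)
  then obtain z where z: "s < z" "z < R" "U s = \<delta> * V z powr m" using s R0 by auto
  have "V z powr m \<le> V s powr m" using U(5)[of s z] U(7)[of z] z s m by (intro powr_mono2) auto
  then have 1: "U s \<le> \<delta> * V s powr m" using z(3) d by simp
  have "\<exists>l y. s < y \<and> y < R \<and> (V has_real_derivative l) (at y) \<and> V R - V s = (R - s) * l"
  proof (rule MVT[OF s(2)])
    show "continuous_on {s..R} V" by (rule continuous_on_subset[OF U(3)]) (use s in auto)
    fix x assume x: "s < x" "x < R"
    show "V differentiable (at x)"
      unfolding real_differentiable_def by (rule exI, rule dV) (use pos[of x] x s in auto)
  qed
  then obtain l y where y: "s < y" "y < R" "(V has_real_derivative l) (at y)" "V R - V s = (R - s) * l"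
    by blast
  have "l = - (h y * U y powr q)" using DERIV_unique[OF y(3) dV] pos[of y] y s by simp
  then have "V s = \<delta> * (h y * U y powr q)" using y(4) R0(3) s(3) by simp
  also have "\<dots> \<le> \<delta> * (h R * U s powr q)"
    using y s d U(4)[of s y] U(6)[of y] q by (intro mult_left_mono mult_mono hm powr_mono2 h0) auto
  also have "\<dots> \<le> 1 * U s powr q" unfolding mult.assoc[symmetric] using dh by (intro mult_right_mono) auto
  finally have "V s powr m \<le> (U s powr q) powr m" using U(7)[of s] s m by (intro powr_mono2) auto
  also have "\<dots> = U s powr (q * m)" by (simp add: powr_powr)
  also have "\<dots> \<le> U s powr 1" using pos[of s] U(4)[of 0 s] U(1) s qm by (intro powr_mono') auto
  also have "\<dots> = U s" using pos[of s] s by simp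
  finally have "\<delta> * V s powr m \<le> 1/2 * U s" using d by (intro mult_mono) auto
  with 1 have "U s \<le> 1/2 * U s" by simp
  then show False using pos[of s] s by simp
qed

text \<open>From s = 1 on, the energy \<open>F\<close> has a derivative of the sign of
  \<open>h 1 - h s\<close>, so it decreases to its limit 0 and is nonnegative. This bounds the speed
  \<open>V powr m\<close> of descent below by a multiple of \<open>U powr \<gamma>\<close> with
  \<gamma> < 1, and such a descent reaches 0 in finite time.\<close>

lemma critical_extinct:
  fixes h U V :: "real \<Rightarrow> real" and m q :: real
  assumes m: "0 < m" and qm: "q * m < 1" and q: "0 \<le> q"
    and hm: "\<And>s t. 0 \<le> s \<Longrightarrow> s \<le> t \<Longrightarrow> h s \<le> h t" and h1: "0 < h 1"
    and U: "\<And>s. 0 \<le> s \<Longrightarrow> 0 \<le> V s"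
      "(U \<longlongrightarrow> 0) at_top" "(V \<longlongrightarrow> 0) at_top"
    and dU: "\<And>s. 0 < s \<Longrightarrow> (U has_real_derivative - (V s powr m)) (at s)"
    and UV: "\<And>s. 0 < s \<Longrightarrow> 0 < U s \<Longrightarrow> 0 < V s"
    and dV: "\<And>s. 0 < s \<Longrightarrow> 0 < U s \<Longrightarrow> (V has_real_derivative - (h s * U s powr q)) (at s)"
  shows "\<exists>s>0. U s \<le> 0"
proof (rule ccontr)
  assume "\<not> ?thesis"
  then have pos: "0 < U s" if "0 < s" for s using that by force
  then have Vpos: "0 < V s" if "0 < s" for s using that UV by blast
  \<comment> \<open>The weight may vanish at 0, so the comparison with a constant weight starts at s
    = 1.\<close>
  define c0 where "c0 = h 1"
  define F where "F s = V s powr (1 + m) / (1 + m) - c0 * (U s powr (q + 1) / (q + 1))" for s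
  have dF: "(F has_real_derivative V s powr m * (- (h s * U s powr q)) - c0 * (U s powr q * (- (V s powr m)))) (at s)"
    if s: "0 < s" for s
  proof -
    from DERIV_fun_powr[OF dV[OF s pos[OF s]] Vpos[OF s], of "1 + m"]
    have 1: "((\<lambda>x. V x powr (1 + m) / (1 + m)) has_real_derivative V s powr m * (- (h s * U s powr q))) (at s)"
      by (rule DERIV_cdivide[THEN DERIV_cong]) (use m in simp)
    from DERIV_fun_powr[OF dU[OF s] pos[OF s], of "q + 1"]
    have 2: "((\<lambda>x. U x powr (q + 1) / (q + 1)) has_real_derivative U s powr q * (- (V s powr m))) (at s)"
      by (rule DERIV_cdivide[THEN DERIV_cong]) (use q in simp)
    show ?thesis unfolding F_def[abs_def] by (intro DERIV_diff 1 DERIV_cmult 2)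
  qed
  have Fmono: "F t \<le> F s" if "1 \<le> s" "s \<le> t" for s t
  proof (rule DERIV_nonpos_imp_nonincreasing[OF that(2)])
    fix x assume x: "s \<le> x" "x \<le> t"
    have "V x powr m * (- (h x * U x powr q)) - c0 * (U x powr q * (- (V x powr m)))
      = (c0 - h x) * (V x powr m * U x powr q)" by (simp add: algebra_simps)
    also have "\<dots> \<le> 0" using hm[of 1 x] x that by (intro mult_nonpos_nonneg) (auto simp: c0_def)
    finally show "\<exists>y. (F has_real_derivative y) (at x) \<and> y \<le> 0" using dF[of x] x that by auto
  qed
  have Flim: "(F \<longlongrightarrow> 0 powr (1 + m) / (1 + m) - c0 * (0 powr (q + 1) / (q + 1))) at_top"
    unfolding F_def using m q
    by (intro tendsto_intros tendsto_powr'[OF U(3)] tendsto_powr'[OF U(2)])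
      (auto simp: eventually_at_top_linorder intro!: exI[of _ 1] less_imp_le pos Vpos)
  have F0: "0 \<le> F s" if "1 \<le> s" for s
    by (rule tendsto_upperbound[OF Flim, simplified])
      (use Fmono[OF that] in \<open>auto simp: eventually_at_top_linorder\<close>)
  \<comment> \<open>The exponent obtained by solving \<open>F s \<ge> 0\<close> for
    \<open>V powr m\<close>; it is below 1 exactly when q * m < 1.\<close>
  define \<gamma> where "\<gamma> = (q + 1) * m / (1 + m)"
  have g: "\<gamma> < 1" using m qm by (simp add: \<gamma>_def field_simps)
  define c1 where "c1 = ((1 + m) * c0 / (q + 1)) powr (m / (1 + m))"
  have c1: "0 < c1" using m q h1 by (simp add: c1_def c0_def)
  have Vge: "c1 * U s powr \<gamma> \<le> V s powr m" if s: "1 \<le> s" for s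
  proof -
    define B where "B = (1 + m) * c0 / (q + 1)"
    have B: "0 \<le> B" using m q h1 by (simp add: B_def c0_def)
    have "c0 * (U s powr (q + 1) / (q + 1)) \<le> V s powr (1 + m) / (1 + m)"
      using F0[OF s] by (simp add: F_def)
    from mult_left_mono[OF this, of "1 + m"]
    have "B * U s powr (q + 1) \<le> V s powr (1 + m)" using m by (simp add: B_def)
    then have "(B * U s powr (q + 1)) powr (m / (1 + m)) \<le> (V s powr (1 + m)) powr (m / (1 + m))"
      using m B by (intro powr_mono2) auto
    also have "(V s powr (1 + m)) powr (m / (1 + m)) = V s powr m"
      unfolding powr_powr using m by simp
    also have "(B * U s powr (q + 1)) powr (m / (1 + m)) = c1 * U s powr \<gamma>"
      by (simp add: powr_mult powr_powr c1_def[folded B_def] \<gamma>_def)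
    finally show ?thesis .
  qed
  define K where "K = (1 - \<gamma>) * c1"
  have K: "0 < K" using g c1 by (simp add: K_def)
  \<comment> \<open>\<open>U powr (1 - \<gamma>)\<close> falls at a rate of at least
    \<open>K\<close>, so adding \<open>K * s\<close> still leaves a nonincreasing function.\<close>
  define X where "X s = U s powr (1 - \<gamma>) + K * s" for s
  have Xm: "X t \<le> X 1" if "1 \<le> t" for t
  proof (rule DERIV_nonpos_imp_nonincreasing[OF that])
    fix x :: real assume x: "1 \<le> x" "x \<le> t"
    have "(X has_real_derivative (1 - \<gamma>) * U x powr (- \<gamma>) * (- (V x powr m)) + K) (at x)"
    proof -
      have "((\<lambda>s. U s powr (1 - \<gamma>)) has_real_derivative (1 - \<gamma>) * U x powr (- \<gamma>) * (- (V x powr m))) (at x)"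
        using DERIV_fun_powr[OF dU pos, of x "1 - \<gamma>"] x by simp
      from DERIV_add[OF this DERIV_cmult_Id[of K x]] show ?thesis unfolding X_def[abs_def] by simp
    qed
    moreover have e: "U x powr \<gamma> * U x powr (- \<gamma>) = 1"
      using pos[of x] x by (simp add: powr_minus)
    have "c1 * (U x powr \<gamma> * U x powr (- \<gamma>)) \<le> V x powr m * U x powr (- \<gamma>)"
      unfolding mult.assoc[symmetric] by (intro mult_right_mono Vge x) simp
    then have "c1 \<le> V x powr m * U x powr (- \<gamma>)" unfolding e by simp
    then have "K \<le> (1 - \<gamma>) * (V x powr m * U x powr (- \<gamma>))"
      unfolding K_def using g by (intro mult_left_mono) auto
    then have "(1 - \<gamma>) * U x powr (- \<gamma>) * (- (V x powr m)) + K \<le> 0" by (simp add: algebra_simps)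
    ultimately show "\<exists>y. (X has_real_derivative y) (at x) \<and> y \<le> 0" by blast
  qed
  \<comment> \<open>At this point the linear term alone exceeds \<open>X 1\<close>.\<close>
  define t where "t = 1 + (U 1 powr (1 - \<gamma>) + 1) / K"
  have "1 \<le> t" using K by (simp add: t_def)
  then have "K * t \<le> U 1 powr (1 - \<gamma>) + K"
    using Xm[of t] powr_ge_zero[of "U t" "1 - \<gamma>"] unfolding X_def by linarith
  moreover have "K * t = K * 1 + K * ((U 1 powr (1 - \<gamma>) + 1) / K)" unfolding t_def distrib_left ..
  moreover have "K * ((U 1 powr (1 - \<gamma>) + 1) / K) = U 1 powr (1 - \<gamma>) + 1" using K by simp
  ultimately show False by linarith
qed

text \<open>The function \<open>w\<close> is the flux \<open>r powr (d - 1) * \<bar>u'\<bar> powr (p - 1)\<close>.\<close>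

definition profile_on :: "nat \<Rightarrow> real \<Rightarrow> real \<Rightarrow> real \<Rightarrow> (real \<Rightarrow> real) \<Rightarrow> (real \<Rightarrow> real) \<Rightarrow> bool" where
  "profile_on d p q k u w \<longleftrightarrow>
     0 < k \<and> u 0 = 1 \<and> w 0 = k \<and> continuous_on {0..} u \<and> continuous_on {0..} w \<and>
     antimono_on {0..} u \<and> antimono_on {0..} w \<and> (\<forall>r\<ge>0. 0 \<le> u r) \<and> (\<forall>r\<ge>0. 0 \<le> w r) \<and>
     (u \<longlongrightarrow> 0) at_top \<and> (w \<longlongrightarrow> 0) at_top \<and>
     (\<forall>r>0. (u has_real_derivative - ((w r * r powr (1 - real d)) powr (1 / (p - 1)))) (at r)) \<and>
     (\<forall>r>0. 0 < u r \<longrightarrow> 0 < w r \<and>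
        (w has_real_derivative - (r powr (real d - 1) * u r powr q)) (at r)) \<and>
     (\<forall>r\<ge>0. u r = 0 \<longrightarrow> w r = 0) \<and>
     (q < p - 1 \<longrightarrow> (\<exists>R>0. (\<forall>r\<in>{0..<R}. 0 < u r) \<and> (\<forall>r\<ge>R. u r = 0))) \<and>
     (p - 1 \<le> q \<longrightarrow> (\<forall>r\<ge>0. 0 < u r))"

text \<open>The new variable \<sigma> absorbs the power of r in the equation for u: with m = 1 / (p
  - 1) one has (1 - d) * m = \<alpha> - 1, which is the exponent in the derivative of \<sigma>. The
  weight r powr (d - 1) in the flux equation becomes \<open>h\<close>. The cases d = 1 and q = 0 are
  set apart in \<open>h\<close> and \<open>G\<close> to keep them continuous, since
  \<open>0 powr 0 = 0\<close>.\<close>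

lemma profile_exists:
  fixes d :: nat and p q :: real
  assumes d: "1 \<le> d" and p: "real d < p" and q: "0 \<le> q"
  shows "\<exists>k u w. profile_on d p q k u w"
proof -
  define m where "m = 1 / (p - 1)"
  define \<alpha> where "\<alpha> = (p - d) / (p - 1)"
  define \<beta> where "\<beta> = (d - \<alpha>) / \<alpha>"
  define h where "h s = (if d = 1 then 1 else (\<alpha> * s) powr \<beta>)" for s :: real
  define G where "G x = (if q = 0 then 1 else max 0 x powr q)" for x :: real
  have p1: "1 < p" using d p by simp
  have m: "0 < m" using p1 by (simp add: m_def)
  have al: "0 < \<alpha>" "\<alpha> \<le> 1" using d p p1 by (auto simp: \<alpha>_def)
  have be: "0 < \<beta>" if "d \<noteq> 1" using al d that by (simp add: \<beta>_def)
  have al1: "\<alpha> = 1" if "d = 1" using p1 that by (simp add: \<alpha>_def)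
  have Geq: "G x = x powr q" if "0 < x" for x using that by (simp add: G_def)
  interpret shooting h G m
  proof
    show "continuous_on {0..} h"
    proof (cases "d = 1")
      case False
      have "continuous_on {0..} (\<lambda>s. (\<alpha> * s) powr \<beta>)"
        by (intro continuous_on_powr' continuous_intros) (use al be[OF False] in auto)
      then show ?thesis using False by (simp add: h_def[abs_def])
    qed (simp add: h_def[abs_def])
    show "h s \<le> h t" if "0 \<le> s" "s \<le> t" for s t
      using that al be by (auto simp: h_def intro!: powr_mono2)
    show "0 \<le> h s" if "0 \<le> s" for s by (simp add: h_def)
    show "0 < h s" if "0 < s" for s using that al by (simp add: h_def)
    show "continuous_on UNIV G"
    proof (cases "q = 0")
      case False
      then have "continuous_on UNIV (\<lambda>x::real. max 0 x powr q)"
        using q by (intro continuous_on_powr' continuous_intros) auto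
      then show ?thesis using False by (simp add: G_def[abs_def])
    qed (simp add: G_def[abs_def])
    show "G x \<le> G y" if "x \<le> y" for x y using that q by (auto simp: G_def intro!: powr_mono2)
    show "0 \<le> G x" for x by (simp add: G_def)
    show "G x \<le> 1" if "x \<le> 1" for x
    proof (cases "q = 0")
      case False
      have "max 0 x powr q \<le> 1 powr q" using that q by (intro powr_mono2) auto
      then show ?thesis using False by (simp add: G_def)
    qed (simp add: G_def)
    show "0 < G x" if "0 < x" for x using that by (simp add: G_def)
    show "\<exists>C. \<forall>x\<in>{e..1}. \<forall>y\<in>{e..1}. \<bar>G x - G y\<bar> \<le> C * \<bar>x - y\<bar>" if e: "0 < e" for e
    proof (cases "q = 0")
      case True then show ?thesis by (intro exI[of _ 0]) (simp add: G_def)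
    next
      case False
      then obtain C where C: "\<forall>x\<in>{e..1}. \<forall>y\<in>{e..1}. x \<le> y \<longrightarrow> y powr q - x powr q \<le> C * (y - x)"
        using powr_lip[of q e 1] q e by auto
      have "\<bar>G x - G y\<bar> \<le> C * \<bar>x - y\<bar>" if xy: "x \<in> {e..1}" "y \<in> {e..1}" "x \<le> y" for x y
      proof -
        have "G x = x powr q" "G y = y powr q" using xy e by (auto intro!: Geq)
        moreover have "x powr q \<le> y powr q" using xy e q by (intro powr_mono2) auto
        moreover have "y powr q - x powr q \<le> C * (y - x)" using C xy by blast
        ultimately show ?thesis using xy(3) by (simp add: abs_minus_commute[of x])
      qed
      then have "\<bar>G x - G y\<bar> \<le> C * \<bar>x - y\<bar>" if "x \<in> {e..1}" "y \<in> {e..1}" for x y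
        using that by (cases "x \<le> y") (metis, metis abs_minus_commute linear)
      then show ?thesis by blast
    qed
    show "0 < m" by fact
  qed
  obtain k U V where k: "0 < k" and U0: "U 0 = 1" "V 0 = k"
    and cont: "continuous_on {0..} U" "continuous_on {0..} V"
    and anti: "\<And>s t. 0 \<le> s \<Longrightarrow> s \<le> t \<Longrightarrow> U t \<le> U s" "\<And>s t. 0 \<le> s \<Longrightarrow> s \<le> t \<Longrightarrow> V t \<le> V s"
    and nn: "\<And>s. 0 \<le> s \<Longrightarrow> 0 \<le> U s" "\<And>s. 0 \<le> s \<Longrightarrow> 0 \<le> V s"
    and lim: "(U \<longlongrightarrow> 0) at_top" "(V \<longlongrightarrow> 0) at_top"
    and dU: "\<And>s. 0 < s \<Longrightarrow> (U has_real_derivative - (V s powr m)) (at s)"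
    and UV: "\<And>s. 0 \<le> s \<Longrightarrow> 0 < U s \<Longrightarrow> 0 < V s"
    and dV: "\<And>s. 0 < s \<Longrightarrow> 0 < U s \<Longrightarrow> (V has_real_derivative - (h s * G (U s))) (at s)"
    and VU: "\<And>s. 0 \<le> s \<Longrightarrow> U s = 0 \<Longrightarrow> V s = 0"
    by (rule critical_profile) blast
  have dV': "(V has_real_derivative - (h s * U s powr q)) (at s)" if "0 < s" "0 < U s" for s
    using dV[OF that] Geq[OF that(2)] by simp
  define \<sigma> where "\<sigma> r = r powr \<alpha> / \<alpha>" for r
  define u where "u r = U (\<sigma> r)" for r
  define w where "w r = V (\<sigma> r)" for r
  have s0: "0 \<le> \<sigma> r" for r using al by (simp add: \<sigma>_def)
  have sp: "0 < \<sigma> r" if "0 < r" for r using al that by (simp add: \<sigma>_def)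
  have smono: "\<sigma> r \<le> \<sigma> t" if "0 \<le> r" "r \<le> t" for r t
    unfolding \<sigma>_def using al that by (intro divide_right_mono powr_mono2) auto
  have s00: "\<sigma> 0 = 0" by (simp add: \<sigma>_def)
  have scont: "continuous_on {0..} \<sigma>" unfolding \<sigma>_def[abs_def]
    by (intro continuous_on_powr' continuous_intros) (use al in auto)
  have dsig: "(\<sigma> has_real_derivative r powr (\<alpha> - 1)) (at r)" if "0 < r" for r
  proof -
    have "((\<lambda>r. r powr \<alpha>) has_real_derivative \<alpha> * r powr (\<alpha> - 1)) (at r)"
      by (rule has_real_derivative_powr[OF that])
    from DERIV_cdivide[OF this, of \<alpha>] show ?thesis using al by (simp add: \<sigma>_def[abs_def])
  qed
  have sinv: "\<exists>r\<ge>0. \<sigma> r = s" if "0 \<le> s" for s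
  proof (intro exI conjI)
    show "\<sigma> ((\<alpha> * s) powr (1 / \<alpha>)) = s" using al that by (simp add: \<sigma>_def powr_powr)
  qed simp
  have stop: "filterlim \<sigma> at_top at_top"
    unfolding filterlim_at_top
  proof
    fix Z :: real
    obtain r0 where r0: "0 \<le> r0" "\<sigma> r0 = max Z 0" using sinv[of "max Z 0"] by auto
    have "Z \<le> \<sigma> r" if "r0 \<le> r" for r using smono[OF r0(1) that] r0(2) by simp
    then show "\<forall>\<^sub>F r in at_top. Z \<le> \<sigma> r" by (auto simp: eventually_at_top_linorder)
  qed
  have du: "(u has_real_derivative - ((w r * r powr (1 - real d)) powr (1 / (p - 1)))) (at r)" if r: "0 < r" for r
  proof -
    have "(u has_real_derivative - (V (\<sigma> r) powr m) * r powr (\<alpha> - 1)) (at r)"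
      unfolding u_def[abs_def] by (rule DERIV_chain2[OF dU[OF sp[OF r]] dsig[OF r]])
    moreover have "(1 - real d) * m = \<alpha> - 1" using p1 by (simp add: m_def \<alpha>_def field_simps)
    then have "(w r * r powr (1 - real d)) powr m = V (\<sigma> r) powr m * r powr (\<alpha> - 1)"
      using nn(2)[OF s0] by (simp add: w_def powr_mult powr_powr)
    ultimately show ?thesis by (simp add: m_def)
  qed
  have dw: "(w has_real_derivative - (r powr (real d - 1) * u r powr q)) (at r)" if r: "0 < r" "0 < u r" for r
  proof -
    have "(w has_real_derivative - (h (\<sigma> r) * U (\<sigma> r) powr q) * r powr (\<alpha> - 1)) (at r)"
      unfolding w_def[abs_def]
      by (rule DERIV_chain2[OF dV'[OF sp[OF r(1)]] dsig[OF r(1)]]) (use r in \<open>simp add: u_def\<close>)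
    moreover have "h (\<sigma> r) * r powr (\<alpha> - 1) = r powr (real d - 1)"
    proof (cases "d = 1")
      case False
      have "h (\<sigma> r) = r powr (d - \<alpha>)" using False al by (simp add: h_def \<sigma>_def powr_powr \<beta>_def)
      then show ?thesis by (simp add: powr_add[symmetric])
    qed (use al1 r in \<open>simp add: h_def\<close>)
    then have "- (h (\<sigma> r) * U (\<sigma> r) powr q) * r powr (\<alpha> - 1) = - (r powr (real d - 1) * u r powr q)"
      by (simp add: u_def mult_ac)
    ultimately show ?thesis by simp
  qed
  have ext: "\<exists>R>0. (\<forall>r\<in>{0..<R}. 0 < u r) \<and> (\<forall>r\<ge>R. u r = 0)" if "q < p - 1"
  proof -
    have "q * m < 1" using that p1 by (simp add: m_def)
    then obtain s where s: "0 < s" "U s \<le> 0"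
      using critical_extinct[OF m _ q h_mono h_pos[of 1] nn(2) lim dU UV dV'] by (auto simp: less_imp_le)
    obtain t where t: "0 \<le> t" "\<sigma> t = s" using sinv[of s] s by auto
    have ut: "u t = 0" using s nn(1)[of s] t by (simp add: u_def)
    define Z where "Z = {r\<in>{0..t}. u r = 0}"
    have "continuous_on {0..t} u" unfolding u_def
      by (rule continuous_on_compose2[OF cont(1) continuous_on_subset[OF scont]]) (use s0 in auto)
    then have "closedin (top_of_set {0..t}) Z" unfolding Z_def
      by (rule continuous_closedin_preimage_constant)
    then have "compact Z" using closedin_compact compact_Icc by blast
    moreover have "t \<in> Z" using ut t by (simp add: Z_def)
    ultimately obtain R where R: "R \<in> Z" "\<And>z. z \<in> Z \<Longrightarrow> R \<le> z"
      using compact_attains_inf[of Z] by blast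
    have "R \<noteq> 0" using R(1) U0 s00 by (auto simp: Z_def u_def)
    then have R0: "0 < R" "u R = 0" "R \<le> t" using R(1) by (auto simp: Z_def)
    have "0 < u r" if "r \<in> {0..<R}" for r
      using R(2)[of r] R0 that nn(1)[OF s0, of r] by (force simp: Z_def u_def order_le_less)
    moreover have "u r = 0" if "r \<ge> R" for r
      using anti(1)[OF s0 smono[of R r]] nn(1)[OF s0, of r] R0 that by (simp add: u_def)
    ultimately show ?thesis using R0 by blast
  qed
  have pos: "0 < u r" if "p - 1 \<le> q" for r
  proof -
    have "1 \<le> q * m" using that p1 by (simp add: m_def)
    then show ?thesis unfolding u_def
      by (rule critical_positive[OF m _ q h_mono h_nonneg U0(1) cont anti nn dU dV' VU s0])
  qed
  have "continuous_on {0..} u" "continuous_on {0..} w" unfolding u_def w_def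
    by (rule continuous_on_compose2[OF cont(1) scont] continuous_on_compose2[OF cont(2) scont]; use s0 in auto)+
  moreover have "antimono_on {0..} u" "antimono_on {0..} w"
    unfolding u_def w_def by (auto intro!: monotone_onI anti smono s0)
  moreover have "(u \<longlongrightarrow> 0) at_top" "(w \<longlongrightarrow> 0) at_top"
    unfolding u_def w_def by (rule filterlim_compose[OF lim(1) stop] filterlim_compose[OF lim(2) stop])+
  ultimately have "profile_on d p q k u w"
    unfolding profile_on_def
    using k U0 s00 nn s0 du dw UV VU ext pos by (auto simp: u_def w_def)
  then show ?thesis by blast
qed

section \<open>Uniqueness of the profile\<close>

text \<open>The nonlinearity of the p-Laplacian in one variable, an odd power of exponent p -
  1.\<close>

definition phi :: "real \<Rightarrow> real \<Rightarrow> real" where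
  "phi p x = \<bar>x\<bar> powr (p - 2) * x"

lemma phi_nonneg: "0 \<le> x \<Longrightarrow> phi p x = x powr (p - 1)"
  using powr_mult_base[of x "p - 2"] by (simp add: phi_def mult.commute)

lemma phi_nonpos: "x \<le> 0 \<Longrightarrow> phi p x = - ((- x) powr (p - 1))"
  using phi_nonneg[of "- x" p] by (simp add: phi_def)

lemma phi_strict_mono: assumes "1 < p" "x < y" shows "phi p x < phi p y"
proof -
  consider "0 \<le> x" | "y \<le> 0" | "x < 0" "0 < y" by linarith
  then show ?thesis
  proof cases
    case 1 then show ?thesis using assms by (auto simp: phi_nonneg intro!: powr_less_mono2)
  next
    case 2 then show ?thesis using assms by (auto simp: phi_nonpos intro!: powr_less_mono2)
  next
    case 3
    then have "0 < (- x) powr (p - 1)" "0 < y powr (p - 1)" by auto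
    moreover have "phi p y = y powr (p - 1)" "phi p x = - ((- x) powr (p - 1))"
      using 3 by (intro phi_nonneg phi_nonpos; simp)+
    ultimately show ?thesis by linarith
  qed
qed

lemma phi_mono_mult: assumes "1 < p" shows "0 \<le> (x - y) * (phi p x - phi p y)"
  using phi_strict_mono[OF assms, of x y] phi_strict_mono[OF assms, of y x]
  by (cases x y rule: linorder_cases) (auto intro: mult_nonpos_nonpos)

lemma radial_flux_phi: "radial_flux p u r = phi p (deriv u r)"
  by (simp add: radial_flux_def phi_def)

text \<open>The sign makes it nonnegative for nonincreasing \<open>u\<close>; on the constructed
  profile it coincides with \<open>w\<close>.\<close>

definition wflux :: "nat \<Rightarrow> real \<Rightarrow> (real \<Rightarrow> real) \<Rightarrow> real \<Rightarrow> real" where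
  "wflux d p u r = - (r powr (real d - 1) * radial_flux p u r)"

text \<open>The integrating factor r powr (d - 1) puts the radial equation into divergence
  form.\<close>

lemma wflux_deriv:
  assumes "radial_ode_on d p q I u" "r \<in> I" "0 < r"
  shows "(wflux d p u has_real_derivative - (r powr (real d - 1) * u r powr q)) (at r)"
    and "(u has_real_derivative deriv u r) (at r)"
proof -
  have u: "u differentiable (at r)" "radial_flux p u differentiable (at r)"
    "deriv (radial_flux p u) r + (real d - 1) / r * radial_flux p u r = u r powr q"
    using assms unfolding radial_ode_on_def by auto
  show "(u has_real_derivative deriv u r) (at r)"
    using u(1) by (metis DERIV_deriv_iff_real_differentiable)
  have f: "(radial_flux p u has_real_derivative deriv (radial_flux p u) r) (at r)"
    using u(2) by (metis DERIV_deriv_iff_real_differentiable)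
  have "((\<lambda>r. r powr (real d - 1)) has_real_derivative (real d - 1) * r powr (real d - 1 - 1)) (at r)"
    by (rule has_real_derivative_powr[OF assms(3)])
  from DERIV_minus[OF DERIV_mult[OF this f]]
  have "(wflux d p u has_real_derivative - ((real d - 1) * r powr (real d - 1 - 1) * radial_flux p u r
      + deriv (radial_flux p u) r * r powr (real d - 1))) (at r)"
    by (simp add: wflux_def[abs_def])
  also have "r powr (real d - 1 - 1) = r powr (real d - 1) / r"
    using powr_diff[of r "real d - 1" 1] assms(3) by simp
  also have "(real d - 1) * (r powr (real d - 1) / r) * radial_flux p u r + deriv (radial_flux p u) r * r powr (real d - 1)
    = r powr (real d - 1) * u r powr q"
    unfolding u(3)[symmetric] by (simp add: algebra_simps)
  finally show "(wflux d p u has_real_derivative - (r powr (real d - 1) * u r powr q)) (at r)" .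
qed

lemma wflux_antimono:
  assumes "radial_ode_on d p q I u" "{a..b} \<subseteq> I" "0 < a" "a \<le> b"
  shows "wflux d p u b \<le> wflux d p u a"
proof (rule DERIV_nonpos_imp_nonincreasing[OF assms(4)])
  fix x assume "a \<le> x" "x \<le> b"
  then show "\<exists>y. (wflux d p u has_real_derivative y) (at x) \<and> y \<le> 0"
    using wflux_deriv(1)[OF assms(1), of x] assms(2,3)
    by (intro exI[of _ "- (x powr (real d - 1) * u x powr q)"]) auto
qed

text \<open>For two solutions this product is nonincreasing, because \<open>phi p\<close> and \<open>t \<mapsto> t powr q\<close> are
  monotone; it vanishes at 0 and, by the decay conditions, at the other end.\<close>

definition flux_gap :: "nat \<Rightarrow> real \<Rightarrow> (real \<Rightarrow> real) \<Rightarrow> (real \<Rightarrow> real) \<Rightarrow> real \<Rightarrow> real" where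
  "flux_gap d p u v r = (u r - v r) * (wflux d p u r - wflux d p v r)"

text \<open>Covers a bounded interval (0, T) as well as the half-line, so that both problems share
  one comparison argument.\<close>

locale ode_interval =
  fixes d :: nat and p q :: real and I :: "real set"
  assumes d: "1 \<le> d" and p: "1 < p" and q: "0 \<le> q"
    and I: "I \<subseteq> {0<..}" "\<And>a b. a \<in> I \<Longrightarrow> b \<in> I \<Longrightarrow> {a..b} \<subseteq> I"
      "\<forall>\<^sub>F r in at_right 0. r \<in> I"
begin

text \<open>Nothing is prescribed for the derivative at the origin. The flux is bounded there all
  the same, because in divergence form its rate of change is bounded once \<open>v\<close> is close
  to 1.\<close>

lemma wflux_bounded_near_0:
  assumes v: "radial_ode_on d p q I v" "(v \<longlongrightarrow> 1) (at_right 0)" "\<And>r. r \<in> I \<Longrightarrow> 0 < v r"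
  shows "\<exists>B. \<forall>\<^sub>F r in at_right 0. \<bar>wflux d p v r\<bar> \<le> B"
proof -
  have "\<forall>\<^sub>F r in at_right 0. v r < 2" using order_tendstoD(2)[OF v(2), of 2] by simp
  moreover have "\<forall>\<^sub>F r in at_right 0. r < (1::real)" by (auto simp: eventually_at_right_field intro: exI[of _ 1])
  ultimately have "\<forall>\<^sub>F r in at_right 0. v r < 2 \<and> r < 1 \<and> r \<in> I" using I(3) by eventually_elim auto
  then obtain b where b: "0 < b" "\<And>r. 0 < r \<Longrightarrow> r < b \<Longrightarrow> v r < 2 \<and> r < 1 \<and> r \<in> I"
    by (auto simp: eventually_at_right_field)
  define c where "c = b / 2"
  have c: "0 < c" "c < b" using b by (auto simp: c_def)
  have "\<bar>wflux d p v r\<bar> \<le> \<bar>wflux d p v c\<bar> + 2 powr q" if r: "0 < r" "r < c" for r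
  proof -
    have sub: "{r..c} \<subseteq> I" using r c b(2) by (intro I(2)) auto
    have 1: "wflux d p v c \<le> wflux d p v r" using wflux_antimono[OF v(1) sub] r by simp
    \<comment> \<open>Where v < 2 and r < 1 the flux decreases at a rate of at most 2 powr
      q.\<close>
    have "wflux d p v r + 2 powr q * r \<le> wflux d p v c + 2 powr q * c"
    proof (rule DERIV_nonneg_imp_nondecreasing[of r c "\<lambda>x. wflux d p v x + 2 powr q * x"])
      fix x assume x: "r \<le> x" "x \<le> c"
      have xI: "x \<in> I" "v x < 2" "x < 1" "0 < x" using sub x b(2)[of x] c r by auto
      have "x powr (real d - 1) * v x powr q \<le> 1 powr (real d - 1) * 2 powr q"
        using xI v(3)[OF xI(1)] d q by (intro mult_mono powr_mono2) auto
      moreover have "((\<lambda>x. wflux d p v x + 2 powr q * x) has_real_derivative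
          - (x powr (real d - 1) * v x powr q) + 2 powr q) (at x)"
        by (intro DERIV_add wflux_deriv(1)[OF v(1)] xI DERIV_cmult_Id)
      ultimately show "\<exists>y. ((\<lambda>x. wflux d p v x + 2 powr q * x) has_real_derivative y) (at x) \<and> 0 \<le> y"
        by auto
    qed (use r in auto)
    moreover have "2 powr q * c \<le> 2 powr q * 1" using c b(2)[of c] by (intro mult_left_mono) auto
    moreover have "0 \<le> 2 powr q * r" using r by simp
    ultimately show ?thesis using 1 by linarith
  qed
  then have "\<forall>\<^sub>F r in at_right 0. \<bar>wflux d p v r\<bar> \<le> \<bar>wflux d p v c\<bar> + 2 powr q"
    using c by (auto simp: eventually_at_right_field)
  then show ?thesis by blast
qed

context
  fixes u v :: "real \<Rightarrow> real"
  assumes u: "radial_ode_on d p q I u" "(u \<longlongrightarrow> 1) (at_right 0)" "\<And>r. r \<in> I \<Longrightarrow> 0 < u r"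
    and v: "radial_ode_on d p q I v" "(v \<longlongrightarrow> 1) (at_right 0)" "\<And>r. r \<in> I \<Longrightarrow> 0 < v r"
begin

abbreviation "E \<equiv> flux_gap d p u v"

lemma E_deriv:
  assumes "r \<in> I"
  shows "(E has_real_derivative - (r powr (real d - 1) *
     ((deriv u r - deriv v r) * (phi p (deriv u r) - phi p (deriv v r))
       + (u r - v r) * (u r powr q - v r powr q)))) (at r)"
proof -
  have r: "0 < r" using assms I(1) by auto
  note U = wflux_deriv[OF u(1) assms r] and V = wflux_deriv[OF v(1) assms r]
  from DERIV_mult[OF DERIV_diff[OF U(2) V(2)] DERIV_diff[OF U(1) V(1)]]
  show ?thesis unfolding flux_gap_def[abs_def]
    by (rule DERIV_cong) (simp add: wflux_def radial_flux_phi algebra_simps)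
qed

lemma E_terms:
  assumes "r \<in> I"
  shows "0 \<le> (deriv u r - deriv v r) * (phi p (deriv u r) - phi p (deriv v r))"
    "0 \<le> (u r - v r) * (u r powr q - v r powr q)"
proof -
  show "0 \<le> (deriv u r - deriv v r) * (phi p (deriv u r) - phi p (deriv v r))"
    by (rule phi_mono_mult[OF p])
  show "0 \<le> (u r - v r) * (u r powr q - v r powr q)"
  proof (cases "u r \<le> v r")
    case True
    then have "u r powr q \<le> v r powr q" using u(3)[OF assms] q by (intro powr_mono2) auto
    then show ?thesis using True by (intro mult_nonpos_nonpos) auto
  next
    case False
    then have "v r powr q \<le> u r powr q" using v(3)[OF assms] q by (intro powr_mono2) auto
    then show ?thesis using False by (intro mult_nonneg_nonneg) auto
  qed
qed

lemma E_antimono: assumes "a \<in> I" "b \<in> I" "a \<le> b" shows "E b \<le> E a"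
proof (rule DERIV_nonpos_imp_nonincreasing[OF assms(3)])
  fix x assume "a \<le> x" "x \<le> b"
  then have x: "x \<in> I" using I(2)[OF assms(1,2)] by auto
  have "- (x powr (real d - 1) *
     ((deriv u x - deriv v x) * (phi p (deriv u x) - phi p (deriv v x))
       + (u x - v x) * (u x powr q - v x powr q))) \<le> 0"
    using E_terms[OF x] by (simp add: zero_le_mult_iff)
  then show "\<exists>y. (E has_real_derivative y) (at x) \<and> y \<le> 0" using E_deriv[OF x] by blast
qed

lemma E_at_0: "(E \<longlongrightarrow> 0) (at_right 0)"
proof -
  obtain B1 B2 where "\<forall>\<^sub>F r in at_right 0. \<bar>wflux d p u r\<bar> \<le> B1" "\<forall>\<^sub>F r in at_right 0. \<bar>wflux d p v r\<bar> \<le> B2"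
    using wflux_bounded_near_0[OF u] wflux_bounded_near_0[OF v] by blast
  then have "\<forall>\<^sub>F r in at_right 0. norm (E r) \<le> norm (u r - v r) * (B1 + B2)"
    by eventually_elim (auto simp: flux_gap_def abs_mult intro!: mult_left_mono)
  moreover have "((\<lambda>r. u r - v r) \<longlongrightarrow> 0) (at_right 0)"
    using tendsto_diff[OF u(2) v(2)] by simp
  ultimately show ?thesis by (rule tendsto_0_le[rotated])
qed

lemma E_nonpos: assumes "r \<in> I" shows "E r \<le> 0"
proof (rule tendsto_lowerbound[OF E_at_0])
  have "0 < r" using assms I(1) by auto
  then have "\<forall>\<^sub>F x in at_right 0. x < r" by (auto simp: eventually_at_right_field)
  then show "\<forall>\<^sub>F x in at_right 0. E r \<le> E x"
    using I(3) by eventually_elim (auto intro: E_antimono assms)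
qed simp

text \<open>The filter \<open>F\<close> stands for the approach to the right end, a finite radius or
  infinity. A nonincreasing gap with limit 0 at both ends vanishes identically, hence so does its
  derivative, a sum of two terms of equal sign.\<close>

lemma coincide:
  assumes F: "F \<noteq> bot" "\<forall>\<^sub>F r in F. r \<in> I" "\<And>a. a \<in> I \<Longrightarrow> \<forall>\<^sub>F r in F. a \<le> r" "(E \<longlongrightarrow> 0) F"
    and r: "r \<in> I"
  shows "u r = v r"
proof -
  have E0: "E a = 0" if a: "a \<in> I" for a
  proof (rule antisym[OF E_nonpos[OF a]])
    have "\<forall>\<^sub>F x in F. E x \<le> E a" using F(2) F(3)[OF a] by eventually_elim (auto intro: E_antimono a)
    then show "0 \<le> E a" by (rule tendsto_upperbound[OF F(4) _ F(1)])
  qed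
  have dd: "deriv u x = deriv v x" if x: "a < x" "x < b" "a \<in> I" "b \<in> I" for a b x
  proof -
    have xI: "x \<in> I" using I(2)[OF x(3,4)] x by auto
    have "(E has_real_derivative 0) (at x)"
    proof (rule has_field_derivative_transform_within_open[OF DERIV_const, where S = "{a<..<b}"])
      show "0 = E y" if "y \<in> {a<..<b}" for y
      proof -
        have "y \<in> I" using that by (intro subsetD[OF I(2)[OF x(3,4)]]) auto
        then show ?thesis by (simp add: E0)
      qed
    qed (use x in auto)
    from DERIV_unique[OF E_deriv[OF xI] this]
    have "x powr (real d - 1) * ((deriv u x - deriv v x) * (phi p (deriv u x) - phi p (deriv v x))
       + (u x - v x) * (u x powr q - v x powr q)) = 0" by linarith
    moreover have "x powr (real d - 1) \<noteq> 0" using I(1) xI by auto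
    ultimately have "(deriv u x - deriv v x) * (phi p (deriv u x) - phi p (deriv v x))
       + (u x - v x) * (u x powr q - v x powr q) = 0" by (metis mult_eq_0_iff)
    \<comment> \<open>Strictness comes from the gradient term, since for q = 0 the other one is
      identically 0. So only the derivatives are known to agree, and the functions are matched
      through their common limit at 0.\<close>
    then have "(deriv u x - deriv v x) * (phi p (deriv u x) - phi p (deriv v x)) = 0"
      using E_terms[OF xI] by linarith
    then show ?thesis
      using phi_strict_mono[OF p, of "deriv u x" "deriv v x"] phi_strict_mono[OF p, of "deriv v x" "deriv u x"]
      by (cases "deriv u x" "deriv v x" rule: linorder_cases) auto
  qed
  have const: "u a - v a = u r - v r" if a: "a \<in> I" "a < r" for a
  proof -
    have D: "((\<lambda>x. u x - v x) has_real_derivative deriv u x - deriv v x) (at x)" if "a \<le> x" "x \<le> r" for x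
    proof -
      have "x \<in> I" "0 < x" using I(1) I(2)[OF a(1) r] that by auto
      then show ?thesis by (intro DERIV_diff wflux_deriv(2)[OF u(1)] wflux_deriv(2)[OF v(1)])
    qed
    from MVT2[OF a(2) D] obtain z where z: "a < z" "z < r"
      "(u r - v r) - (u a - v a) = (r - a) * (deriv u z - deriv v z)" by blast
    show ?thesis using z(3) unfolding dd[OF z(1,2) a(1) r] by simp
  qed
  have "((\<lambda>x. u x - v x) \<longlongrightarrow> u r - v r) (at_right 0)"
  proof (rule tendsto_eventually)
    have "0 < r" using r I(1) by auto
    then have "\<forall>\<^sub>F x in at_right 0. x < r" by (auto simp: eventually_at_right_field)
    then show "\<forall>\<^sub>F x in at_right 0. u x - v x = u r - v r"
      using I(3) by eventually_elim (rule const)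
  qed
  moreover have "((\<lambda>r. u r - v r) \<longlongrightarrow> 0) (at_right 0)"
    using tendsto_diff[OF u(2) v(2)] by simp
  ultimately have "u r - v r = 0" by (rule tendsto_unique[rotated]) simp
  then show ?thesis by simp
qed

end
end

section \<open>The constructed profile as a solution of the radial equation\<close>

lemma wflux_profile:
  assumes "profile_on d p q k u w" "1 < p" "0 < r"
  shows "radial_flux p u r = - (w r * r powr (1 - real d))" "wflux d p u r = w r"
proof -
  have w: "0 \<le> w r" using assms by (simp add: profile_on_def)
  have "deriv u r = - ((w r * r powr (1 - real d)) powr (1 / (p - 1)))"
    using assms by (intro DERIV_imp_deriv) (simp add: profile_on_def)
  then have "radial_flux p u r = - (((w r * r powr (1 - real d)) powr (1 / (p - 1))) powr (p - 1))"
    unfolding radial_flux_phi by (subst phi_nonpos) auto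
  also have "\<dots> = - (w r * r powr (1 - real d))"
    using assms w by (simp add: powr_powr)
  finally show f: "radial_flux p u r = - (w r * r powr (1 - real d))" .
  have "r powr (real d - 1) * r powr (1 - real d) = 1"
    using assms by (simp add: powr_add[symmetric])
  then show "wflux d p u r = w r"
    unfolding wflux_def f by (simp add: mult.left_commute)
qed

lemma profile_ode:
  assumes prof: "profile_on d p q k u w" and p: "1 < p" and I: "\<And>r. r \<in> I \<Longrightarrow> 0 < r \<and> 0 < u r"
  shows "radial_ode_on d p q I u"
  unfolding radial_ode_on_def
proof (intro ballI conjI)
  fix r assume "r \<in> I"
  then have r: "0 < r" "0 < u r" using I by auto
  have "(u has_real_derivative - ((w r * r powr (1 - real d)) powr (1 / (p - 1)))) (at r)"
    using prof r by (simp add: profile_on_def)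
  then show "u differentiable at r" unfolding real_differentiable_def by blast
  have dw: "(w has_real_derivative - (r powr (real d - 1) * u r powr q)) (at r)"
    using prof r by (simp add: profile_on_def)
  have "((\<lambda>r. r powr (1 - real d)) has_real_derivative (1 - real d) * r powr (1 - real d - 1)) (at r)"
    by (rule has_real_derivative_powr[OF r(1)])
  from DERIV_minus[OF DERIV_mult[OF dw this]]
  have D: "(radial_flux p u has_real_derivative
      - (- (r powr (real d - 1) * u r powr q) * r powr (1 - real d)
         + (1 - real d) * r powr (1 - real d - 1) * w r)) (at r)"
    by (rule has_field_derivative_transform_within_open[where S = "{0<..}"])
      (use r wflux_profile(1)[OF prof p] in auto)
  then show "radial_flux p u differentiable at r" unfolding real_differentiable_def by blast
  have 1: "r powr (real d - 1) * r powr (1 - real d) = 1"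
    using r by (simp add: powr_add[symmetric])
  have 2: "r powr (1 - real d - 1) = r powr (1 - real d) / r"
    using powr_diff[of r "1 - real d" 1] r by simp
  have "deriv (radial_flux p u) r = u r powr q * (r powr (real d - 1) * r powr (1 - real d))
      + (real d - 1) / r * (w r * r powr (1 - real d))"
    unfolding DERIV_imp_deriv[OF D] 2 by (simp add: algebra_simps add_divide_distrib diff_divide_distrib)
  then show "deriv (radial_flux p u) r + (real d - 1) / r * radial_flux p u r = u r powr q"
    unfolding wflux_profile(1)[OF prof p r(1)] 1 mult_minus_right by linarith
qed

section \<open>Sign and boundary behaviour of the flux, and comparison of solutions\<close>

lemma antimono_deriv_nonpos:
  fixes u :: "real \<Rightarrow> real"
  assumes "(u has_real_derivative D) (at r)" "a < r" "r < b" "antimono_on {a..b} u"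
  shows "D \<le> 0"
proof (rule ccontr)
  assume "\<not> D \<le> 0"
  then obtain e where e: "0 < e" "\<And>h. 0 < h \<Longrightarrow> h < e \<Longrightarrow> u r < u (r + h)"
    using DERIV_pos_inc_right[OF assms(1)] by auto
  define h where "h = min (e / 2) (b - r)"
  have "0 < h" "h < e" "r + h \<le> b" using e assms by (auto simp: h_def)
  then show False using e(2)[of h] assms by (force dest: monotone_onD[of _ _ _ u r "r + h"])
qed

lemma wflux_nonneg:
  assumes "radial_ode_on d p q I u" "r \<in> I" "0 < r" "a < r" "r < b" "antimono_on {a..b} u"
  shows "0 \<le> wflux d p u r"
proof -
  have "deriv u r \<le> 0" by (rule antimono_deriv_nonpos[OF wflux_deriv(2)[OF assms(1-3)] assms(4-6)])
  then show ?thesis by (simp add: wflux_def radial_flux_phi phi_nonpos)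
qed

text \<open>The free boundary condition concerns difference quotients at \<open>R\<close> only. The
  mean value theorem turns one small quotient into an interior point with small flux, and
  monotonicity of the nonnegative flux extends the bound to all later points.\<close>

lemma FBP_wflux_to_0:
  assumes p: "1 < p" and d: "1 \<le> d" and F: "FBP_inf d p q R u" and anti: "antimono_on {0..R} u"
  shows "(wflux d p u \<longlongrightarrow> 0) (at_left R)"
proof -
  have R: "0 < R" and ode: "radial_ode_on d p q {0<..<R} u" and dR: "(u has_real_derivative 0) (at_left R)"
    using F by (auto simp: FBP_inf_def)
  have nn: "0 \<le> wflux d p u r" if "0 < r" "r < R" for r
    using wflux_nonneg[OF ode _ _ _ _ anti] that by auto
  have lim: "((\<lambda>r. (u r - u R) / (r - R)) \<longlongrightarrow> 0) (at_left R)"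
    using dR by (simp add: has_field_derivative_iff)
  show ?thesis
  proof (rule tendstoI)
    fix e :: real assume e: "0 < e"
    \<comment> \<open>Chosen so that slopes below \<delta> have flux at most
      \<open>e / 2\<close>.\<close>
    define \<delta> where "\<delta> = (e / (2 * R powr (real d - 1))) powr (1 / (p - 1))"
    have dl: "0 < \<delta>" using e R by (simp add: \<delta>_def)
    have "\<forall>\<^sub>F r in at_left R. \<bar>(u r - u R) / (r - R)\<bar> < \<delta>"
      using tendstoD[OF lim dl] by simp
    moreover have "\<forall>\<^sub>F r in at_left R. 0 < r \<and> r < R"
      using R by (auto simp: eventually_at_left_field)
    ultimately have "\<forall>\<^sub>F r in at_left R. \<bar>(u r - u R) / (r - R)\<bar> < \<delta> \<and> 0 < r \<and> r < R"
      by eventually_elim blast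
    from eventually_happens'[OF trivial_limit_at_left_real this]
    obtain r where r: "\<bar>(u r - u R) / (r - R)\<bar> < \<delta>" "0 < r" "r < R" by blast
    have "\<exists>l z. r < z \<and> z < R \<and> (u has_real_derivative l) (at z) \<and> u R - u r = (R - r) * l"
    proof (rule MVT[OF r(3)])
      show "continuous_on {r..R} u"
        unfolding continuous_on_eq_continuous_within
      proof
        fix x assume x: "x \<in> {r..R}"
        show "continuous (at x within {r..R}) u"
        proof (cases "x = R")
          case True
          have "continuous (at_left R) u" using dR by (rule DERIV_continuous)
          then show ?thesis unfolding True
            using r by (simp add: at_within_Icc_at_left)
        next
          case False
          then have "isCont u x" using wflux_deriv(2)[OF ode, of x] x r by (auto intro: DERIV_isCont)
          then show ?thesis by (rule continuous_at_imp_continuous_at_within)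
        qed
      qed
      fix x assume "r < x" "x < R"
      then show "u differentiable (at x)" using ode r by (auto simp: radial_ode_on_def)
    qed
    then obtain l z where z: "r < z" "z < R" "(u has_real_derivative l) (at z)" "u R - u r = (R - r) * l" by blast
    have l: "deriv u z = l" using z(3) by (rule DERIV_imp_deriv)
    have "(u r - u R) / (r - R) = l" using z(4) r by (simp add: field_simps)
    then have ll: "\<bar>l\<bar> < \<delta>" using r by simp
    have ln: "l \<le> 0" by (rule antimono_deriv_nonpos[OF z(3) _ z(2) anti]) (use z r in auto)
    have "wflux d p u z = z powr (real d - 1) * (- l) powr (p - 1)"
      using ln by (simp add: wflux_def radial_flux_phi l phi_nonpos)
    also have "\<dots> \<le> R powr (real d - 1) * \<delta> powr (p - 1)"
      using z r ll ln d p by (intro mult_mono powr_mono2) auto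
    also have "\<delta> powr (p - 1) = e / (2 * R powr (real d - 1))"
      using p e R by (simp add: \<delta>_def powr_powr)
    also have "R powr (real d - 1) * (e / (2 * R powr (real d - 1))) = e / 2"
      using R by simp
    finally have wz: "wflux d p u z < e" using e by simp
    have "dist (wflux d p u x) 0 < e" if x: "z < x" "x < R" for x
    proof -
      have "{z..x} \<subseteq> {0<..<R}" using x r z by auto
      then show ?thesis using wflux_antimono[OF ode, of z x] nn[of x] wz x r z by simp
    qed
    then show "\<forall>\<^sub>F x in at_left R. dist (wflux d p u x) 0 < e"
      using z by (auto simp: eventually_at_left_field)
  qed
qed

lemma FBP_left_lim:
  assumes "FBP_inf d p q R u" shows "(u \<longlongrightarrow> 0) (at_left R)"
proof -
  have "(u has_real_derivative 0) (at_left R)" "u R = 0" using assms by (auto simp: FBP_inf_def)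
  then show ?thesis using DERIV_continuous[of u 0 R "{..<R}"] by (simp add: continuous_within)
qed

lemma FBP_ode_interval:
  assumes "1 < p" "1 \<le> d" "0 \<le> q" "0 < T"
  shows "ode_interval d p q {0<..<T}"
  using assms by unfold_locales (auto simp: eventually_at_right_field)

text \<open>If S < R, then at \<open>S\<close> both \<open>v\<close> and its flux vanish, so the
  nonpositive gap tends to \<open>u S * wflux d p u S\<close>. But \<open>u\<close> and its flux are
  still positive there.\<close>

lemma FBP_radius_le:
  assumes p: "1 < p" and d: "1 \<le> d" and q: "0 \<le> q"
    and u: "FBP_inf d p q R u" "antimono_on {0..R} u"
    and v: "FBP_inf d p q S v" "antimono_on {0..S} v"
  shows "R \<le> S"
proof (rule ccontr)
  assume "\<not> R \<le> S"
  then have SR: "S < R" by simp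
  have S: "0 < S" using v by (simp add: FBP_inf_def)
  interpret ode_interval d p q "{0<..<S}" by (rule FBP_ode_interval[OF p d q S])
  have ou: "radial_ode_on d p q {0<..<R} u" and up: "\<And>r. r \<in> {0..<R} \<Longrightarrow> 0 < u r"
    using u by (auto simp: FBP_inf_def)
  have U: "radial_ode_on d p q {0<..<S} u" "(u \<longlongrightarrow> 1) (at_right 0)" "\<And>r. r \<in> {0<..<S} \<Longrightarrow> 0 < u r"
    using u SR by (auto simp: FBP_inf_def radial_ode_on_def)
  have V: "radial_ode_on d p q {0<..<S} v" "(v \<longlongrightarrow> 1) (at_right 0)" "\<And>r. r \<in> {0<..<S} \<Longrightarrow> 0 < v r"
    using v by (auto simp: FBP_inf_def)
  have SI: "S \<in> {0<..<R}" using S SR by simp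
  have cu: "isCont u S" "isCont (wflux d p u) S"
    using wflux_deriv[OF ou SI S] by (auto intro: DERIV_isCont)
  have "(flux_gap d p u v \<longlongrightarrow> (u S - 0) * (wflux d p u S - 0)) (at_left S)"
    unfolding flux_gap_def[abs_def] using cu
    by (intro tendsto_intros FBP_left_lim[OF v(1)] FBP_wflux_to_0[OF p d v])
      (auto intro: filterlim_mono[OF _ order_refl at_le] simp: isCont_def)
  moreover have "\<forall>\<^sub>F r in at_left S. flux_gap d p u v r \<le> 0"
    unfolding eventually_at_left_field using E_nonpos[OF U V] S by (intro exI[of _ 0]) auto
  ultimately have le: "u S * wflux d p u S \<le> 0"
    by (intro tendsto_upperbound) auto
  \<comment> \<open>The flux is nonnegative before \<open>R\<close> and strictly decreasing where u
    is positive.\<close>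
  have "wflux d p u S > 0"
  proof -
    define t where "t = (S + R) / 2"
    have t: "S < t" "t < R" using SR by (auto simp: t_def)
    have "wflux d p u t < wflux d p u S"
    proof (rule DERIV_neg_imp_decreasing[OF t(1)])
      fix x assume x: "S \<le> x" "x \<le> t"
      then show "\<exists>y. (wflux d p u has_real_derivative y) (at x) \<and> y < 0"
        using wflux_deriv(1)[OF ou, of x] up[of x] t S
        by (intro exI[of _ "- (x powr (real d - 1) * u x powr q)"]) auto
    qed
    moreover have "0 \<le> wflux d p u t" using wflux_nonneg[OF ou _ _ _ _ u(2)] t S by auto
    ultimately show ?thesis by simp
  qed
  then show False using le up[of S] S SR by (simp add: mult_le_0_iff)
qed

lemma FBP_unique:
  assumes p: "1 < p" and d: "1 \<le> d" and q: "0 \<le> q"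
    and u: "FBP_inf d p q R u" "antimono_on {0..R} u"
    and v: "FBP_inf d p q S v" "antimono_on {0..S} v"
  shows "S = R" "\<forall>r\<in>{0..R}. v r = u r"
proof -
  show SR: "S = R"
    using FBP_radius_le[OF p d q u v] FBP_radius_le[OF p d q v u] by simp
  have R: "0 < R" using u by (simp add: FBP_inf_def)
  interpret ode_interval d p q "{0<..<R}" by (rule FBP_ode_interval[OF p d q R])
  have U: "radial_ode_on d p q {0<..<R} u" "(u \<longlongrightarrow> 1) (at_right 0)" "\<And>r. r \<in> {0<..<R} \<Longrightarrow> 0 < u r"
    using u by (auto simp: FBP_inf_def)
  have V: "radial_ode_on d p q {0<..<R} v" "(v \<longlongrightarrow> 1) (at_right 0)" "\<And>r. r \<in> {0<..<R} \<Longrightarrow> 0 < v r"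
    using v SR by (auto simp: FBP_inf_def)
  have "(flux_gap d p u v \<longlongrightarrow> (0 - 0) * (0 - 0)) (at_left R)"
    unfolding flux_gap_def[abs_def] using v SR
    by (intro tendsto_intros FBP_left_lim[OF u(1)] FBP_left_lim[of d p q R v] FBP_wflux_to_0[OF p d u]
      FBP_wflux_to_0[OF p d, of q R v]) auto
  then have lim: "(flux_gap d p u v \<longlongrightarrow> 0) (at_left R)" by simp
  have "u r = v r" if "r \<in> {0<..<R}" for r
    by (rule coincide[OF U V _ _ _ lim that]) (use R in \<open>auto simp: eventually_at_left_field\<close>)
  then show "\<forall>r\<in>{0..R}. v r = u r"
  proof (intro ballI)
    fix r assume r: "r \<in> {0..R}"
    have e: "u 0 = 1" "v 0 = 1" "u R = 0" "v R = 0" using u(1) v(1) SR by (simp_all add: FBP_inf_def)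
    consider "r = 0" | "r = R" | "r \<in> {0<..<R}" using r by fastforce
    then show "v r = u r"
    proof cases
      case 3 then show ?thesis using \<open>\<And>r. r \<in> {0<..<R} \<Longrightarrow> u r = v r\<close>[OF 3] by simp
    qed (use e in simp_all)
  qed
qed

text \<open>No decay of the flux is prescribed at infinity. Nonnegative nonincreasing fluxes are
  bounded, however, and a bounded factor is enough for the gap to tend to 0 together with
  \<open>u - v\<close>.\<close>

lemma P_unique:
  assumes p: "1 < p" and d: "1 \<le> d" and q: "0 \<le> q"
    and u: "P_inf d p q u" "\<And>r. 0 \<le> r \<Longrightarrow> 0 < u r"
    and v: "P_inf d p q v" "\<And>r. 0 \<le> r \<Longrightarrow> 0 < v r"
    and r: "0 \<le> r"
  shows "v r = u r"
proof (cases "r = 0")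
  case True then show ?thesis using u v by (simp add: P_inf_def)
next
  case False
  interpret ode_interval d p q "{0<..}"
    using p d q by unfold_locales (auto simp: eventually_at_right_field intro: exI[of _ 1])
  have U: "radial_ode_on d p q {0<..} u" "(u \<longlongrightarrow> 1) (at_right 0)" "\<And>r. r \<in> {0<..} \<Longrightarrow> 0 < u r"
    using u by (auto simp: P_inf_def)
  have V: "radial_ode_on d p q {0<..} v" "(v \<longlongrightarrow> 1) (at_right 0)" "\<And>r. r \<in> {0<..} \<Longrightarrow> 0 < v r"
    using v by (auto simp: P_inf_def)
  \<comment> \<open>A negative flux would stay negative and make the solution increase from then on,
    against its decay to 0.\<close>
  have nn: "0 \<le> wflux d p w s" if w: "P_inf d p q w" "\<And>r. 0 \<le> r \<Longrightarrow> 0 < w r" and s: "0 < s" for w s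
  proof (rule ccontr)
    assume neg: "\<not> 0 \<le> wflux d p w s"
    have ow: "radial_ode_on d p q {0<..} w" and lim: "(w \<longlongrightarrow> 0) at_top" using w by (auto simp: P_inf_def)
    have inc: "w s \<le> w t" if st: "s \<le> t" for t
    proof (rule DERIV_nonneg_imp_nondecreasing[OF st])
      fix x assume x: "s \<le> x" "x \<le> t"
      have "wflux d p w x < 0"
      proof -
        have "{s..x} \<subseteq> {0<..}" using x s by auto
        then show ?thesis using wflux_antimono[OF ow, of s x] neg x s by simp
      qed
      then have "0 < deriv w x"
      proof (rule contrapos_pp)
        assume "\<not> 0 < deriv w x"
        then have "wflux d p w x = x powr (real d - 1) * (- deriv w x) powr (p - 1)"
          by (simp add: wflux_def radial_flux_phi phi_nonpos)
        moreover have "0 \<le> x powr (real d - 1) * (- deriv w x) powr (p - 1)"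
          by (intro mult_nonneg_nonneg) auto
        ultimately show "\<not> wflux d p w x < 0" by linarith
      qed
      then show "\<exists>y. (w has_real_derivative y) (at x) \<and> 0 \<le> y"
        using wflux_deriv(2)[OF ow, of x] x s by auto
    qed
    obtain t where "s \<le> t" "w t < w s"
      by (rule at_top_exists_ge[OF order_tendstoD(2)[OF lim]]) (use w(2)[of s] s in auto)
    then show False using inc[of t] by simp
  qed
  have "(flux_gap d p u v \<longlongrightarrow> 0) at_top"
  proof (rule tendsto_0_le)
    show "((\<lambda>r. u r - v r) \<longlongrightarrow> 0) at_top"
      using tendsto_diff[of u 0 at_top v 0] u v by (simp add: P_inf_def)
    have "norm (flux_gap d p u v x) \<le> norm (u x - v x) * (wflux d p u 1 + wflux d p v 1)" if "1 \<le> x" for x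
    proof -
      have sub: "{1..x} \<subseteq> {0<..}" by auto
      have "0 \<le> wflux d p u x" by (rule nn[OF u]) (use that in auto)
      moreover have "0 \<le> wflux d p v x" by (rule nn[OF v]) (use that in auto)
      ultimately have "\<bar>wflux d p u x - wflux d p v x\<bar> \<le> wflux d p u 1 + wflux d p v 1"
        using wflux_antimono[OF U(1) sub _ that] wflux_antimono[OF V(1) sub _ that] by linarith
      then show ?thesis unfolding flux_gap_def real_norm_def abs_mult by (rule mult_left_mono) simp
    qed
    then show "\<forall>\<^sub>F x in at_top. norm (flux_gap d p u v x) \<le> norm (u x - v x) * (wflux d p u 1 + wflux d p v 1)"
      by (auto simp: eventually_at_top_linorder)
  qed
  from coincide[OF U V _ _ _ this, of r] show ?thesis
    using False r by (simp add: eventually_gt_at_top eventually_ge_at_top)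
qed

lemma profile_onD:
  assumes "profile_on d p q k u w"
  shows "0 < k" "u 0 = 1" "w 0 = k" "continuous_on {0..} u" "continuous_on {0..} w"
    "antimono_on {0..} u" "antimono_on {0..} w" "\<And>r. 0 \<le> r \<Longrightarrow> 0 \<le> u r" "\<And>r. 0 \<le> r \<Longrightarrow> 0 \<le> w r"
    "(u \<longlongrightarrow> 0) at_top" "(w \<longlongrightarrow> 0) at_top"
    "\<And>r. 0 < r \<Longrightarrow> (u has_real_derivative - ((w r * r powr (1 - real d)) powr (1 / (p - 1)))) (at r)"
    "\<And>r. 0 < r \<Longrightarrow> 0 < u r \<Longrightarrow> 0 < w r"
    "\<And>r. 0 < r \<Longrightarrow> 0 < u r \<Longrightarrow> (w has_real_derivative - (r powr (real d - 1) * u r powr q)) (at r)"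
    "\<And>r. 0 \<le> r \<Longrightarrow> u r = 0 \<Longrightarrow> w r = 0"
    "q < p - 1 \<Longrightarrow> \<exists>R>0. (\<forall>r\<in>{0..<R}. 0 < u r) \<and> (\<forall>r\<ge>R. u r = 0)"
    "\<And>r. p - 1 \<le> q \<Longrightarrow> 0 \<le> r \<Longrightarrow> 0 < u r"
  using assms[unfolded profile_on_def] by presburger+

theorem profile_unique:
  assumes prof: "profile_on d p q k u w" and d: "1 \<le> d" and p: "1 < p" and q: "0 \<le> q"
  shows "unique_profile d p q u"
proof -
  note P = profile_onD[OF prof]
  have u1: "(u \<longlongrightarrow> 1) (at_right 0)"
  proof -
    have "continuous (at 0 within {0..}) u" using P(4) by (auto simp: continuous_on_eq_continuous_within)
    then have "(u \<longlongrightarrow> u 0) (at 0 within {0..})" by (simp add: continuous_within)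
    then have "(u \<longlongrightarrow> u 0) (at 0 within {0<..})" by (rule filterlim_mono[OF _ order_refl at_le]) auto
    then show ?thesis unfolding P(2) .
  qed
  show ?thesis
    unfolding unique_profile_def
  proof (intro conjI impI)
    assume "q < p - 1"
    then obtain R where R: "0 < R" "\<forall>r\<in>{0..<R}. 0 < u r" "\<forall>r\<ge>R. u r = 0" using P(16) by blast
    have ode: "radial_ode_on d p q {0<..<R} u"
      by (rule profile_ode[OF prof p]) (use R in auto)
    \<comment> \<open>The flux vanishes together with u, which yields the second condition at the
      free boundary.\<close>
    have "w R = 0" using P(15)[of R] R by simp
    then have "(u has_real_derivative 0) (at R)" using P(12)[OF R(1)] by simp
    then have "(u has_real_derivative 0) (at_left R)" by (rule has_field_derivative_at_within)
    then have F: "FBP_inf d p q R u" unfolding FBP_inf_def using R ode u1 P(2) by auto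
    have A: "antimono_on {0..R} u" by (rule monotone_on_subset[OF P(6)]) auto
    show "\<exists>R. FBP_inf d p q R u \<and> antimono_on {0..R} u \<and> (\<forall>r\<ge>R. u r = 0) \<and>
       (\<forall>S v. FBP_inf d p q S v \<and> antimono_on {0..S} v \<longrightarrow> S = R \<and> (\<forall>r\<in>{0..R}. v r = u r))"
    proof (intro exI[of _ R] conjI F A R(3) allI impI; elim conjE)
      fix S v assume "FBP_inf d p q S v" "antimono_on {0..S} v"
      from FBP_unique[OF p d q F A this] show "S = R" "\<forall>r\<in>{0..R}. v r = u r" by blast+
    qed
  next
    assume "p - 1 \<le> q"
    then have pos: "\<forall>r\<ge>0. 0 < u r" using P(17) by blast
    have ode: "radial_ode_on d p q {0<..} u"
      by (rule profile_ode[OF prof p]) (use pos in auto)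
    show F: "P_inf d p q u" unfolding P_inf_def using ode u1 P(2,10) by blast
    show "\<forall>r\<ge>0. 0 < u r" by fact
    show "strict_antimono_on {0..} u"
    proof (rule monotone_onI)
      fix x y :: real assume x: "x \<in> {0..}" "y \<in> {0..}" "x < y"
      show "u y < u x"
      proof (rule DERIV_neg_imp_decreasing_open[OF x(3)])
        fix z assume z: "x < z" "z < y"
        have "0 < (w z * z powr (1 - real d)) powr (1 / (p - 1))" using P(13)[of z] pos z x by auto
        then show "\<exists>l. (u has_real_derivative l) (at z) \<and> l < 0"
          using P(12)[of z] z x by (intro exI[of _ "- ((w z * z powr (1 - real d)) powr (1 / (p - 1)))"]) auto
      next
        show "continuous_on {x..y} u" by (rule continuous_on_subset[OF P(4)]) (use x in auto)
      qed
    qed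
    show "\<forall>v. P_inf d p q v \<and> (\<forall>r\<ge>0. 0 < v r) \<longrightarrow> (\<forall>r\<ge>0. v r = u r)"
    proof (intro allI impI, elim conjE)
      fix v and r :: real assume v: "P_inf d p q v" "\<forall>r\<ge>0. 0 < v r" and r: "0 \<le> r"
      show "v r = u r" by (rule P_unique[OF p d q F _ v(1) _ r]) (use pos v in blast)+
    qed
  qed
qed

section \<open>Affine changes of variables and difference quotients\<close>

text \<open>The coordinatewise affine change of variables with the same factor in every
  coordinate.\<close>

lemma lebesgue_scaleR_translate:
  fixes t :: "'a::euclidean_space"
  assumes "c \<noteq> 0"
  shows "lebesgue = density (distr lebesgue lebesgue (\<lambda>x. t + c *\<^sub>R x)) (\<lambda>_. ennreal (\<bar>c\<bar> ^ DIM('a)))"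
    and "(\<lambda>x. t + c *\<^sub>R x) \<in> lebesgue \<rightarrow>\<^sub>M lebesgue"
  using lebesgue_affine_euclidean[where c="\<lambda>_::'a. c" and t=t]
    lebesgue_affine_measurable[where c="\<lambda>_::'a. c" and t=t] assms
  unfolding scaleR_scaleR[symmetric] scaleR_sum_right[symmetric] euclidean_representation prod_constant
  by simp_all

lemma measurable_lebesgue_affine:
  fixes t :: "'a::euclidean_space"
  assumes "c \<noteq> 0" "f \<in> measurable lebesgue M"
  shows "(\<lambda>x. f (t + c *\<^sub>R x)) \<in> measurable lebesgue M"
  using measurable_compose[OF lebesgue_scaleR_translate(2)[OF assms(1)] assms(2)] .

lemma lebesgue_integral_affine:
  fixes f :: "'a::euclidean_space \<Rightarrow> real"
  assumes "c \<noteq> 0" "f \<in> borel_measurable lebesgue"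
  shows "(LINT x|lebesgue. f x) = \<bar>c\<bar> ^ DIM('a) * (LINT x|lebesgue. f (t + c *\<^sub>R x))"
    and "integrable lebesgue (\<lambda>x. f (t + c *\<^sub>R x)) \<longleftrightarrow> integrable lebesgue f"
proof -
  let ?T = "\<lambda>x. t + c *\<^sub>R x"
  note L = lebesgue_scaleR_translate[OF assms(1), of t]
  have fm: "f \<in> borel_measurable (distr lebesgue lebesgue ?T)" using assms(2) by simp
  have "(LINT x|lebesgue. f x) = (LINT x|density (distr lebesgue lebesgue ?T) (\<lambda>_. ennreal (\<bar>c\<bar> ^ DIM('a))). f x)"
    using L(1) by simp
  also have "\<dots> = \<bar>c\<bar> ^ DIM('a) * (LINT x|distr lebesgue lebesgue ?T. f x)"
    using fm by (subst integral_density) auto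
  also have "(LINT x|distr lebesgue lebesgue ?T. f x) = (LINT x|lebesgue. f (?T x))"
    by (rule integral_distr[OF L(2) assms(2)])
  finally show "(LINT x|lebesgue. f x) = \<bar>c\<bar> ^ DIM('a) * (LINT x|lebesgue. f (?T x))" .
  have "integrable lebesgue f \<longleftrightarrow> integrable (density (distr lebesgue lebesgue ?T) (\<lambda>_. ennreal (\<bar>c\<bar> ^ DIM('a)))) f"
    using L(1) by simp
  also have "\<dots> \<longleftrightarrow> integrable (distr lebesgue lebesgue ?T) (\<lambda>x. \<bar>c\<bar> ^ DIM('a) *\<^sub>R f x)"
    using fm by (subst integrable_density) auto
  also have "\<dots> \<longleftrightarrow> integrable (distr lebesgue lebesgue ?T) f"
    using assms(1) by simp
  also have "\<dots> \<longleftrightarrow> integrable lebesgue (\<lambda>x. f (?T x))"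
    by (rule integrable_distr_eq[OF L(2) assms(2)])
  finally show "integrable lebesgue (\<lambda>x. f (?T x)) \<longleftrightarrow> integrable lebesgue f" by simp
qed

lemma integrable_bounded_support:
  fixes f :: "'a::euclidean_space \<Rightarrow> 'b::euclidean_space"
  assumes "f \<in> borel_measurable lebesgue" "\<And>x. norm (f x) \<le> B" "\<And>x. K < norm x \<Longrightarrow> f x = 0"
  shows "integrable lebesgue f"
proof (rule Bochner_Integration.integrable_bound)
  show "integrable lebesgue (\<lambda>x::'a. indicator (cball 0 K) x * B)"
    by (intro integrable_mult_left integrable_real_indicator) (auto simp: emeasure_lborel_cball_finite[unfolded infinity_ennreal_def])
  show "AE x in lebesgue. norm (f x) \<le> norm (indicator (cball 0 K) x * B)"
  proof (intro AE_I2)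
    fix x show "norm (f x) \<le> norm (indicator (cball 0 K) x * B)"
    proof (cases "norm x \<le> K")
      case True
      have "norm (f x) \<le> \<bar>B\<bar>" using assms(2)[of x] by linarith
      then show ?thesis using True by simp
    next
      case False then show ?thesis using assms(3)[of x] by simp
    qed
  qed
qed fact

lemma integrable_continuous_support:
  fixes f :: "'a::euclidean_space \<Rightarrow> real"
  assumes "continuous_on UNIV f" "\<And>x. K < norm x \<Longrightarrow> f x = 0"
  shows "integrable lebesgue f" "\<exists>B. \<forall>x. \<bar>f x\<bar> \<le> B"
proof -
  have "compact (f ` cball 0 K)"
    by (intro compact_continuous_image continuous_on_subset[OF assms(1)]) auto
  then obtain B where B: "\<And>x. x \<in> cball 0 K \<Longrightarrow> norm (f x) \<le> B"
    using compact_imp_bounded bounded_iff by (metis imageI)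
  have "\<bar>f x\<bar> \<le> max B 0" for x
    using B[of x] assms(2)[of x] by (cases "norm x \<le> K") auto
  then show "\<exists>B. \<forall>x. \<bar>f x\<bar> \<le> B" by blast
  show "integrable lebesgue f"
    by (rule integrable_bounded_support[where B = "max B 0" and K = K])
      (use \<open>\<And>x. \<bar>f x\<bar> \<le> max B 0\<close> assms borel_measurable_continuous_onI[OF assms(1)] in \<open>auto simp: measurable_completion\<close>)
qed

lemma lip_continuous:
  fixes w :: "'a::euclidean_space \<Rightarrow> real"
  assumes "\<And>x y. \<bar>w x - w y\<bar> \<le> L * norm (x - y)"
  shows "continuous_on S w"
proof -
  have "\<bar>w x - w y\<bar> \<le> \<bar>L\<bar> * norm (x - y)" for x y
    using order_trans[OF assms mult_right_mono[of L "\<bar>L\<bar>"]] by simp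
  then have "\<bar>L\<bar>-lipschitz_on S w" by (intro lipschitz_onI) (auto simp: dist_norm)
  then show ?thesis by (rule lipschitz_on_continuous_on)
qed

text \<open>The integral of a difference quotient vanishes by translation invariance.\<close>

lemma integral_partial_derivative_zero:
  fixes w :: "'a::euclidean_space \<Rightarrow> real"
  assumes lip: "\<And>x y. \<bar>w x - w y\<bar> \<le> L * norm (x - y)" and supp: "\<And>x. K < norm x \<Longrightarrow> w x = 0"
    and D: "AE x in lebesgue. ((\<lambda>h. w (x + h *\<^sub>R b)) has_real_derivative D x) (at 0)"
  shows "integrable lebesgue D" "(LINT x|lebesgue. D x) = 0"
proof -
  have cont: "continuous_on UNIV w" by (rule lip_continuous[OF lip])
  have iw: "integrable lebesgue w" by (rule integrable_continuous_support[OF cont supp])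
  define h where "h n = inverse (real (Suc n))" for n
  have h: "0 < h n" "h n \<le> 1" for n by (auto simp: h_def inverse_le_1_iff)
  define f where "f n x = (w (x + h n *\<^sub>R b) - w x) / h n" for n x
  have tr: "integrable lebesgue (\<lambda>x. w (x + h n *\<^sub>R b))" "(LINT x|lebesgue. w (x + h n *\<^sub>R b)) = (LINT x|lebesgue. w x)" for n
    using lebesgue_integral_affine[of 1 w "h n *\<^sub>R b"] iw borel_measurable_integrable[OF iw]
    by (simp_all add: add.commute)
  have f0: "(LINT x|lebesgue. f n x) = 0" for n
    unfolding f_def using tr iw by simp
  have fm: "f n \<in> borel_measurable lebesgue" for n
    unfolding f_def using borel_measurable_integrable[OF tr(1)] borel_measurable_integrable[OF iw] by measurable
  \<comment> \<open>As \<open>h n \<le> 1\<close>, all difference quotients are supported in this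
    one ball.\<close>
  define g where "g x = indicator (cball 0 (K + norm b)) x * (\<bar>L\<bar> * norm b)" for x :: 'a
  have bd: "norm (f n x) \<le> g x" for n x
  proof (cases "norm x \<le> K + norm b")
    case True
    have "\<bar>w (x + h n *\<^sub>R b) - w x\<bar> \<le> L * (h n * norm b)" using lip[of "x + h n *\<^sub>R b" x] h[of n] by simp
    also have "\<dots> \<le> \<bar>L\<bar> * (h n * norm b)" using h[of n] by (intro mult_right_mono) auto
    finally have "\<bar>w (x + h n *\<^sub>R b) - w x\<bar> / h n \<le> \<bar>L\<bar> * norm b"
      using h(1)[of n] by (simp add: divide_le_eq mult_ac)
    then show ?thesis using True h(1)[of n] by (simp add: g_def f_def)
  next
    case False
    have "norm (h n *\<^sub>R b) \<le> norm b" using h[of n] by (simp add: mult_left_le_one_le)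
    then have "K < norm (x + h n *\<^sub>R b)" using False norm_diff_ineq[of x "h n *\<^sub>R b"] by linarith
    moreover have "K < norm x" using False norm_ge_zero[of b] by linarith
    ultimately show ?thesis using supp False by (simp add: f_def g_def)
  qed
  have ig: "integrable lebesgue g" unfolding g_def
    by (intro integrable_mult_left integrable_real_indicator) (auto simp: emeasure_lborel_cball_finite[unfolded infinity_ennreal_def])
  have lim: "AE x in lebesgue. (\<lambda>n. f n x) \<longlonglongrightarrow> D x"
    using D
  proof eventually_elim
    case (elim x)
    then have "((\<lambda>t. (w (x + t *\<^sub>R b) - w x) / t) \<longlongrightarrow> D x) (at 0)"
      by (simp add: DERIV_def)
    moreover have "filterlim h (at 0) sequentially"
    proof (rule filterlim_atI)
      show "h \<longlonglongrightarrow> 0" unfolding h_def by (rule LIMSEQ_inverse_real_of_nat)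
      show "\<forall>\<^sub>F n in sequentially. h n \<noteq> 0" using h(1) by (simp add: less_imp_neq[symmetric])
    qed
    ultimately show ?case unfolding f_def by (rule filterlim_compose)
  qed
  \<comment> \<open>\<open>D\<close> is determined only almost everywhere; completeness of Lebesgue
    measure still makes it measurable.\<close>
  have meas: "D \<in> borel_measurable lebesgue"
  proof (rule borel_measurable_AE)
    show "(\<lambda>x. lim (\<lambda>n. f n x)) \<in> borel_measurable lebesgue"
      by (intro borel_measurable_lim_metric fm)
    show "AE x in lebesgue. lim (\<lambda>n. f n x) = D x" using lim by eventually_elim (rule limI)
  qed
  show "integrable lebesgue D"
    by (rule integrable_dominated_convergence[OF meas fm ig lim]) (use bd in auto)
  have "(\<lambda>n. LINT x|lebesgue. f n x) \<longlonglongrightarrow> (LINT x|lebesgue. D x)"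
    by (rule integral_dominated_convergence[OF meas fm ig lim]) (use bd in auto)
  then show "(LINT x|lebesgue. D x) = 0" unfolding f0 by (simp add: LIMSEQ_const_iff)
qed

section \<open>Test functions\<close>

lemma ktcd_const: "k_times_cont_diff k (\<lambda>_. c)"
  by (induction k arbitrary: c) auto

lemma frechet_derivative_eqI: "(f has_derivative f') (at x) \<Longrightarrow> frechet_derivative f (at x) = f'"
  using frechet_derivative_at by metis

lemma ktcd_SucI:
  assumes "\<And>x. (f has_derivative f' x) (at x)" "\<And>b. b \<in> Basis \<Longrightarrow> k_times_cont_diff k (\<lambda>x. f' x b)"
  shows "k_times_cont_diff (Suc k) f"
  using assms frechet_derivative_eqI[OF assms(1)] by (auto simp: differentiable_def)

lemma ktcd_SucD:
  assumes "k_times_cont_diff (Suc k) f"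
  shows "(f has_derivative frechet_derivative f (at x)) (at x)"
    "b \<in> Basis \<Longrightarrow> k_times_cont_diff k (\<lambda>x. frechet_derivative f (at x) b)"
  using assms by (auto simp: frechet_derivative_works[symmetric])

lemma ktcd_Suc_imp: "k_times_cont_diff (Suc k) f \<Longrightarrow> k_times_cont_diff k f"
proof (induction k arbitrary: f)
  case 0
  then show ?case
    using ktcd_SucD(1)[OF 0] by (auto simp: continuous_on_eq_continuous_at intro: has_derivative_continuous)
next
  case (Suc k)
  from ktcd_SucD[OF Suc.prems] show ?case by (intro ktcd_SucI) (auto intro: Suc.IH)
qed

lemma ktcd_add: "k_times_cont_diff k f \<Longrightarrow> k_times_cont_diff k g \<Longrightarrow> k_times_cont_diff k (\<lambda>x. f x + g x)"
proof (induction k arbitrary: f g)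
  case 0 then show ?case by (auto intro: continuous_intros)
next
  case (Suc k)
  note F = ktcd_SucD[OF Suc.prems(1)] and G = ktcd_SucD[OF Suc.prems(2)]
  show ?case by (rule ktcd_SucI[OF has_derivative_add[OF F(1) G(1)]]) (intro Suc.IH F(2) G(2))
qed

lemma ktcd_mult: "k_times_cont_diff k f \<Longrightarrow> k_times_cont_diff k g \<Longrightarrow> k_times_cont_diff k (\<lambda>x. f x * g x)"
proof (induction k arbitrary: f g)
  case 0 then show ?case by (auto intro: continuous_intros)
next
  case (Suc k)
  note F = ktcd_SucD[OF Suc.prems(1)] and G = ktcd_SucD[OF Suc.prems(2)]
  note f = ktcd_Suc_imp[OF Suc.prems(1)] and g = ktcd_Suc_imp[OF Suc.prems(2)]
  show ?case
    by (rule ktcd_SucI[OF has_derivative_mult[OF F(1) G(1)]]) (intro ktcd_add Suc.IH F(2) G(2) f g)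
qed

lemma ktcd_prod:
  assumes "finite A" "\<And>a. a \<in> A \<Longrightarrow> k_times_cont_diff k (f a)"
  shows "k_times_cont_diff k (\<lambda>x. \<Prod>a\<in>A. f a x)"
  using assms by (induction A rule: finite_induct) (auto intro: ktcd_const ktcd_mult)

lemma ktcd_affine:
  fixes f :: "'a::euclidean_space \<Rightarrow> real"
  shows "k_times_cont_diff k f \<Longrightarrow> k_times_cont_diff k (\<lambda>x. f (t + c *\<^sub>R x))"
proof (induction k arbitrary: f)
  case 0
  have "continuous_on UNIV (\<lambda>x. f (t + c *\<^sub>R x))"
    by (rule continuous_on_compose2[of UNIV f]) (use 0 in \<open>auto intro!: continuous_intros\<close>)
  then show ?case by simp
next
  case (Suc k)
  note F = ktcd_SucD[OF Suc.prems]
  have D: "((\<lambda>x. f (t + c *\<^sub>R x)) has_derivative (\<lambda>h. frechet_derivative f (at (t + c *\<^sub>R x)) (c *\<^sub>R h))) (at x)" for x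
    by (rule has_derivative_compose[of "\<lambda>x. t + c *\<^sub>R x" "\<lambda>h. c *\<^sub>R h" x UNIV, OF _ F(1)])
      (auto intro!: derivative_eq_intros)
  have lin: "frechet_derivative f (at y) (c *\<^sub>R b) = c * frechet_derivative f (at y) b" for y b
    using has_derivative_linear[OF F(1)] by (simp add: linear_cmul)
  show ?case
    by (rule ktcd_SucI[OF D], unfold lin) (intro ktcd_mult ktcd_const Suc.IH F(2))
qed

lemma test_function_affine:
  fixes f :: "'a::euclidean_space \<Rightarrow> real"
  assumes f: "test_function f" and c: "c \<noteq> 0"
  shows "test_function (\<lambda>x. f (t + c *\<^sub>R x))"
    and "frechet_derivative (\<lambda>x. f (t + c *\<^sub>R x)) (at x) b = c * frechet_derivative f (at (t + c *\<^sub>R x)) b"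
proof -
  have k: "\<And>k. k_times_cont_diff k f" and cpt: "compact (closure {x. f x \<noteq> 0})"
    using f by (auto simp: test_function_def)
  note F = ktcd_SucD[OF k[of "Suc 0"]]
  have D: "((\<lambda>x. f (t + c *\<^sub>R x)) has_derivative (\<lambda>h. frechet_derivative f (at (t + c *\<^sub>R x)) (c *\<^sub>R h))) (at x)"
    by (rule has_derivative_compose[of "\<lambda>x. t + c *\<^sub>R x" "\<lambda>h. c *\<^sub>R h" x UNIV, OF _ F(1)])
      (auto intro!: derivative_eq_intros)
  show "frechet_derivative (\<lambda>x. f (t + c *\<^sub>R x)) (at x) b = c * frechet_derivative f (at (t + c *\<^sub>R x)) b"
    unfolding frechet_derivative_eqI[OF D] using has_derivative_linear[OF F(1)] by (simp add: linear_cmul)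
  have "bounded {x. f x \<noteq> 0}" using cpt compact_imp_bounded bounded_subset closure_subset by metis
  then obtain B where B: "\<And>x. f x \<noteq> 0 \<Longrightarrow> norm x \<le> B" by (auto simp: bounded_iff)
  have "norm x \<le> (B + norm t) / \<bar>c\<bar>" if "f (t + c *\<^sub>R x) \<noteq> 0" for x
  proof -
    have "\<bar>c\<bar> * norm x = norm ((t + c *\<^sub>R x) - t)" by simp
    also have "\<dots> \<le> norm (t + c *\<^sub>R x) + norm t" by (rule norm_triangle_ineq4)
    finally show ?thesis using B[OF that] c by (simp add: le_divide_eq mult.commute)
  qed
  then have "bounded {x. f (t + c *\<^sub>R x) \<noteq> 0}" unfolding bounded_iff by blast
  then show "test_function (\<lambda>x. f (t + c *\<^sub>R x))"
    unfolding test_function_def using ktcd_affine[OF k] by (simp add: compact_closure)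
qed

text \<open>\<open>flat 0\<close> is the standard smooth function exp (-1/t). The powers are
  included because the derivative of \<open>flat j\<close> combines \<open>flat (j + 1)\<close> and
  \<open>flat (j + 2)\<close>, so that the family is closed under differentiation and smooth by a
  single induction.\<close>

definition flat :: "nat \<Rightarrow> real \<Rightarrow> real" where
  "flat j t = (if 0 < t then (1 / t) ^ j * exp (- (1 / t)) else 0)"

lemma flat_lim_0: "(flat j \<longlongrightarrow> 0) (at 0)"
proof -
  have "((\<lambda>t. (1 / t) ^ j / exp (1 / t)) \<longlongrightarrow> (0::real)) (at_right 0)"
    using filterlim_compose[OF tendsto_power_div_exp_0[of j] filterlim_inverse_at_top_right]
    by (simp add: inverse_eq_divide)
  then have "(flat j \<longlongrightarrow> 0) (at_right 0)"
  proof (rule Lim_transform_eventually)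
    have "(1 / t) ^ j / exp (1 / t) = flat j t" if "0 < t" for t
      using that by (simp add: flat_def exp_minus divide_inverse)
    then show "\<forall>\<^sub>F t in at_right 0. (1 / t) ^ j / exp (1 / t) = flat j t"
      unfolding eventually_at_right_field by (intro exI[of _ 1]) simp
  qed
  moreover have "(flat j \<longlongrightarrow> 0) (at_left 0)"
  proof (rule Lim_transform_eventually[OF tendsto_const])
    show "\<forall>\<^sub>F t in at_left 0. 0 = flat j t"
      unfolding eventually_at_left_field by (intro exI[of _ "-1"]) (simp add: flat_def)
  qed
  ultimately show ?thesis by (simp add: filterlim_at_split)
qed

lemma flat_deriv: "(flat j has_real_derivative flat (j + 2) t - real j * flat (j + 1) t) (at t)"
proof (cases t "0::real" rule: linorder_cases)
  case less
  have "(flat j has_real_derivative 0) (at t)"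
    by (rule has_field_derivative_transform_within_open[OF DERIV_const, where S = "{..<0}"])
      (use less in \<open>auto simp: flat_def\<close>)
  then show ?thesis using less by (simp add: flat_def)
next
  case equal
  have "((\<lambda>h. (flat j (0 + h) - flat j 0) / h) \<longlongrightarrow> 0) (at 0)"
  proof (rule Lim_transform_eventually[OF flat_lim_0[of "Suc j"]])
    have "flat (Suc j) h = (flat j (0 + h) - flat j 0) / h" for h
      by (simp add: flat_def)
    then show "\<forall>\<^sub>F h in at 0. flat (Suc j) h = (flat j (0 + h) - flat j 0) / h" by simp
  qed
  then show ?thesis using equal by (simp add: DERIV_def flat_def)
next
  case greater
  have "((\<lambda>t. (1 / t) ^ j * exp (- (1 / t))) has_real_derivative flat (j + 2) t - real j * flat (j + 1) t) (at t)"
  proof -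
    have 1: "((\<lambda>t. 1 / t) has_real_derivative - ((1 / t) ^ 2)) (at t)"
      using greater by (auto intro!: derivative_eq_intros simp: power2_eq_square)
    have 2: "((\<lambda>t. exp (- (1 / t))) has_real_derivative exp (- (1 / t)) * (1 / t) ^ 2) (at t)"
      using DERIV_fun_exp[OF DERIV_minus[OF 1]] by simp
    show ?thesis
      by (rule DERIV_cong[OF DERIV_mult[OF DERIV_power[OF 1] 2]], cases j)
        (use greater in \<open>simp_all add: flat_def power2_eq_square algebra_simps\<close>)
  qed
  then show ?thesis
    by (rule has_field_derivative_transform_within_open[where S = "{0<..}"])
      (use greater in \<open>auto simp: flat_def\<close>)
qed

lemma ktcd_flat:
  fixes e :: "'a::euclidean_space"
  shows "k_times_cont_diff k (\<lambda>x. flat j (c + x \<bullet> e))"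
proof (induction k arbitrary: j)
  case 0
  have "continuous_on UNIV (flat j)"
    using flat_deriv DERIV_isCont by (metis continuous_on_eq_continuous_at open_UNIV)
  then have "continuous_on UNIV (\<lambda>x. flat j (c + x \<bullet> e))"
    by (rule continuous_on_compose2) (auto intro!: continuous_intros)
  then show ?case by simp
next
  case (Suc k)
  have D: "((\<lambda>x. flat j (c + x \<bullet> e)) has_derivative
      (\<lambda>h. (flat (j + 2) (c + x \<bullet> e) + (- real j) * flat (j + 1) (c + x \<bullet> e)) * (h \<bullet> e))) (at x)" for x
  proof -
    have "((\<lambda>x. c + x \<bullet> e) has_derivative (\<lambda>h. h \<bullet> e)) (at x)"
      by (auto intro!: derivative_eq_intros)
    from has_derivative_compose[OF this has_field_derivative_imp_has_derivative[OF flat_deriv]]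
    show ?thesis by simp
  qed
  show ?case
    by (rule ktcd_SucI[OF D]) (intro ktcd_mult ktcd_add ktcd_const Suc.IH)
qed

text \<open>A product over coordinates, supported in a cube: only \<open>flat\<close> composed with
  affine functions has to be differentiated.\<close>

definition bump :: "real \<Rightarrow> 'a::euclidean_space \<Rightarrow> real" where
  "bump \<rho> x = (\<Prod>e\<in>Basis. flat 0 (\<rho> + x \<bullet> e) * flat 0 (\<rho> + x \<bullet> (- e)))"

lemma ktcd_bump: "k_times_cont_diff k (bump \<rho>)"
  unfolding bump_def[abs_def] by (intro ktcd_prod ktcd_mult ktcd_flat finite_Basis)

lemma bump_nonneg: "0 \<le> bump \<rho> x"
  unfolding bump_def by (intro prod_nonneg) (auto simp: flat_def)

lemma bump_pos: "0 < \<rho> \<Longrightarrow> 0 < bump \<rho> 0"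
  unfolding bump_def by (intro prod_pos) (auto simp: flat_def)

text \<open>The cube of half side \<rho> lies in the ball of radius d * \<rho>, by comparison with
  the l1 norm; the mollifier is rescaled accordingly.\<close>

lemma bump_support:
  fixes x :: "'a::euclidean_space"
  assumes "real DIM('a) * \<rho> < norm x" shows "bump \<rho> x = 0"
proof (rule ccontr)
  assume "bump \<rho> x \<noteq> 0"
  then have "\<bar>x \<bullet> e\<bar> \<le> \<rho>" if "e \<in> Basis" for e
  proof -
    have "flat 0 (\<rho> + x \<bullet> e) * flat 0 (\<rho> + x \<bullet> (- e)) \<noteq> 0"
      using \<open>bump \<rho> x \<noteq> 0\<close> that unfolding bump_def prod_zero_iff[OF finite_Basis] by blast
    then have "flat 0 (\<rho> + x \<bullet> e) \<noteq> 0" "flat 0 (\<rho> - x \<bullet> e) \<noteq> 0" by auto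
    then have "0 < \<rho> + x \<bullet> e" "0 < \<rho> - x \<bullet> e" by (simp_all add: flat_def split: if_splits)
    then show ?thesis by linarith
  qed
  then have "(\<Sum>e\<in>Basis. \<bar>x \<bullet> e\<bar>) \<le> (\<Sum>e\<in>(Basis::'a set). \<rho>)" by (rule sum_mono)
  then show False using norm_le_l1[of x] assms by simp
qed

section \<open>Weak gradients\<close>

text \<open>Passes from a statement almost everywhere to an actual point, as nonempty open sets are
  not negligible.\<close>

lemma AE_open_meets:
  fixes S :: "'a::euclidean_space set"
  assumes "AE x in lebesgue. P x" "open S" "S \<noteq> {}"
  obtains x where "x \<in> S" "P x"
proof -
  obtain N where N: "N \<in> null_sets lebesgue" "{x. \<not> P x} \<subseteq> N"
    using assms(1) by (auto simp: eventually_ae_filter)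
  have "\<not> S \<subseteq> N"
    using N(1) negligible_subset[of N S] open_not_negligible[OF assms(2,3)]
    by (auto simp: negligible_iff_null_sets)
  then show ?thesis using N(2) that by blast
qed

lemma integral_pos_continuous:
  fixes f :: "'a::euclidean_space \<Rightarrow> real"
  assumes "continuous_on UNIV f" "integrable lebesgue f" "\<And>x. 0 \<le> f x" "0 < f a"
  shows "0 < (LINT x|lebesgue. f x)"
proof (rule ccontr)
  assume "\<not> 0 < (LINT x|lebesgue. f x)"
  moreover have "0 \<le> (LINT x|lebesgue. f x)"
    by (rule Bochner_Integration.integral_nonneg) (rule assms(3))
  ultimately have "(LINT x|lebesgue. f x) = 0" by linarith
  then have "AE x in lebesgue. f x = 0"
    using integral_nonneg_eq_0_iff_AE[OF assms(2)] assms(3) by simp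
  moreover have "open {x. 0 < f x}" using open_Collect_less[OF continuous_on_const assms(1)] .
  ultimately obtain x where "x \<in> {x. 0 < f x}" "f x = 0"
    using AE_open_meets assms(4) by blast
  then show False by simp
qed

definition moll :: "real \<Rightarrow> 'a::euclidean_space \<Rightarrow> real" where
  "moll \<rho> x = bump (\<rho> / DIM('a)) x / (LINT x::'a|lebesgue. bump (\<rho> / DIM('a)) x)"

lemma moll:
  assumes "0 < \<rho>"
  shows "k_times_cont_diff k (moll \<rho> :: 'a::euclidean_space \<Rightarrow> real)"
    "0 \<le> moll \<rho> (x :: 'a)" "\<rho> < norm (x :: 'a) \<Longrightarrow> moll \<rho> x = 0"
    "integrable lebesgue (moll \<rho> :: 'a \<Rightarrow> real)" "(LINT x::'a|lebesgue. moll \<rho> x) = 1"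
    "continuous_on S (moll \<rho> :: 'a \<Rightarrow> real)"
proof -
  let ?b = "bump (\<rho> / DIM('a)) :: 'a \<Rightarrow> real"
  let ?c = "LINT x|lebesgue. ?b x"
  have cont: "continuous_on UNIV ?b" using ktcd_bump[of 0 "\<rho> / DIM('a)"] by simp
  have supp: "?b x = 0" if "\<rho> < norm x" for x using that by (intro bump_support) simp
  have int: "integrable lebesgue ?b" by (rule integrable_continuous_support[OF cont supp])
  have c: "0 < ?c"
    by (rule integral_pos_continuous[OF cont int bump_nonneg bump_pos]) (use assms in simp)
  have m: "moll \<rho> = (\<lambda>x. (1 / ?c) * ?b x)" by (auto simp: moll_def)
  show "k_times_cont_diff k (moll \<rho> :: 'a \<Rightarrow> real)" unfolding m by (intro ktcd_mult ktcd_const ktcd_bump)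
  show "0 \<le> moll \<rho> x" unfolding m using c bump_nonneg[of _ x] by simp
  show "\<rho> < norm x \<Longrightarrow> moll \<rho> x = 0" unfolding m using supp by simp
  show "integrable lebesgue (moll \<rho> :: 'a \<Rightarrow> real)" unfolding m using int by simp
  show "(LINT x::'a|lebesgue. moll \<rho> x) = 1" unfolding m using int c by simp
  show "continuous_on S (moll \<rho> :: 'a \<Rightarrow> real)" unfolding m
    by (intro continuous_intros continuous_on_subset[OF cont]) auto
qed

text \<open>All derivatives fall on \<eta>, so that \<phi> may be merely continuous. The partial
  derivatives of \<eta> satisfy the same hypotheses, which drives the induction.\<close>

lemma conv_smooth:
  fixes \<eta> \<phi> :: "'a::euclidean_space \<Rightarrow> real"
  assumes "\<And>k. k_times_cont_diff k \<eta>" "continuous_on (cbox a c) \<phi>"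
  shows "k_times_cont_diff k (\<lambda>x. integral (cbox a c) (\<lambda>y. \<eta> (x - y) * \<phi> y))"
  using assms(1)
proof (induction k arbitrary: \<eta>)
  case 0
  have "continuous_on UNIV \<eta>" using 0[of 0] by simp
  then have "continuous_on (UNIV \<times> cbox a c) (\<lambda>(x, y). \<eta> (x - y) * \<phi> y)"
    unfolding split_beta
    by (intro continuous_intros continuous_on_compose2[OF \<open>continuous_on UNIV \<eta>\<close>]
        continuous_on_compose2[OF assms(2)]) auto
  from integral_continuous_on_param[OF this] show ?case by simp
next
  case (Suc k)
  note E = ktcd_SucD[OF Suc.prems]
  define d where "d i z = frechet_derivative \<eta> (at z) i" for i z
  have dk: "k_times_cont_diff j (d i)" if "i \<in> Basis" for i j unfolding d_def[abs_def] using E(2)[OF that] .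
  have dcont: "continuous_on UNIV (d i)" if "i \<in> Basis" for i using dk[OF that, of 0] by simp
  \<comment> \<open>Differentiation under the integral asks for a derivative that is jointly
    continuous as a bounded linear map; the expansion in the basis reduces this to the partial
    derivatives.\<close>
  define fx where "fx x t = (\<Sum>i\<in>Basis. (d i (x - t) * \<phi> t) *\<^sub>R blinfun_inner_left i)" for x t
  have expand: "frechet_derivative \<eta> (at z) h = (\<Sum>i\<in>Basis. (h \<bullet> i) * d i z)" for z h
  proof -
    have lin: "linear (frechet_derivative \<eta> (at z))" using has_derivative_linear[OF E(1)] .
    have "frechet_derivative \<eta> (at z) h = frechet_derivative \<eta> (at z) (\<Sum>i\<in>Basis. (h \<bullet> i) *\<^sub>R i)"
      by (simp add: euclidean_representation)
    also have "\<dots> = (\<Sum>i\<in>Basis. (h \<bullet> i) * d i z)"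
      by (simp add: linear_sum[OF lin] linear_cmul[OF lin] d_def)
    finally show ?thesis .
  qed
  have D1: "((\<lambda>x. \<eta> (x - t) * \<phi> t) has_derivative blinfun_apply (fx x t)) (at x within UNIV)" for x t
  proof -
    have "((\<lambda>x. x - t) has_derivative (\<lambda>h. h)) (at x)" by (auto intro!: derivative_eq_intros)
    from has_derivative_mult_left[OF has_derivative_compose[OF this E(1)], of "\<phi> t"]
    have "((\<lambda>x. \<eta> (x - t) * \<phi> t) has_derivative (\<lambda>h. frechet_derivative \<eta> (at (x - t)) h * \<phi> t)) (at x)" .
    moreover have "(\<lambda>h. frechet_derivative \<eta> (at (x - t)) h * \<phi> t) = blinfun_apply (fx x t)"
      unfolding expand fx_def
      by (auto simp: fun_eq_iff blinfun.sum_left blinfun.scaleR_left sum_distrib_left sum_distrib_right mult_ac)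
    ultimately show ?thesis by simp
  qed
  have C: "continuous_on (UNIV \<times> cbox a c) (\<lambda>(x, t). fx x t)"
    unfolding split_beta fx_def
    by (intro continuous_intros continuous_on_compose2[OF dcont] continuous_on_compose2[OF assms(2)]) auto
  have ce: "continuous_on UNIV \<eta>" using Suc.prems[of 0] by simp
  have int: "(\<lambda>t. \<eta> (x - t) * \<phi> t) integrable_on cbox a c" for x
    by (intro integrable_continuous continuous_intros continuous_on_compose2[OF ce] assms(2)) auto
  have D: "((\<lambda>x. integral (cbox a c) (\<lambda>y. \<eta> (x - y) * \<phi> y)) has_derivative
      blinfun_apply (integral (cbox a c) (fx x))) (at x)" for x
    using leibniz_rule[OF D1 int C, of x] by simp
  have fint: "fx x integrable_on cbox a c" for x
    by (rule integrable_continuous[OF continuous_on_compose2[OF C, of _ "\<lambda>t. (x, t)", simplified]])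
      (auto intro!: continuous_intros)
  have eq: "blinfun_apply (integral (cbox a c) (fx x)) b = integral (cbox a c) (\<lambda>y. d b (x - y) * \<phi> y)"
    if "b \<in> Basis" for b x
    unfolding blinfun_apply_integral[OF fint]
    using that by (intro integral_cong)
      (simp add: fx_def blinfun.sum_left blinfun.scaleR_left inner_Basis if_distrib cong: if_cong)
  show ?case
    by (rule ktcd_SucI[OF D]) (simp add: eq Suc.IH dk)
qed

text \<open>The increment is controlled uniformly for base points \<open>z\<close> near
  \<open>x\<close>, not only at \<open>x\<close>, because a mollified function at \<open>x\<close>
  averages increments based at such points.\<close>

definition strict_dd :: "('a::euclidean_space \<Rightarrow> real) \<Rightarrow> 'a \<Rightarrow> real \<Rightarrow> 'a \<Rightarrow> bool" where
  "strict_dd \<phi> b D x \<longleftrightarrow> (\<forall>\<delta>>0. \<exists>\<rho>>0. \<forall>z\<in>ball x \<rho>. \<forall>h. \<bar>h\<bar> < \<rho> \<longrightarrow>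
     \<bar>\<phi> (z + h *\<^sub>R b) - \<phi> z - h * D\<bar> \<le> \<delta> * \<bar>h\<bar>)"

text \<open>Strict differentiability survives mollification, so that no derivative has to be moved
  onto \<open>\<phi>\<close> under the integral.\<close>

lemma weak_gradient_lipschitz:
  fixes u \<phi> D :: "'a::euclidean_space \<Rightarrow> real"
  assumes wg: "weak_gradient u g" and lip: "\<And>x y. \<bar>\<phi> x - \<phi> y\<bar> \<le> L * norm (x - y)"
    and supp: "\<And>x. K < norm x \<Longrightarrow> \<phi> x = 0" and K: "0 \<le> K" and b: "b \<in> Basis"
    and D: "AE x in lebesgue. strict_dd \<phi> b (D x) x"
  shows "integrable lebesgue (\<lambda>x. u x * D x)" "integrable lebesgue (\<lambda>x. (g x \<bullet> b) * \<phi> x)"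
    "(LINT x|lebesgue. u x * D x) = - (LINT x|lebesgue. (g x \<bullet> b) * \<phi> x)"
proof -
  have L: "0 \<le> L" using lip[of b 0] b by (simp add: order_trans[OF abs_ge_zero])
  have cphi: "continuous_on S \<phi>" for S by (rule lip_continuous[OF lip])
  obtain B where B: "\<And>x. \<bar>\<phi> x\<bar> \<le> B" using integrable_continuous_support(2)[OF cphi supp] by blast
  \<comment> \<open>Radii below 1 keep all mollifications supported in one ball.\<close>
  define \<rho> where "\<rho> n = inverse (real (Suc (Suc n)))" for n
  have r: "0 < \<rho> n" "\<rho> n < 1" for n by (auto simp: \<rho>_def inverse_less_1_iff)
  have rlim: "\<rho> \<longlonglongrightarrow> 0" unfolding \<rho>_def using LIMSEQ_Suc[OF LIMSEQ_inverse_real_of_nat] by simp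
  define \<eta> :: "nat \<Rightarrow> 'a \<Rightarrow> real" where "\<eta> n = moll (\<rho> n)" for n
  have eta: "k_times_cont_diff k (\<eta> n)" "0 \<le> \<eta> n x" "\<rho> n < norm x \<Longrightarrow> \<eta> n x = 0"
    "integrable lebesgue (\<eta> n)" "(LINT x|lebesgue. \<eta> n x) = 1" "continuous_on S (\<eta> n)" for k n x S
    unfolding \<eta>_def using moll[OF r(1)] by blast+
  define f where "f n x = (LINT y|lebesgue. \<eta> n y * \<phi> (x - y))" for n x
  have int1: "integrable lebesgue (\<lambda>y. \<eta> n y * \<psi> y)" if "continuous_on UNIV \<psi>" for n and \<psi> :: "'a \<Rightarrow> real"
    by (rule integrable_continuous_support[where K = "\<rho> n"]) (auto intro!: continuous_intros eta(6) that simp: eta(3))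
  have cshift: "continuous_on UNIV (\<lambda>y. \<phi> (z - y))" for z
    by (rule continuous_on_compose2[OF cphi[of UNIV]]) (auto intro!: continuous_intros)
  obtain a where a: "cball (0::'a) K \<subseteq> cbox (- a) a"
    using bounded_subset_cbox_symmetric[of "cball (0::'a) K"] by auto
  \<comment> \<open>A reflection moves \<open>x\<close> into the argument of the mollifier and the
    integration to a fixed box, the form in which smoothness is known. The first form is better
    suited to estimates.\<close>
  have f_eq: "f n x = integral (cbox (- a) a) (\<lambda>y. \<eta> n (x - y) * \<phi> y)" for n x
  proof -
    let ?F = "\<lambda>y. \<eta> n (x - y) * \<phi> y"
    have ce: "continuous_on UNIV (\<lambda>y. \<eta> n (x - y))"
      by (rule continuous_on_compose2[OF eta(6)[of UNIV]]) (auto intro!: continuous_intros)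
    have cF: "continuous_on UNIV ?F" by (intro continuous_intros cphi ce)
    have iF: "integrable lebesgue ?F"
      by (rule integrable_continuous_support[OF cF, of K]) (simp add: supp)
    have "(LINT y|lebesgue. ?F y) = \<bar>-1\<bar> ^ DIM('a) * (LINT y|lebesgue. ?F (x + (-1) *\<^sub>R y))"
      by (rule lebesgue_integral_affine(1)) (use borel_measurable_integrable[OF iF] in auto)
    then have "(LINT y|lebesgue. ?F y) = f n x" by (simp add: f_def)
    then have UN: "(?F has_integral f n x) UNIV" using has_integral_integral_lebesgue[OF iF] by simp
    have out: "?F y = 0" if "y \<notin> cbox (- a) a" for y
    proof -
      have "y \<notin> cball 0 K" using a that by blast
      then show ?thesis by (simp add: supp)
    qed
    have e: "(\<lambda>y. if y \<in> cbox (- a) a then ?F y else 0) = ?F"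
    proof
      fix y show "(if y \<in> cbox (- a) a then ?F y else 0) = ?F y"
        using out[of y] by (cases "y \<in> cbox (- a) a") simp_all
    qed
    have "(?F has_integral f n x) (cbox (- a) a)"
      using has_integral_restrict_UNIV[of "cbox (- a) a" ?F "f n x"] UN unfolding e by blast
    then show ?thesis by (simp add: integral_unique)
  qed
  have fk: "k_times_cont_diff k (f n)" for k n
    unfolding f_eq[abs_def] by (rule conv_smooth[OF eta(1) cphi])
  note fD = ktcd_SucD[OF fk]
  have fsupp: "f n x = 0" if "K + 1 < norm x" for n x
  proof -
    have "\<eta> n y * \<phi> (x - y) = 0" for y
    proof (cases "norm y \<le> 1")
      case True
      then have "K < norm (x - y)" using that norm_triangle_ineq2[of x y] by simp
      then show ?thesis by (simp add: supp)
    next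
      case False then show ?thesis using r(2)[of n] by (simp add: eta(3))
    qed
    then have "f n x = (LINT y::'a|lebesgue. 0)" unfolding f_def by (simp only:)
    then show ?thesis by simp
  qed
  have ftest: "test_function (f n)" for n
  proof -
    have "bounded {x. f n x \<noteq> 0}" unfolding bounded_iff using fsupp by (intro exI[of _ "K + 1"]) (force simp: not_le)
    then show ?thesis unfolding test_function_def using fk by (simp add: compact_closure)
  qed
  define d where "d n x = frechet_derivative (f n) (at x) b" for n x
  have dlim: "((\<lambda>h. (f n (x + h *\<^sub>R b) - f n x) / h) \<longlongrightarrow> d n x) (at 0)" for n x
  proof -
    have "((\<lambda>h. x + h *\<^sub>R b) has_derivative (\<lambda>h. h *\<^sub>R b)) (at 0)" by (auto intro!: derivative_eq_intros)
    from has_derivative_compose[OF this, of "f n"] fD(1)[of n]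
    have "((\<lambda>h. f n (x + h *\<^sub>R b)) has_derivative (\<lambda>h. frechet_derivative (f n) (at x) (h *\<^sub>R b))) (at 0)" by simp
    moreover have "(\<lambda>h. frechet_derivative (f n) (at x) (h *\<^sub>R b)) = (\<lambda>h. d n x * h)"
      using has_derivative_linear[OF fD(1)] by (auto simp: linear_cmul d_def fun_eq_iff)
    ultimately have "((\<lambda>h. f n (x + h *\<^sub>R b)) has_real_derivative d n x) (at 0)"
      by (simp add: has_field_derivative_def)
    then show ?thesis by (simp add: DERIV_def)
  qed
  \<comment> \<open>A bound for the increments of \<phi> near \<open>x\<close> passes to the
    derivative of its mollification. It serves three purposes: c = 0 with the Lipschitz constant
    gives a uniform bound, c = 0 with \<delta> = 0 locates the support, and c = D x gives
    convergence.\<close>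
  have est: "\<bar>d n x - c\<bar> \<le> \<delta>"
    if A: "\<And>z h. z \<in> ball x s \<Longrightarrow> \<bar>h\<bar> < s \<Longrightarrow> \<bar>\<phi> (z + h *\<^sub>R b) - \<phi> z - h * c\<bar> \<le> \<delta> * \<bar>h\<bar>"
      and s: "\<rho> n < s" for n x c \<delta> s
  proof -
    have s0: "0 < s" using r(1)[of n] s by simp
    have "\<bar>(f n (x + h *\<^sub>R b) - f n x) / h - c\<bar> \<le> \<delta>" if h: "h \<noteq> 0" "\<bar>h\<bar> < s" for h
    proof -
      let ?G = "\<lambda>y. \<phi> (x + h *\<^sub>R b - y) - \<phi> (x - y) - h * c"
      have cG: "continuous_on UNIV ?G" by (intro continuous_intros cshift)
      have "f n (x + h *\<^sub>R b) - f n x - h * c = (LINT y|lebesgue. \<eta> n y * ?G y)"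
        unfolding f_def right_diff_distrib
        using int1[OF cshift] eta(4,5)[of n]
        by (subst Bochner_Integration.integral_diff | simp)+
      also have "\<bar>\<dots>\<bar> \<le> (LINT y|lebesgue. \<eta> n y * (\<delta> * \<bar>h\<bar>))"
      proof (rule integral_abs_bound_integral[OF int1[OF cG] integrable_mult_left[OF eta(4)]])
        fix y :: 'a
        show "\<bar>\<eta> n y * ?G y\<bar> \<le> \<eta> n y * (\<delta> * \<bar>h\<bar>)"
        proof (cases "norm y \<le> \<rho> n")
          case True
          then have "\<bar>?G y\<bar> \<le> \<delta> * \<bar>h\<bar>"
            using A[of "x - y" h] s h by (simp add: dist_norm algebra_simps)
          then show ?thesis using eta(2)[of n y] by (simp add: abs_mult mult_left_mono)
        qed (simp add: eta(3))
      qed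
      also have "\<dots> = \<delta> * \<bar>h\<bar>" using eta(5)[of n] by simp
      finally have *: "\<bar>f n (x + h *\<^sub>R b) - f n x - h * c\<bar> \<le> \<delta> * \<bar>h\<bar>" .
      have "(f n (x + h *\<^sub>R b) - f n x) / h - c = (f n (x + h *\<^sub>R b) - f n x - h * c) / h"
        using h by (simp add: diff_divide_distrib)
      then show ?thesis using * h by (simp add: divide_le_eq)
    qed
    then have "\<forall>\<^sub>F h in at 0. \<bar>(f n (x + h *\<^sub>R b) - f n x) / h - c\<bar> \<le> \<delta>"
      unfolding eventually_at using s0 by (intro exI[of _ s]) (auto simp: dist_norm)
    then show ?thesis
      by (rule tendsto_upperbound[OF tendsto_rabs[OF tendsto_diff[OF dlim tendsto_const]]]) simp
  qed
  have dbd: "\<bar>d n x\<bar> \<le> L" for n x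
  proof -
    have "\<bar>\<phi> (z + h *\<^sub>R b) - \<phi> z - h * 0\<bar> \<le> L * \<bar>h\<bar>" for z h
      using lip[of "z + h *\<^sub>R b" z] b by simp
    from est[OF this, of n "\<rho> n + 1" x] show ?thesis by simp
  qed
  have dsupp: "d n x = 0" if "K + 2 < norm x" for n x
  proof -
    have "\<bar>\<phi> (z + h *\<^sub>R b) - \<phi> z - h * 0\<bar> \<le> 0 * \<bar>h\<bar>" if z: "z \<in> ball x 1" "\<bar>h\<bar> < 1" for z h
    proof -
      have "K + 1 < norm z" using z(1) \<open>K + 2 < norm x\<close> norm_triangle_ineq2[of x z] by (simp add: dist_norm)
      moreover have "K < norm (z + h *\<^sub>R b)"
        using \<open>K + 1 < norm z\<close> z(2) b norm_diff_ineq[of z "h *\<^sub>R b"] by simp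
      ultimately show ?thesis by (simp add: supp)
    qed
    from est[OF this r(2)] show ?thesis by simp
  qed
  have dconv: "AE x in lebesgue. (\<lambda>n. d n x) \<longlonglongrightarrow> D x"
    using D
  proof eventually_elim
    case (elim x)
    show ?case
    proof (rule LIMSEQ_I)
      fix e :: real assume e: "0 < e"
      then obtain s where s: "0 < s" "\<And>z h. z \<in> ball x s \<Longrightarrow> \<bar>h\<bar> < s \<Longrightarrow>
          \<bar>\<phi> (z + h *\<^sub>R b) - \<phi> z - h * D x\<bar> \<le> (e/2) * \<bar>h\<bar>"
        using elim unfolding strict_dd_def by (meson half_gt_zero)
      obtain n0 where n0: "\<And>n. n0 \<le> n \<Longrightarrow> \<rho> n < s"
        using order_tendstoD(2)[OF rlim s(1)] by (auto simp: eventually_sequentially)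
      have "norm (d n x - D x) < e" if "n0 \<le> n" for n
      proof -
        have "\<bar>d n x - D x\<bar> \<le> e / 2" by (rule est[OF _ n0[OF that]]) (rule s(2))
        then show ?thesis using e by simp
      qed
      then show "\<exists>n0. \<forall>n\<ge>n0. norm (d n x - D x) < e" by blast
    qed
  qed
  have fest: "\<bar>f n x - \<phi> x\<bar> \<le> L * \<rho> n" for n x
  proof -
    have cG: "continuous_on UNIV (\<lambda>y. \<phi> (x - y) - \<phi> x)" by (intro continuous_intros cshift)
    have "f n x - \<phi> x = (LINT y|lebesgue. \<eta> n y * (\<phi> (x - y) - \<phi> x))"
      unfolding f_def right_diff_distrib
      using int1[OF cshift] eta(4,5)[of n] by (subst Bochner_Integration.integral_diff | simp)+
    also have "\<bar>\<dots>\<bar> \<le> (LINT y|lebesgue. \<eta> n y * (L * \<rho> n))"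
    proof (rule integral_abs_bound_integral[OF int1[OF cG] integrable_mult_left[OF eta(4)]])
      fix y :: 'a
      show "\<bar>\<eta> n y * (\<phi> (x - y) - \<phi> x)\<bar> \<le> \<eta> n y * (L * \<rho> n)"
      proof (cases "norm y \<le> \<rho> n")
        case True
        have "\<bar>\<phi> (x - y) - \<phi> x\<bar> \<le> L * norm y" using lip[of "x - y" x] by simp
        also have "\<dots> \<le> L * \<rho> n" using True L by (intro mult_left_mono)
        finally show ?thesis using eta(2)[of n y] by (simp add: abs_mult mult_left_mono)
      qed (simp add: eta(3))
    qed
    also have "\<dots> = L * \<rho> n" using eta(5)[of n] by simp
    finally show ?thesis .
  qed
  have fconv: "(\<lambda>n. f n x) \<longlonglongrightarrow> \<phi> x" for x
  proof (rule Lim_transform2[OF tendsto_const])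
    have "(\<lambda>n. L * \<rho> n) \<longlonglongrightarrow> 0" using tendsto_mult_right_zero[OF rlim] .
    then have "(\<lambda>n. f n x - \<phi> x) \<longlonglongrightarrow> 0"
      by (rule Lim_null_comparison[rotated]) (auto simp: fest)
    from tendsto_minus[OF this] show "(\<lambda>n. \<phi> x - f n x) \<longlonglongrightarrow> 0" by simp
  qed
  have "locally_integrable u" "locally_integrable g" using wg by (auto simp: weak_gradient_def)
  then have iu: "integrable lebesgue (\<lambda>x. indicator (cball 0 (K + 2)) x *\<^sub>R u x)"
    and ig: "integrable lebesgue (\<lambda>x. indicator (cball 0 (K + 2)) x *\<^sub>R g x)"
    by (auto simp: locally_integrable_def set_integrable_def)
  \<comment> \<open>\<open>u\<close> and \<open>g\<close> are integrable only locally;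
    \<open>I\<close> restricts them to a ball containing all supports involved.\<close>
  define I where "I = (indicator (cball 0 (K + 2)) :: 'a \<Rightarrow> real)"
  have I: "I x = 1" if "norm x \<le> K + 2" for x using that by (simp add: I_def)
  have igb: "integrable lebesgue (\<lambda>x. I x * (g x \<bullet> b))"
    using integrable_inner_left[OF ig, of b] by (simp add: I_def)
  have iu': "integrable lebesgue (\<lambda>x. I x * u x)" using iu by (simp add: I_def)
  have ud: "u x * d n x = (I x * u x) * d n x" for n x
    using dsupp[of x n] I[of x] by (cases "norm x \<le> K + 2") auto
  have gf: "(g x \<bullet> b) * f n x = (I x * (g x \<bullet> b)) * f n x" for n x
    using fsupp[of x n] I[of x] by (cases "norm x \<le> K + 2") auto
  have gphi: "(g x \<bullet> b) * \<phi> x = (I x * (g x \<bullet> b)) * \<phi> x" for x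
    using supp[of x] I[of x] K by (cases "norm x \<le> K + 2") auto
  have dc: "continuous_on UNIV (d n)" for n
    using fD(2)[OF b, of 0 n] unfolding d_def[abs_def] by simp
  have fc: "continuous_on UNIV (f n)" for n using fk[of 0 n] by simp
  have aeu: "AE x in lebesgue. (\<lambda>n. u x * d n x) \<longlonglongrightarrow> I x * u x * D x"
    using dconv
  proof eventually_elim
    case (elim x)
    show ?case unfolding ud by (intro tendsto_intros elim)
  qed
  have aeD: "AE x in lebesgue. I x * u x * D x = u x * D x"
    using dconv
  proof eventually_elim
    case (elim x)
    show ?case
    proof (cases "norm x \<le> K + 2")
      case False
      then have "D x = 0" using elim dsupp[of x] by (simp add: LIMSEQ_const_iff)
      then show ?thesis by simp
    qed (simp add: I)
  qed
  note mu = borel_measurable_integrable[OF iu'] and mg = borel_measurable_integrable[OF igb]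
  have cm: "h \<in> borel_measurable lebesgue" if "continuous_on UNIV h" for h :: "'a \<Rightarrow> real"
    using borel_measurable_continuous_onI[OF that] by (simp add: measurable_completion)
  have m1: "(\<lambda>x. u x * d n x) \<in> borel_measurable lebesgue" for n
    unfolding ud by (rule borel_measurable_times[OF mu cm[OF dc]])
  have m2: "(\<lambda>x. (g x \<bullet> b) * f n x) \<in> borel_measurable lebesgue" for n
    unfolding gf by (rule borel_measurable_times[OF mg cm[OF fc]])
  have m3: "(\<lambda>x. (g x \<bullet> b) * \<phi> x) \<in> borel_measurable lebesgue"
    unfolding gphi by (rule borel_measurable_times[OF mg cm[OF cphi]])
  have Dm: "D \<in> borel_measurable lebesgue"
  proof (rule borel_measurable_AE)
    show "(\<lambda>x. lim (\<lambda>n. d n x)) \<in> borel_measurable lebesgue"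
      by (intro borel_measurable_lim_metric cm dc)
    show "AE x in lebesgue. lim (\<lambda>n. d n x) = D x" using dconv by eventually_elim (rule limI)
  qed
  have m4: "(\<lambda>x. I x * u x * D x) \<in> borel_measurable lebesgue"
    by (rule borel_measurable_times[OF mu Dm])
  have bound1: "norm (u x * d n x) \<le> norm (I x * u x) * L" for n x
    unfolding ud using dbd[of n x] by (auto simp: abs_mult intro!: mult_left_mono)
  have bound2: "norm ((g x \<bullet> b) * f n x) \<le> norm (I x * (g x \<bullet> b)) * (B + L)" for n x
  proof -
    have "L * \<rho> n \<le> L * 1" using r(2)[of n] L by (intro mult_left_mono) auto
    then have "\<bar>f n x\<bar> \<le> B + L" using fest[of n x] B[of x] by linarith
    then show ?thesis unfolding gf by (auto simp: abs_mult intro!: mult_left_mono)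
  qed
  have iU: "integrable lebesgue (\<lambda>x. norm (I x * u x) * L)" using iu' by simp
  have iG: "integrable lebesgue (\<lambda>x. norm (I x * (g x \<bullet> b)) * (B + L))" using igb by simp
  have lim1: "(\<lambda>n. LINT x|lebesgue. u x * d n x) \<longlonglongrightarrow> (LINT x|lebesgue. I x * u x * D x)"
    by (rule integral_dominated_convergence[OF m4 m1 iU aeu]) (intro AE_I2 bound1)
  have i1: "integrable lebesgue (\<lambda>x. I x * u x * D x)"
    by (rule integrable_dominated_convergence[OF m4 m1 iU aeu]) (intro AE_I2 bound1)
  have aeg: "AE x in lebesgue. (\<lambda>n. (g x \<bullet> b) * f n x) \<longlonglongrightarrow> (g x \<bullet> b) * \<phi> x"
    by (intro AE_I2 tendsto_intros fconv)
  have lim2: "(\<lambda>n. LINT x|lebesgue. (g x \<bullet> b) * f n x) \<longlonglongrightarrow> (LINT x|lebesgue. (g x \<bullet> b) * \<phi> x)"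
    by (rule integral_dominated_convergence[OF m3 m2 iG aeg]) (intro AE_I2 bound2)
  show i2: "integrable lebesgue (\<lambda>x. (g x \<bullet> b) * \<phi> x)"
    by (rule integrable_dominated_convergence[OF m3 m2 iG aeg]) (intro AE_I2 bound2)
  have "(LINT x|lebesgue. u x * d n x) = - (LINT x|lebesgue. (g x \<bullet> b) * f n x)" for n
    using wg ftest[of n] b unfolding weak_gradient_def d_def by blast
  with lim1 have "(\<lambda>n. - (LINT x|lebesgue. (g x \<bullet> b) * f n x)) \<longlonglongrightarrow> (LINT x|lebesgue. I x * u x * D x)" by simp
  from LIMSEQ_unique[OF this tendsto_minus[OF lim2]]
  have eq: "(LINT x|lebesgue. I x * u x * D x) = - (LINT x|lebesgue. (g x \<bullet> b) * \<phi> x)" .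
  have m5: "(\<lambda>x. u x * D x) \<in> borel_measurable lebesgue"
    by (rule borel_measurable_AE[OF m4 aeD])
  show "integrable lebesgue (\<lambda>x. u x * D x)"
    using integrable_cong_AE[OF m4 m5 aeD] i1 by simp
  show "(LINT x|lebesgue. u x * D x) = - (LINT x|lebesgue. (g x \<bullet> b) * \<phi> x)"
    using integral_cong_AE[OF m4 m5 aeD] eq by simp
qed

section \<open>Translations and dilations of weak gradients\<close>

lemma integrable_affine:
  fixes f :: "'a::euclidean_space \<Rightarrow> 'b::euclidean_space"
  assumes "c \<noteq> 0" "integrable lebesgue f"
  shows "integrable lebesgue (\<lambda>x. f (t + c *\<^sub>R x))"
proof -
  have fm: "f \<in> borel_measurable lebesgue" using assms(2) by (rule borel_measurable_integrable)
  have "integrable lebesgue (\<lambda>x. norm (f (t + c *\<^sub>R x)))"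
    using lebesgue_integral_affine(2)[OF assms(1), of "\<lambda>x. norm (f x)" t] fm assms(2) by simp
  then show ?thesis
    using measurable_lebesgue_affine[OF assms(1) fm] by (simp add: integrable_norm_iff)
qed

lemma locally_integrable_measurable:
  fixes f :: "'a::euclidean_space \<Rightarrow> 'b::euclidean_space"
  assumes "locally_integrable f"
  shows "f \<in> borel_measurable lebesgue"
proof (rule borel_measurable_LIMSEQ_metric)
  show "(\<lambda>x. indicat_real (cball 0 (real n)) x *\<^sub>R f x) \<in> borel_measurable lebesgue" for n
    using assms unfolding locally_integrable_def set_integrable_def
    by (intro borel_measurable_integrable) auto
  fix x :: 'a
  have "indicat_real (cball 0 (real n)) x *\<^sub>R f x = f x" if "nat \<lceil>norm x\<rceil> \<le> n" for n
    using that by (simp add: indicator_def nat_le_iff ceiling_le_iff)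
  then show "(\<lambda>n. indicat_real (cball 0 (real n)) x *\<^sub>R f x) \<longlonglongrightarrow> f x"
    by (intro tendsto_eventually) (use eventually_sequentially in blast)
qed

lemma locally_integrable_affine:
  fixes f :: "'a::euclidean_space \<Rightarrow> 'b::euclidean_space"
  assumes "c \<noteq> 0" "locally_integrable f"
  shows "locally_integrable (\<lambda>x. s *\<^sub>R f (t + c *\<^sub>R x))"
  unfolding locally_integrable_def
proof (intro allI impI)
  fix K :: "'a set" assume "compact K"
  then have "compact ((\<lambda>x. t + c *\<^sub>R x) ` K)" by (intro compact_continuous_image continuous_intros)
  then have "integrable lebesgue (\<lambda>y. indicat_real ((\<lambda>x. t + c *\<^sub>R x) ` K) y *\<^sub>R f y)"
    using assms(2) by (auto simp: locally_integrable_def set_integrable_def)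
  from integrable_affine[OF assms(1) this, of t]
  have "integrable lebesgue (\<lambda>x. indicat_real ((\<lambda>x. t + c *\<^sub>R x) ` K) (t + c *\<^sub>R x) *\<^sub>R f (t + c *\<^sub>R x))" .
  moreover have "indicat_real ((\<lambda>x. t + c *\<^sub>R x) ` K) (t + c *\<^sub>R x) = indicat_real K x" for x
    using assms(1) by (auto simp: indicator_def)
  ultimately have "set_integrable lebesgue K (\<lambda>x. f (t + c *\<^sub>R x))" by (simp add: set_integrable_def)
  then show "set_integrable lebesgue K (\<lambda>x. s *\<^sub>R f (t + c *\<^sub>R x))" by (rule set_integrable_scaleR_right)
qed

lemma test_function_continuous:
  assumes "test_function \<phi>"
  shows "continuous_on UNIV \<phi>" "b \<in> Basis \<Longrightarrow> continuous_on UNIV (\<lambda>x. frechet_derivative \<phi> (at x) b)"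
proof -
  have k: "\<And>k. k_times_cont_diff k \<phi>" using assms by (auto simp: test_function_def)
  show "continuous_on UNIV \<phi>" using k[of 0] by simp
  show "b \<in> Basis \<Longrightarrow> continuous_on UNIV (\<lambda>x. frechet_derivative \<phi> (at x) b)"
    using ktcd_SucD(2)[OF k[of "Suc 0"], of b] by simp
qed

lemma continuous_lebesgue_measurable:
  fixes h :: "'a::euclidean_space \<Rightarrow> real"
  assumes "continuous_on UNIV h" shows "h \<in> borel_measurable lebesgue"
  using borel_measurable_continuous_onI[OF assms] by (simp add: measurable_completion)

text \<open>The inverse substitution is carried out in the test function, whose derivative supplies
  the factor 1 / c; the Jacobians on the two sides cancel.\<close>

lemma weak_gradient_affine:
  fixes u :: "'a::euclidean_space \<Rightarrow> real"
  assumes wg: "weak_gradient u g" and c: "c \<noteq> 0"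
  shows "weak_gradient (\<lambda>x. s * u (t + c *\<^sub>R x)) (\<lambda>x. (s * c) *\<^sub>R g (t + c *\<^sub>R x))"
  unfolding weak_gradient_def
proof (intro conjI allI impI ballI)
  have li: "locally_integrable u" "locally_integrable g" using wg by (auto simp: weak_gradient_def)
  show "locally_integrable (\<lambda>x. s * u (t + c *\<^sub>R x))"
    using locally_integrable_affine[OF c li(1), of s t] by simp
  show "locally_integrable (\<lambda>x. (s * c) *\<^sub>R g (t + c *\<^sub>R x))"
    by (rule locally_integrable_affine[OF c li(2)])
  fix \<psi> :: "'a \<Rightarrow> real" and b :: 'a assume psi: "test_function \<psi>" and b: "b \<in> Basis"
  define t' where "t' = - (1 / c) *\<^sub>R t"
  define \<phi> where "\<phi> y = \<psi> (t' + (1 / c) *\<^sub>R y)" for y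
  have c': "1 / c \<noteq> 0" using c by simp
  have phi: "test_function \<phi>" unfolding \<phi>_def[abs_def] by (rule test_function_affine(1)[OF psi c'])
  have dphi: "frechet_derivative \<phi> (at y) b = (1 / c) * frechet_derivative \<psi> (at (t' + (1 / c) *\<^sub>R y)) b" for y
    unfolding \<phi>_def[abs_def] by (rule test_function_affine(2)[OF psi c'])
  have inv: "t' + (1 / c) *\<^sub>R (t + c *\<^sub>R x) = x" for x
    using c by (simp add: t'_def scaleR_right_distrib)
  have mu: "u \<in> borel_measurable lebesgue" "(\<lambda>x. g x \<bullet> b) \<in> borel_measurable lebesgue"
    using locally_integrable_measurable[OF li(1)] locally_integrable_measurable[OF li(2)] by auto
  note cphi = test_function_continuous[OF phi]
  have m1: "(\<lambda>y. u y * frechet_derivative \<phi> (at y) b) \<in> borel_measurable lebesgue"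
    by (intro borel_measurable_times mu continuous_lebesgue_measurable cphi(2) b)
  have m2: "(\<lambda>y. (g y \<bullet> b) * \<phi> y) \<in> borel_measurable lebesgue"
    by (intro borel_measurable_times mu continuous_lebesgue_measurable cphi(1))
  have cancel: "x = - y" if "k \<noteq> 0" "k * x = - (k * y)" for k x y :: real
    using that by (metis mult_left_cancel mult_minus_right)
  have "(LINT y|lebesgue. u y * frechet_derivative \<phi> (at y) b) = - (LINT y|lebesgue. (g y \<bullet> b) * \<phi> y)"
    using wg phi b unfolding weak_gradient_def by blast
  then have "\<bar>c\<bar> ^ DIM('a) * (LINT x|lebesgue. u (t + c *\<^sub>R x) * ((1 / c) * frechet_derivative \<psi> (at x) b))
     = - (\<bar>c\<bar> ^ DIM('a) * (LINT x|lebesgue. (g (t + c *\<^sub>R x) \<bullet> b) * \<psi> x))"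
    unfolding lebesgue_integral_affine(1)[OF c m1, of t] lebesgue_integral_affine(1)[OF c m2, of t]
    unfolding dphi inv unfolding \<phi>_def inv .
  then have E: "(LINT x|lebesgue. u (t + c *\<^sub>R x) * ((1 / c) * frechet_derivative \<psi> (at x) b))
     = - (LINT x|lebesgue. (g (t + c *\<^sub>R x) \<bullet> b) * \<psi> x)"
    by (rule cancel[rotated]) (use c in simp)
  have alg: "s * x * y = (s * c) * (x * ((1 / c) * y))" for x y :: real using c by simp
  have "(LINT x|lebesgue. s * u (t + c *\<^sub>R x) * frechet_derivative \<psi> (at x) b)
     = (LINT x|lebesgue. (s * c) * (u (t + c *\<^sub>R x) * ((1 / c) * frechet_derivative \<psi> (at x) b)))"
    by (rule Bochner_Integration.integral_cong[OF refl alg])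
  also have "\<dots> = (s * c) * - (LINT x|lebesgue. (g (t + c *\<^sub>R x) \<bullet> b) * \<psi> x)"
    unfolding integral_mult_right_zero E ..
  also have "\<dots> = - (LINT x|lebesgue. ((s * c) *\<^sub>R g (t + c *\<^sub>R x) \<bullet> b) * \<psi> x)"
    by (simp add: mult.assoc)
  finally show "(LINT x|lebesgue. s * u (t + c *\<^sub>R x) * frechet_derivative \<psi> (at x) b)
     = - (LINT x|lebesgue. ((s * c) *\<^sub>R g (t + c *\<^sub>R x) \<bullet> b) * \<psi> x)" .
qed

text \<open>The positive and negative part of \<open>f\<close> are compared as measures, first on open sets by the
  Vitali covering theorem and then on \<open>{f > 0}\<close> by outer regularity.\<close>

lemma AE_nonpos_if_ball_integrals_nonpos:
  fixes f :: "'a::euclidean_space \<Rightarrow> real"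
  assumes li: "locally_integrable f" and r0: "0 < r0"
    and ball: "\<And>x r. 0 < r \<Longrightarrow> r < r0 \<Longrightarrow> (LINT y|lebesgue. indicator (ball x r) y * f y) \<le> 0"
  shows "AE x in lebesgue. f x \<le> 0"
proof -
  have fm[measurable]: "f \<in> borel_measurable lebesgue" by (rule locally_integrable_measurable[OF li])
  define P where "P = density lebesgue (\<lambda>x. ennreal (f x))"
  define N where "N = density lebesgue (\<lambda>x. ennreal (- f x))"
  have sets: "sets P = sets lebesgue" "sets N = sets lebesgue" by (auto simp: P_def N_def)
  have emP: "emeasure P A = (\<integral>\<^sup>+x. ennreal (indicator A x * f x) \<partial>lebesgue)" if "A \<in> sets lebesgue" for A
    using that unfolding P_def
    by (subst emeasure_density) (auto intro!: nn_integral_cong simp: indicator_def)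
  have emN: "emeasure N A = (\<integral>\<^sup>+x. ennreal (- (indicator A x * f x)) \<partial>lebesgue)" if "A \<in> sets lebesgue" for A
    using that unfolding N_def
    by (subst emeasure_density) (auto intro!: nn_integral_cong simp: indicator_def)
  have intb: "integrable lebesgue (\<lambda>y. indicator A y * f y)" if "A \<in> sets lebesgue" "A \<subseteq> cball 0 K" for A K
  proof -
    have "set_integrable lebesgue (cball 0 K) f" using li by (simp add: locally_integrable_def)
    from set_integrable_subset[OF this that] show ?thesis by (simp add: set_integrable_def)
  qed
  have openb: "ball x r \<in> sets lebesgue" for x :: 'a and r by simp
  have ball_le: "emeasure P (ball x r) \<le> emeasure N (ball x r)" if r: "0 < r" "r < r0" for x r
  proof -
    have "ball x r \<subseteq> cball 0 (norm x + r)"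
    proof
      fix y assume "y \<in> ball x r"
      then show "y \<in> cball 0 (norm x + r)"
        using norm_triangle_ineq2[of y x] by (simp add: dist_norm norm_minus_commute)
    qed
    from intb[OF openb this] have i: "integrable lebesgue (\<lambda>y. indicator (ball x r) y * f y)" .
    let ?F = "\<lambda>y. indicator (ball x r) y * f y"
    have fin: "emeasure P (ball x r) < \<infinity>" "emeasure N (ball x r) < \<infinity>"
      unfolding emP[OF openb] emN[OF openb]
      using i integrable_minus[OF i] by (auto simp: real_integrable_def less_top)
    have "(LINT y|lebesgue. ?F y) = enn2real (emeasure P (ball x r)) - enn2real (emeasure N (ball x r))"
      unfolding emP[OF openb] emN[OF openb] by (rule real_lebesgue_integral_def[OF i])
    then have "enn2real (emeasure P (ball x r)) \<le> enn2real (emeasure N (ball x r))" using ball[OF r, of x] by simp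
    then show ?thesis using fin by (metis ennreal_enn2real ennreal_leI infinity_ennreal_def)
  qed
  have open_le: "emeasure P U \<le> emeasure N U" if U: "open U" for U
  proof -
    define I where "I = {(c::'a, r). 0 < r \<and> r < r0 \<and> ball c r \<subseteq> U}"
    have cov: "\<exists>i. i \<in> I \<and> x \<in> ball (fst i) (snd i) \<and> snd i < d" if xd: "x \<in> U" "0 < d" for x d
    proof -
      obtain e where e: "0 < e" "ball x e \<subseteq> U" using U xd by (meson openE)
      define r where "r = min e (min d r0) / 2"
      have r: "0 < r" "r < e" "r < d" "r < r0" using e xd r0 by (auto simp: r_def)
      then have "ball x r \<subseteq> U" using e(2) subset_ball[of r e x] by auto
      then show ?thesis using r by (intro exI[of _ "(x, r)"]) (auto simp: I_def)
    qed
    obtain C where C: "countable C" "C \<subseteq> I"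
      "pairwise (\<lambda>i j. disjnt (ball (fst i) (snd i)) (ball (fst j) (snd j))) C"
      "negligible (U - (\<Union>i\<in>C. ball (fst i) (snd i)))"
      by (rule Vitali_covering_theorem_balls[OF cov])
    let ?B = "\<lambda>i. ball (fst i) (snd i) :: 'a set"
    let ?V = "\<Union>i\<in>C. ?B i"
    have Ci: "0 < snd i \<and> snd i < r0 \<and> ?B i \<subseteq> U" if "i \<in> C" for i
      using C(2) that by (cases i) (auto simp: I_def)
    have V: "?V \<subseteq> U" using Ci by blast
    have disj: "disjoint_family_on ?B C"
      using C(3) by (auto simp: disjoint_family_on_def pairwise_def disjnt_def)
    have null: "U - ?V \<in> null_sets lebesgue" using C(4) by (simp add: negligible_iff_null_sets)
    have ms: "?V \<in> sets lebesgue" "U - ?V \<in> sets lebesgue" "U \<in> sets lebesgue"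
    proof -
      have "open ?V" by (intro open_UN ballI open_ball)
      then show "?V \<in> sets lebesgue" "U \<in> sets lebesgue" using U by (auto intro: lborelD)
      show "U - ?V \<in> sets lebesgue" using null by auto
    qed
    \<comment> \<open>Both measures have densities, so the null set left over by the disjoint balls
      is invisible to them.\<close>
    have eq: "emeasure M U = emeasure M ?V" if M: "M = density lebesgue h" "h \<in> borel_measurable lebesgue" for M h
    proof -
      have "U - ?V \<in> null_sets M" using null M by (auto simp: null_sets_density_iff intro: AE_not_in[THEN eventually_mono])
      then have "emeasure M (?V \<union> (U - ?V)) = emeasure M ?V"
        using ms M by (intro emeasure_Un_null_set) auto
      then show ?thesis using V by (simp add: Un_absorb1)
    qed
    have cnt: "emeasure M ?V = (\<integral>\<^sup>+i. emeasure M (?B i) \<partial>count_space C)" if "sets M = sets lebesgue" for M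
      using that by (intro emeasure_UN_countable C(1) disj) auto
    have "emeasure P U = (\<integral>\<^sup>+i. emeasure P (?B i) \<partial>count_space C)"
      unfolding eq[OF P_def, simplified] by (rule cnt[OF sets(1)])
    also have "\<dots> \<le> (\<integral>\<^sup>+i. emeasure N (?B i) \<partial>count_space C)"
      using Ci by (intro nn_integral_mono ball_le) auto
    also have "\<dots> = emeasure N U"
      unfolding eq[OF N_def, simplified] by (rule cnt[OF sets(2), symmetric])
    finally show ?thesis .
  qed
  have main: "{x \<in> ball 0 K. 0 < f x} \<in> null_sets lebesgue" for K :: real
  proof -
    define E where "E = {x \<in> ball 0 K. 0 < f x}"
    have "{x \<in> space lebesgue. 0 < f x} \<in> sets lebesgue" by measurable
    moreover have "E = ball 0 K \<inter> {x \<in> space lebesgue. 0 < f x}" by (auto simp: E_def)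
    ultimately have Em: "E \<in> sets lebesgue" using openb by auto
    have "\<exists>T. open T \<and> E \<subseteq> T \<and> T - E \<in> lmeasurable \<and> emeasure lebesgue (T - E) < ennreal (inverse (real (Suc n)))" for n
      using sets_lebesgue_outer_open[OF Em, of "inverse (real (Suc n))"] by (metis inverse_positive_iff_positive of_nat_0_less_iff zero_less_Suc)
    then obtain T where T: "\<And>n. open (T n)" "\<And>n. E \<subseteq> T n"
      "\<And>n. emeasure lebesgue (T n - E) < ennreal (inverse (real (Suc n)))" by metis
    \<comment> \<open>Open sets decreasing to \<open>E\<close> up to a null set. Inside a fixed ball
      their \<open>N\<close>-measure is finite, so it tends to that of \<open>E\<close>, which is 0
      because the negative part of \<open>f\<close> vanishes on \<open>E\<close>.\<close>
    define U where "U n = ball 0 K \<inter> (\<Inter>i\<le>n. T i)" for n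
    have Uo: "open (U n)" for n unfolding U_def using T(1) by (intro open_Int open_INT) auto
    have EU: "E \<subseteq> U n" for n using T(2) by (auto simp: U_def E_def)
    have dec: "decseq U" unfolding U_def by (auto simp: decseq_def)
    have Us: "U n \<in> sets lebesgue" for n using Uo by (auto intro: lborelD)
    have Uint: "(\<Inter>n. U n) \<in> sets lebesgue" using Us by auto
    have null: "(\<Inter>n. U n) - E \<in> null_sets lebesgue"
    proof -
      have "emeasure lebesgue ((\<Inter>n. U n) - E) \<le> ennreal (inverse (real (Suc n)))" for n
      proof -
        have "emeasure lebesgue ((\<Inter>n. U n) - E) \<le> emeasure lebesgue (T n - E)"
          using T(1)[of n] Em by (intro emeasure_mono sets.Diff) (auto simp: U_def intro: lborelD)
        then show ?thesis using T(3)[of n] by simp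
      qed
      moreover have "(\<lambda>n. ennreal (inverse (real (Suc n)))) \<longlonglongrightarrow> ennreal 0"
        by (intro tendsto_ennrealI LIMSEQ_inverse_real_of_nat)
      ultimately have "emeasure lebesgue ((\<Inter>n. U n) - E) \<le> ennreal 0"
        by (intro LIMSEQ_le_const) auto
      then show ?thesis using Uint Em by (auto intro!: null_setsI)
    qed
    have "emeasure N E = 0"
      unfolding emN[OF Em] by (simp add: E_def indicator_def ennreal_neg nn_integral_0_iff_AE if_distrib)
    moreover have "(\<Inter>n. U n) - E \<in> null_sets N"
      unfolding N_def using null by (auto simp: null_sets_density_iff intro: AE_not_in[THEN eventually_mono])
    moreover have "E \<union> ((\<Inter>n. U n) - E) = (\<Inter>n. U n)" using EU by auto
    ultimately have N0: "emeasure N (\<Inter>n. U n) = 0"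
      using emeasure_Un_null_set[of E N "(\<Inter>n. U n) - E"] Em sets by simp
    have "emeasure N (U n) \<noteq> \<infinity>" for n
    proof -
      have "U n \<subseteq> cball 0 K" by (auto simp: U_def)
      from integrable_minus[OF intb[OF Us this]] show ?thesis
        unfolding emN[OF Us] by (auto simp: real_integrable_def)
    qed
    then have "(\<lambda>n. emeasure N (U n)) \<longlonglongrightarrow> emeasure N (\<Inter>n. U n)"
      using Us sets by (intro Lim_emeasure_decseq dec) auto
    then have lim: "(\<lambda>n. emeasure N (U n)) \<longlonglongrightarrow> 0" unfolding N0 .
    have "emeasure P E \<le> emeasure N (U n)" for n
      using emeasure_mono[OF EU[of n], of P] open_le[OF Uo[of n]] Us sets by (auto intro: order_trans)
    then have "emeasure P E \<le> 0" by (intro LIMSEQ_le_const[OF lim]) auto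
    then have "(\<integral>\<^sup>+x. ennreal (indicator E x * f x) \<partial>lebesgue) = 0" unfolding emP[OF Em] by simp
    then have "AE x in lebesgue. ennreal (indicator E x * f x) = 0"
      using Em by (subst (asm) nn_integral_0_iff_AE) auto
    then have "AE x in lebesgue. x \<notin> E"
      by eventually_elim (auto simp: E_def indicator_def split: if_splits)
    then show ?thesis using Em AE_iff_null_sets[of E lebesgue] by (simp add: E_def)
  qed
  have "(\<Union>n. {x \<in> ball 0 (real n). 0 < f x}) \<in> null_sets lebesgue" by (intro null_sets_UN main)
  then have "AE x in lebesgue. x \<notin> (\<Union>n. {x \<in> ball 0 (real n). 0 < f x})" by (rule AE_not_in)
  then show ?thesis
  proof eventually_elim
    case (elim x)
    obtain n where "norm x < real n" using reals_Archimedean2 by blast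
    moreover have "x \<notin> {x \<in> ball 0 (real n). 0 < f x}" using elim by blast
    ultimately show ?case by (simp add: not_less)
  qed
qed

section \<open>Radial vector fields\<close>

lemma DERIV_norm_line:
  fixes z b :: "'a::euclidean_space"
  assumes "z \<noteq> 0"
  shows "((\<lambda>h. norm (z + h *\<^sub>R b)) has_real_derivative (z \<bullet> b) / norm z) (at 0)"
proof -
  have "((\<lambda>h. z + h *\<^sub>R b) has_derivative (\<lambda>h. h *\<^sub>R b)) (at 0)" by (auto intro!: derivative_eq_intros)
  from has_derivative_compose[OF this, of norm "\<lambda>y. y \<bullet> sgn z"] has_derivative_norm[OF assms]
  have "((\<lambda>h. norm (z + h *\<^sub>R b)) has_derivative (\<lambda>h. (h *\<^sub>R b) \<bullet> sgn z)) (at 0)" by simp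
  moreover have "(\<lambda>h. (h *\<^sub>R b) \<bullet> sgn z) = (\<lambda>h. (z \<bullet> b) / norm z * h)"
    by (auto simp: sgn_div_norm inner_commute divide_inverse fun_eq_iff)
  ultimately show ?thesis unfolding has_field_derivative_def by (simp only:)
qed

text \<open>The partial derivative in direction \<open>b\<close> of the \<open>b\<close>-component
  of the field f(|x|) x; the sum over the basis is the divergence of the field.\<close>

definition radial_D :: "(real \<Rightarrow> real) \<Rightarrow> (real \<Rightarrow> real) \<Rightarrow> 'a::euclidean_space \<Rightarrow> 'a \<Rightarrow> real" where
  "radial_D f f' b x = f' (norm x) * ((x \<bullet> b)\<^sup>2 / norm x) + f (norm x)"

lemma radial_component_deriv:
  fixes z b :: "'a::euclidean_space"
  assumes "z \<noteq> 0" "(f has_real_derivative f' (norm z)) (at (norm z))" "b \<in> Basis"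
  shows "((\<lambda>h. f (norm (z + h *\<^sub>R b)) * ((z + h *\<^sub>R b) \<bullet> b)) has_real_derivative radial_D f f' b z) (at 0)"
proof -
  have 1: "((\<lambda>h. f (norm (z + h *\<^sub>R b))) has_real_derivative f' (norm z) * ((z \<bullet> b) / norm z)) (at 0)"
    by (rule DERIV_chain2[OF _ DERIV_norm_line[OF assms(1)]]) (use assms(2) in simp)
  have 2: "((\<lambda>h. (z + h *\<^sub>R b) \<bullet> b) has_real_derivative 1) (at 0)"
  proof -
    have "(\<lambda>h. (z + h *\<^sub>R b) \<bullet> b) = (\<lambda>h. z \<bullet> b + h)"
      using assms(3) by (simp add: inner_left_distrib inner_Basis)
    then show ?thesis by (auto intro!: derivative_eq_intros)
  qed
  show ?thesis
    by (rule DERIV_cong[OF DERIV_mult[OF 1 2]]) (simp add: radial_D_def power2_eq_square)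
qed

lemma radial_D_sum:
  fixes x :: "'a::euclidean_space" and f f' :: "real \<Rightarrow> real"
  shows "(\<Sum>b\<in>Basis. radial_D f f' b x) = f' (norm x) * norm x + DIM('a) * f (norm x)"
proof -
  have "(\<Sum>b\<in>Basis. (x \<bullet> b)\<^sup>2) = (norm x)\<^sup>2"
    unfolding power2_norm_eq_inner by (subst euclidean_inner) (simp add: power2_eq_square)
  then have "(\<Sum>b\<in>Basis. (x \<bullet> b)\<^sup>2 / norm x) = norm x"
    unfolding sum_divide_distrib[symmetric] by (simp add: power2_eq_square)
  then show ?thesis unfolding radial_D_def sum.distrib sum_distrib_left[symmetric] by simp
qed

text \<open>At every base point near \<open>x\<close> the mean value theorem along direction
  \<open>b\<close> expresses the increment by a value of \<open>D\<close> at a point that is still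
  near \<open>x\<close>.\<close>

lemma strict_ddI:
  fixes x b :: "'a::euclidean_space"
  assumes S: "open S" "x \<in> S" and b: "b \<in> Basis"
    and D: "\<And>z. z \<in> S \<Longrightarrow> ((\<lambda>h. \<phi> (z + h *\<^sub>R b)) has_real_derivative D z) (at 0)"
    and cont: "isCont D x"
  shows "strict_dd \<phi> b (D x) x"
  unfolding strict_dd_def
proof (intro allI impI)
  fix \<delta> :: real assume d: "0 < \<delta>"
  obtain s1 where s1: "0 < s1" "ball x s1 \<subseteq> S" using S by (meson openE)
  obtain s2 where s2: "0 < s2" "\<And>z. dist z x < s2 \<Longrightarrow> dist (D z) (D x) < \<delta>"
    using cont d unfolding continuous_at_eps_delta by blast
  define s where "s = min s1 s2"
  have s: "0 < s" "s \<le> s1" "s \<le> s2" using s1 s2 by (auto simp: s_def)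
  have nb: "norm b = 1" using b by simp
  have est: "\<bar>\<phi> (z + h *\<^sub>R b) - \<phi> z - h * D x\<bar> \<le> \<delta> * \<bar>h\<bar>" if z: "z \<in> ball x (s / 2)" and h: "\<bar>h\<bar> < s / 2" for z h
  proof -
    have near: "dist (z + t *\<^sub>R b) x < s" if "\<bar>t\<bar> \<le> \<bar>h\<bar>" for t
    proof -
      have "dist (z + t *\<^sub>R b) x = norm ((z - x) + t *\<^sub>R b)" by (simp add: dist_norm algebra_simps)
      also have "\<dots> \<le> norm (z - x) + \<bar>t\<bar>" using norm_triangle_ineq[of "z - x" "t *\<^sub>R b"] nb by simp
      also have "\<dots> < s" using z h that by (simp add: dist_norm norm_minus_commute)
      finally show ?thesis .
    qed
    have der: "((\<lambda>t. \<phi> (z + t *\<^sub>R b)) has_real_derivative D (z + t *\<^sub>R b)) (at t)" if "\<bar>t\<bar> \<le> \<bar>h\<bar>" for t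
    proof -
      have "z + t *\<^sub>R b \<in> S" using near[OF that] s s1(2) by (auto simp: dist_commute)
      from D[OF this]
      have "((\<lambda>r. \<phi> (z + (t + r) *\<^sub>R b)) has_real_derivative D (z + t *\<^sub>R b)) (at 0)"
        by (simp add: scaleR_left_distrib add.assoc)
      then show ?thesis
        using DERIV_at_within_shift[of "\<lambda>t. \<phi> (z + t *\<^sub>R b)" "D (z + t *\<^sub>R b)" t 0 UNIV] by (simp add: add.commute)
    qed
    have close: "\<bar>D (z + t *\<^sub>R b) - D x\<bar> \<le> \<delta>" if "\<bar>t\<bar> \<le> \<bar>h\<bar>" for t
      using s2(2)[of "z + t *\<^sub>R b"] near[OF that] s by (simp add: dist_real_def)
    have "\<exists>t. \<bar>t\<bar> \<le> \<bar>h\<bar> \<and> \<phi> (z + h *\<^sub>R b) - \<phi> z = h * D (z + t *\<^sub>R b)"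
    proof (cases h "0::real" rule: linorder_cases)
      case less
      have "\<exists>t. h < t \<and> t < 0 \<and> \<phi> (z + 0 *\<^sub>R b) - \<phi> (z + h *\<^sub>R b) = (0 - h) * D (z + t *\<^sub>R b)"
        by (rule MVT2[OF less]) (use less der in simp)
      then obtain t where t: "h < t" "t < 0" "\<phi> z - \<phi> (z + h *\<^sub>R b) = - h * D (z + t *\<^sub>R b)" by auto
      then show ?thesis using less by (intro exI[of _ t]) auto
    next
      case equal then show ?thesis by auto
    next
      case greater
      have "\<exists>t. 0 < t \<and> t < h \<and> \<phi> (z + h *\<^sub>R b) - \<phi> (z + 0 *\<^sub>R b) = (h - 0) * D (z + t *\<^sub>R b)"
        by (rule MVT2[OF greater]) (use greater der in simp)
      then obtain t where t: "0 < t" "t < h" "\<phi> (z + h *\<^sub>R b) - \<phi> z = h * D (z + t *\<^sub>R b)" by auto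
      then show ?thesis using greater by (intro exI[of _ t]) auto
    qed
    then obtain t where t: "\<bar>t\<bar> \<le> \<bar>h\<bar>" "\<phi> (z + h *\<^sub>R b) - \<phi> z = h * D (z + t *\<^sub>R b)" by blast
    have "\<bar>\<phi> (z + h *\<^sub>R b) - \<phi> z - h * D x\<bar> = \<bar>h\<bar> * \<bar>D (z + t *\<^sub>R b) - D x\<bar>"
      unfolding t(2) right_diff_distrib[symmetric] abs_mult ..
    also have "\<dots> \<le> \<bar>h\<bar> * \<delta>" by (rule mult_left_mono[OF close[OF t(1)]]) simp
    finally show ?thesis by (simp add: mult.commute)
  qed
  show "\<exists>\<rho>>0. \<forall>z\<in>ball x \<rho>. \<forall>h. \<bar>h\<bar> < \<rho> \<longrightarrow> \<bar>\<phi> (z + h *\<^sub>R b) - \<phi> z - h * D x\<bar> \<le> \<delta> * \<bar>h\<bar>"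
    using est s(1) by (intro exI[of _ "s / 2"]) auto
qed

lemma AE_norm_notin:
  assumes "finite (Z :: real set)"
  shows "AE x in lebesgue. norm (x::'a::euclidean_space) \<notin> Z"
proof -
  have "negligible (\<Union>r\<in>Z. sphere (0::'a) r)"
    by (rule negligible_Union) (use assms negligible_sphere in auto)
  then have "(\<Union>r\<in>Z. sphere (0::'a) r) \<in> null_sets lebesgue" by (simp add: negligible_iff_null_sets)
  from AE_not_in[OF this] show ?thesis by eventually_elim auto
qed

text \<open>The fundamental theorem of calculus tolerates finitely many exceptional points for a
  continuous function.\<close>

lemma lipschitz_from_deriv:
  fixes f f' :: "real \<Rightarrow> real"
  assumes fin: "finite Z" and cont: "continuous_on {0..} f"
    and D: "\<And>r. 0 < r \<Longrightarrow> r \<notin> Z \<Longrightarrow> (f has_real_derivative f' r) (at r)"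
    and bd: "\<And>r. 0 < r \<Longrightarrow> r \<notin> Z \<Longrightarrow> \<bar>f' r\<bar> \<le> C"
    and ab: "0 \<le> a" "0 \<le> b" and C: "0 \<le> C"
  shows "\<bar>f a - f b\<bar> \<le> C * \<bar>a - b\<bar>"
proof -
  have main: "\<bar>f b - f a\<bar> \<le> C * (b - a)" if ab: "0 \<le> a" "a \<le> b" for a b
  proof -
    define g where "g r = (if r \<in> Z \<union> {0} then 0 else f' r)" for r
    have "(g has_integral (f b - f a)) {a..b}"
    proof (rule fundamental_theorem_of_calculus_interior_strong[of "Z \<union> {0}"])
      fix x assume "x \<in> {a<..<b} - (Z \<union> {0})"
      then show "(f has_vector_derivative g x) (at x)"
        using D[of x] ab by (simp add: g_def has_real_derivative_iff_has_vector_derivative)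
    qed (use fin ab continuous_on_subset[OF cont] in auto)
    from has_integral_bound[OF C this[folded cbox_interval]]
    show ?thesis using bd ab C by (fastforce simp: g_def)
  qed
  show ?thesis
  proof (cases "a \<le> b")
    case True then show ?thesis using main[OF ab(1) True] by (simp add: abs_minus_commute)
  next
    case False then show ?thesis using main[OF ab(2), of a] by simp
  qed
qed

text \<open>Describes the field f(|x|) x. The finite set \<open>Z\<close> admits kinks, at
  truncation radii and at the free boundary; the spheres over it are negligible.\<close>

locale radial_field =
  fixes f f' :: "real \<Rightarrow> real" and Z :: "real set" and C K :: real
  assumes fin: "finite Z" and cont: "continuous_on {0..} f"
    and D: "\<And>r. 0 < r \<Longrightarrow> r \<notin> Z \<Longrightarrow> (f has_real_derivative f' r) (at r)"
    and bd: "\<And>r. 0 < r \<Longrightarrow> r \<notin> Z \<Longrightarrow> \<bar>f' r\<bar> \<le> C"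
    and C: "0 \<le> C" and K: "0 \<le> K" and supp: "\<And>r. K \<le> r \<Longrightarrow> f r = 0"
begin

lemma lip: "0 \<le> a \<Longrightarrow> 0 \<le> b \<Longrightarrow> \<bar>f a - f b\<bar> \<le> C * \<bar>a - b\<bar>"
  by (rule lipschitz_from_deriv[OF fin cont D bd _ _ C])

lemma bounded: "0 \<le> r \<Longrightarrow> \<bar>f r\<bar> \<le> C * K"
  using lip[of r K] supp[of K] supp[of r] C K
  by (cases "K \<le> r") (auto intro: order_trans[OF _ mult_left_mono[of "K - r" K C]])

text \<open>The factor x . b is unbounded. If one of the two points lies in the ball of radius
  \<open>K\<close>, that point can be made to carry the factor; otherwise both values
  vanish.\<close>

lemma component_lip:
  fixes x y b :: "'a::euclidean_space"
  assumes b: "b \<in> Basis"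
  shows "\<bar>f (norm x) * (x \<bullet> b) - f (norm y) * (y \<bullet> b)\<bar> \<le> (2 * C * K) * norm (x - y)"
proof -
  have main: "\<bar>f (norm x) * (x \<bullet> b) - f (norm y) * (y \<bullet> b)\<bar> \<le> (2 * C * K) * norm (x - y)"
    if y: "norm y \<le> K" for x y :: 'a
  proof -
    have "f (norm x) * (x \<bullet> b) - f (norm y) * (y \<bullet> b)
        = f (norm x) * ((x - y) \<bullet> b) + (f (norm x) - f (norm y)) * (y \<bullet> b)"
      by (simp add: inner_diff_left algebra_simps)
    also have "\<bar>\<dots>\<bar> \<le> \<bar>f (norm x)\<bar> * \<bar>(x - y) \<bullet> b\<bar> + \<bar>f (norm x) - f (norm y)\<bar> * \<bar>y \<bullet> b\<bar>"
      by (rule order_trans[OF abs_triangle_ineq]) (simp add: abs_mult)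
    also have "\<dots> \<le> (C * K) * norm (x - y) + (C * norm (x - y)) * K"
    proof (intro add_mono mult_mono bounded)
      show "\<bar>(x - y) \<bullet> b\<bar> \<le> norm (x - y)" using b by (rule Basis_le_norm)
      show "\<bar>y \<bullet> b\<bar> \<le> K" using Basis_le_norm[OF b, of y] y by simp
      have "\<bar>f (norm x) - f (norm y)\<bar> \<le> C * \<bar>norm x - norm y\<bar>" by (intro lip) auto
      also have "\<dots> \<le> C * norm (x - y)" by (intro mult_left_mono norm_triangle_ineq3 C)
      finally show "\<bar>f (norm x) - f (norm y)\<bar> \<le> C * norm (x - y)" .
    qed (use C K in auto)
    finally show ?thesis by (simp add: algebra_simps)
  qed
  show ?thesis
  proof (cases "norm y \<le> K")
    case False
    show ?thesis
    proof (cases "norm x \<le> K")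
      case True then show ?thesis using main[OF True, of y] by (simp add: abs_minus_commute norm_minus_commute)
    next
      case False2: False
      then show ?thesis using False supp C K by simp
    qed
  qed (rule main)
qed

lemma component_supp: "K < norm x \<Longrightarrow> f (norm x) * (x \<bullet> b) = 0"
  using supp by simp

lemma component_deriv_AE:
  fixes b :: "'a::euclidean_space"
  assumes b: "b \<in> Basis"
  shows "AE x in lebesgue. ((\<lambda>h. f (norm (x + h *\<^sub>R b)) * ((x + h *\<^sub>R b) \<bullet> b))
      has_real_derivative radial_D f f' b x) (at 0)"
  using AE_norm_notin[of "insert 0 Z"] fin
  by (auto elim!: eventually_mono intro!: radial_component_deriv D b)

lemma divergence_integral:
  shows "integrable lebesgue (\<lambda>x::'a::euclidean_space. f' (norm x) * norm x + DIM('a) * f (norm x))"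
    "(LINT x::'a|lebesgue. f' (norm x) * norm x + DIM('a) * f (norm x)) = 0"
proof -
  have i: "integrable lebesgue (radial_D f f' b :: 'a \<Rightarrow> real)" "(LINT x::'a|lebesgue. radial_D f f' b x) = 0"
    if b: "b \<in> Basis" for b :: 'a
    using integral_partial_derivative_zero[of "\<lambda>x. f (norm x) * (x \<bullet> b)" "2 * C * K" K b "radial_D f f' b",
      OF component_lip[OF b] _ component_deriv_AE[OF b]] component_supp by blast+
  show "integrable lebesgue (\<lambda>x::'a. f' (norm x) * norm x + DIM('a) * f (norm x))"
    unfolding radial_D_sum[where f = f and f' = f', symmetric] by (intro Bochner_Integration.integrable_sum i)
  show "(LINT x::'a|lebesgue. f' (norm x) * norm x + DIM('a) * f (norm x)) = 0"
    unfolding radial_D_sum[where f = f and f' = f', symmetric] by (subst Bochner_Integration.integral_sum) (auto simp: i)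
qed

lemma component_strict_AE:
  fixes b :: "'a::euclidean_space"
  assumes b: "b \<in> Basis" and cont': "\<And>r. 0 < r \<Longrightarrow> r \<notin> Z \<Longrightarrow> isCont f' r"
  shows "AE x in lebesgue. strict_dd (\<lambda>x. f (norm x) * (x \<bullet> b)) b (radial_D f f' b x) x"
proof -
  have "finite (insert 0 Z)" using fin by simp
  from AE_norm_notin[OF this] show ?thesis
  proof eventually_elim
    case (elim x)
    define S where "S = {z::'a. norm z \<notin> insert 0 Z}"
    have "open (norm -` (- insert 0 Z) :: 'a set)"
      using fin by (intro open_vimage continuous_intros open_Compl finite_imp_closed) auto
    moreover have "norm -` (- insert 0 Z) = S" by (auto simp: S_def)
    ultimately have S: "open S" by simp
    have xS: "x \<in> S" using elim by (simp add: S_def)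
    have der: "((\<lambda>h. f (norm (z + h *\<^sub>R b)) * ((z + h *\<^sub>R b) \<bullet> b)) has_real_derivative radial_D f f' b z) (at 0)"
      if "z \<in> S" for z
      using that by (intro radial_component_deriv D b) (auto simp: S_def)
    have cD: "isCont (radial_D f f' b) x"
    proof -
      have r: "0 < norm x" "norm x \<notin> Z" using elim by auto
      have "isCont (\<lambda>x. f' (norm x)) x" "isCont (\<lambda>x. f (norm x)) x"
        using cont'[OF r] DERIV_isCont[OF D[OF r]]
        by (auto intro!: isCont_o2[of x norm f'] isCont_o2[of x norm f] continuous_intros)
      then show ?thesis unfolding radial_D_def[abs_def]
        using r by (intro continuous_intros) auto
    qed
    show ?case by (rule strict_ddI[OF S xS b _ cD]) (rule der)
  qed
qed

text \<open>Here a function that has only a weak gradient is tested, so the components must be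
  strictly differentiable almost everywhere; this is where continuity of \<open>f'\<close>
  enters.\<close>

lemma weak_divergence:
  fixes u :: "'a::euclidean_space \<Rightarrow> real"
  assumes wg: "weak_gradient u g" and cont': "\<And>r. 0 < r \<Longrightarrow> r \<notin> Z \<Longrightarrow> isCont f' r"
  shows "integrable lebesgue (\<lambda>x. u x * (f' (norm x) * norm x + DIM('a) * f (norm x)))"
    "integrable lebesgue (\<lambda>x. f (norm x) * (g x \<bullet> x))"
    "(LINT x|lebesgue. u x * (f' (norm x) * norm x + DIM('a) * f (norm x)))
      = - (LINT x|lebesgue. f (norm x) * (g x \<bullet> x))"
proof -
  have i: "integrable lebesgue (\<lambda>x. u x * radial_D f f' b x)"
    "integrable lebesgue (\<lambda>x. (g x \<bullet> b) * (f (norm x) * (x \<bullet> b)))"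
    "(LINT x|lebesgue. u x * radial_D f f' b x) = - (LINT x|lebesgue. (g x \<bullet> b) * (f (norm x) * (x \<bullet> b)))"
    if b: "b \<in> Basis" for b
  proof -
    have st: "AE x in lebesgue. strict_dd (\<lambda>x. f (norm x) * (x \<bullet> b)) b (radial_D f f' b x) x"
      by (rule component_strict_AE[OF b cont'])
    note I = weak_gradient_lipschitz[of u g "\<lambda>x. f (norm x) * (x \<bullet> b)" "2 * C * K" K b "radial_D f f' b",
      OF wg component_lip[OF b] _ K b st]
    show "integrable lebesgue (\<lambda>x. u x * radial_D f f' b x)" by (rule I(1)[OF component_supp])
    show "integrable lebesgue (\<lambda>x. (g x \<bullet> b) * (f (norm x) * (x \<bullet> b)))" by (rule I(2)[OF component_supp])
    show "(LINT x|lebesgue. u x * radial_D f f' b x) = - (LINT x|lebesgue. (g x \<bullet> b) * (f (norm x) * (x \<bullet> b)))"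
      by (rule I(3)[OF component_supp])
  qed
  have e1: "u x * (f' (norm x) * norm x + DIM('a) * f (norm x)) = (\<Sum>b\<in>Basis. u x * radial_D f f' b x)" for x
    unfolding radial_D_sum[where f = f and f' = f', symmetric] sum_distrib_left ..
  have e2: "f (norm x) * (g x \<bullet> x) = (\<Sum>b\<in>Basis. (g x \<bullet> b) * (f (norm x) * (x \<bullet> b)))" for x
    by (subst euclidean_inner) (simp add: sum_distrib_left mult_ac)
  show "integrable lebesgue (\<lambda>x. u x * (f' (norm x) * norm x + DIM('a) * f (norm x)))"
    unfolding e1 by (intro Bochner_Integration.integrable_sum i)
  show "integrable lebesgue (\<lambda>x. f (norm x) * (g x \<bullet> x))"
    unfolding e2 by (intro Bochner_Integration.integrable_sum i)
  show "(LINT x|lebesgue. u x * (f' (norm x) * norm x + DIM('a) * f (norm x)))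
      = - (LINT x|lebesgue. f (norm x) * (g x \<bullet> x))"
    unfolding e1 e2 using i
    by (subst (1 2) Bochner_Integration.integral_sum) (auto simp: sum_negf)
qed

end

section \<open>The flux of the extremal function\<close>

locale extremal =
  fixes d :: nat and p q k :: real and u w :: "real \<Rightarrow> real" and ty :: "'a::euclidean_space itself"
  assumes prof: "profile_on d p q k u w" and d_DIM: "d = DIM('a)" and p_gt: "real d < p" and q: "0 \<le> q"
begin

lemma d1: "1 \<le> d" using d_DIM DIM_positive[where 'a='a] by simp
lemma p1: "1 < p" using d1 p_gt by simp

lemmas P = profile_onD[OF prof]

text \<open>The slope -u' of the profile, recovered from its flux.\<close>

definition v :: "real \<Rightarrow> real" where
  "v r = (w r * r powr (1 - real d)) powr (1 / (p - 1))"

lemma v_nonneg: "0 \<le> v r" by (simp add: v_def)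

lemma u_mono: "0 \<le> r \<Longrightarrow> r \<le> s \<Longrightarrow> u s \<le> u r"
  using P(6) by (auto dest!: monotone_onD[of _ _ _ u r s])

lemma w_mono: "0 \<le> r \<Longrightarrow> r \<le> s \<Longrightarrow> w s \<le> w r"
  using P(7) by (auto dest!: monotone_onD[of _ _ _ w r s])

lemma u_le1: "0 \<le> r \<Longrightarrow> u r \<le> 1" using u_mono[of 0 r] P(2) by simp
lemma w_lek: "0 \<le> r \<Longrightarrow> w r \<le> k" using w_mono[of 0 r] P(3) by simp

lemma du: "0 < r \<Longrightarrow> (u has_real_derivative - v r) (at r)"
  using P(12) by (simp add: v_def)

lemma v_flux: assumes "0 < r" shows "v r powr (p - 1) = w r * r powr (1 - real d)"
  using P(9)[of r] assms p1 by (simp add: v_def powr_powr)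

lemma v_energy: assumes "0 < r" shows "v r * (w r * r powr (1 - real d)) = v r powr p"
  using powr_mult_base[OF v_nonneg, of r "p - 1"] v_flux[OF assms] by simp

text \<open>Contains at most the free boundary radius. For q = 0 the function
  \<open>u powr q\<close> jumps there from 1 to 0 and \<open>w\<close> has a kink.\<close>

definition Z0 :: "real set" where
  "Z0 = {r. 0 < r \<and> \<not> ((w has_real_derivative - (r powr (real d - 1) * u r powr q)) (at r)
     \<and> isCont (\<lambda>r. u r powr q) r)}"

lemma finite_Z0: "finite Z0"
proof -
  have pos: "r \<notin> Z0" if "0 < r" "0 < u r" for r
    using P(14)[OF that] DERIV_isCont[OF du[OF that(1)]] that
    by (auto simp: Z0_def intro!: continuous_intros)
  show ?thesis
  proof (cases "q < p - 1")
    case True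
    then obtain R where R: "0 < R" "\<forall>r\<in>{0..<R}. 0 < u r" "\<forall>r\<ge>R. u r = 0" using P(16) by blast
    have "r \<notin> Z0" if r: "R < r" for r
    proof -
      have 0: "u s = 0" "w s = 0" if "s \<in> {R<..}" for s
        using that R P(15)[of s] by auto
      have "(w has_real_derivative 0) (at r)"
        by (rule has_field_derivative_transform_within_open[OF DERIV_const, where S = "{R<..}"])
          (use r 0 in auto)
      moreover have "isCont (\<lambda>r. u r powr q) r"
      proof -
        have "\<forall>\<^sub>F s in nhds r. u s powr q = 0"
          by (rule eventually_nhds_in_open[of "{R<..}", THEN eventually_mono]) (use r 0 in auto)
        then have "isCont (\<lambda>r. u r powr q) r = isCont (\<lambda>_. 0 :: real) r" by (rule isCont_cong)
        then show ?thesis by simp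
      qed
      ultimately show ?thesis using 0[of r] r by (simp add: Z0_def)
    qed
    moreover have "r \<notin> Z0" if "r < R" for r
      using pos[of r] R that by (cases "0 < r") (auto simp: Z0_def)
    ultimately have "Z0 \<subseteq> {R}" by (metis insertI1 linorder_less_linear subsetI)
    then show ?thesis by (rule finite_subset) simp
  next
    case False
    then have "Z0 = {}" using pos P(17) by (auto simp: Z0_def)
    then show ?thesis by simp
  qed
qed

lemma dw: "0 < r \<Longrightarrow> r \<notin> Z0 \<Longrightarrow> (w has_real_derivative - (r powr (real d - 1) * u r powr q)) (at r)"
  and cont_uq: "0 < r \<Longrightarrow> r \<notin> Z0 \<Longrightarrow> isCont (\<lambda>r. u r powr q) r"
  by (simp_all add: Z0_def)

text \<open>The field \<open>zeta(|x|) x\<close> is minus the flux of the extremal function, with its singularity at the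
  origin replaced by a linear field on the ball of radius \<open>\<epsilon>\<close> and shifted so as to vanish
  at radius \<open>L\<close>.\<close>

definition zeta :: "real \<Rightarrow> real \<Rightarrow> real \<Rightarrow> real" where
  "zeta \<epsilon> L r = (w (min (max r \<epsilon>) L) - w L) * max r \<epsilon> powr (- real d)"

definition zeta' :: "real \<Rightarrow> real \<Rightarrow> real \<Rightarrow> real" where
  "zeta' \<epsilon> L r = (if \<epsilon> < r \<and> r < L
     then - (u r powr q / r) - real d * (w r - w L) * r powr (- real d - 1) else 0)"

context
  fixes \<epsilon> L :: real
  assumes eL: "0 < \<epsilon>" "\<epsilon> < L"
begin

lemma zeta_cont: "continuous_on {0..} (zeta \<epsilon> L)"
  unfolding zeta_def using eL
  by (intro continuous_intros continuous_on_compose2[OF P(5)]) (auto simp: max_def)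

lemma zeta_small: "r \<le> \<epsilon> \<Longrightarrow> zeta \<epsilon> L r = (w \<epsilon> - w L) * \<epsilon> powr (- real d)"
  using eL by (simp add: zeta_def max_absorb2)

lemma zeta_mid: "\<epsilon> \<le> r \<Longrightarrow> r \<le> L \<Longrightarrow> zeta \<epsilon> L r = (w r - w L) * r powr (- real d)"
  by (simp add: zeta_def max_absorb1 min_absorb1)

lemma zeta_large: "L \<le> r \<Longrightarrow> zeta \<epsilon> L r = 0"
  using eL by (simp add: zeta_def max_absorb1 min_absorb2)

lemma zeta_deriv:
  assumes r: "0 < r" "r \<notin> Z0 \<union> {\<epsilon>, L}"
  shows "(zeta \<epsilon> L has_real_derivative zeta' \<epsilon> L r) (at r)"
proof -
  consider "r < \<epsilon>" | "\<epsilon> < r" "r < L" | "L < r" using r(2) by fastforce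
  then show ?thesis
  proof cases
    case 1
    have "(zeta \<epsilon> L has_real_derivative 0) (at r)"
      by (rule has_field_derivative_transform_within_open[OF DERIV_const, where S = "{..<\<epsilon>}"])
        (use 1 zeta_small in auto)
    then show ?thesis using 1 by (simp add: zeta'_def)
  next
    case 2
    have a: "((\<lambda>r. w r - w L) has_real_derivative - (r powr (real d - 1) * u r powr q)) (at r)"
      using DERIV_diff[OF dw DERIV_const, of r "w L"] r by simp
    have "((\<lambda>r. r powr (- real d)) has_real_derivative - real d * r powr (- real d - 1)) (at r)"
      by (rule has_real_derivative_powr[OF r(1)])
    from DERIV_mult[OF a this]
    have "((\<lambda>r. (w r - w L) * r powr (- real d)) has_real_derivative zeta' \<epsilon> L r) (at r)"
    proof (rule DERIV_cong)
      have "r powr (real d - 1) * r powr (- real d) = 1 / r"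
        using r powr_minus_divide[of r 1] by (simp add: powr_add[symmetric])
      then have "r powr (real d - 1) * u r powr q * r powr (- real d) = u r powr q / r"
        by (metis mult.commute mult.left_commute mult_1 times_divide_eq_left)
      then show "- (r powr (real d - 1) * u r powr q) * r powr - real d +
          - real d * r powr (- real d - 1) * (w r - w L) = zeta' \<epsilon> L r"
        using 2 by (simp add: zeta'_def)
    qed
    then show ?thesis
      by (rule has_field_derivative_transform_within_open[where S = "{\<epsilon><..<L}"])
        (use 2 zeta_mid in auto)
  next
    case 3
    have "(zeta \<epsilon> L has_real_derivative 0) (at r)"
      by (rule has_field_derivative_transform_within_open[OF DERIV_const, where S = "{L<..}"])
        (use 3 zeta_large in auto)
    then show ?thesis using 3 by (simp add: zeta'_def)
  qed
qed

lemma uq_le1: "0 \<le> r \<Longrightarrow> u r powr q \<le> 1"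
  using powr_mono2[of q "u r" 1] P(8)[of r] u_le1[of r] q by simp

definition C\<zeta> :: real where "C\<zeta> = 1 / \<epsilon> + real d * k * \<epsilon> powr (- real d - 1)"

lemma C\<zeta>_nonneg: "0 \<le> C\<zeta>" using eL P(1) by (simp add: C\<zeta>_def)

lemma zeta'_bound: "\<bar>zeta' \<epsilon> L r\<bar> \<le> C\<zeta>"
proof (cases "\<epsilon> < r \<and> r < L")
  case True
  have "u r powr q / r \<le> 1 / \<epsilon>" using uq_le1[of r] True eL by (intro frac_le) auto
  moreover have "real d * (w r - w L) * r powr (- real d - 1) \<le> real d * k * \<epsilon> powr (- real d - 1)"
    using True eL w_lek[of r] w_mono[of r L] P(9)[of L] P(1) by (intro mult_mono powr_mono2') auto
  moreover have "0 \<le> u r powr q / r" using True eL by simp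
  moreover have "0 \<le> real d * (w r - w L) * r powr (- real d - 1)"
    using True eL w_mono[of r L] by simp
  ultimately show ?thesis using True unfolding zeta'_def C\<zeta>_def by simp
qed (use C\<zeta>_nonneg in \<open>auto simp: zeta'_def\<close>)

lemma zeta_field: "radial_field (zeta \<epsilon> L) (zeta' \<epsilon> L) (Z0 \<union> {\<epsilon>, L}) C\<zeta> L"
  by unfold_locales
    (use finite_Z0 zeta_cont zeta_deriv zeta'_bound C\<zeta>_nonneg eL zeta_large in auto)

lemma zeta'_cont:
  assumes r: "0 < r" "r \<notin> Z0 \<union> {\<epsilon>, L}"
  shows "isCont (zeta' \<epsilon> L) r"
proof -
  consider "r < \<epsilon>" | "\<epsilon> < r" "r < L" | "L < r" using r(2) by fastforce
  then show ?thesis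
  proof cases
    case 1
    have "\<forall>\<^sub>F s in nhds r. zeta' \<epsilon> L s = 0"
      by (rule eventually_nhds_in_open[of "{..<\<epsilon>}", THEN eventually_mono]) (use 1 in \<open>auto simp: zeta'_def\<close>)
    then show ?thesis by (simp add: isCont_cong)
  next
    case 2
    have "\<forall>\<^sub>F s in nhds r. zeta' \<epsilon> L s = - (u s powr q / s) - real d * (w s - w L) * s powr (- real d - 1)"
      by (rule eventually_nhds_in_open[of "{\<epsilon><..<L}", THEN eventually_mono]) (use 2 in \<open>auto simp: zeta'_def\<close>)
    moreover have "isCont (\<lambda>s. - (u s powr q / s) - real d * (w s - w L) * s powr (- real d - 1)) r"
    proof -
      have 1: "isCont (\<lambda>s. u s powr q / s) r"
        using cont_uq[of r] r by (intro isCont_divide continuous_ident) auto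
      have 2: "isCont w r" using DERIV_isCont[OF dw[of r]] r by auto
      have 3: "isCont (\<lambda>s. s powr (- real d - 1)) r" using r by (intro continuous_intros) auto
      show ?thesis by (intro continuous_diff continuous_minus continuous_mult continuous_const 1 2 3)
    qed
    ultimately show ?thesis by (simp add: isCont_cong)
  next
    case 3
    have "\<forall>\<^sub>F s in nhds r. zeta' \<epsilon> L s = 0"
      by (rule eventually_nhds_in_open[of "{L<..}", THEN eventually_mono]) (use 3 in \<open>auto simp: zeta'_def\<close>)
    then show ?thesis by (simp add: isCont_cong)
  qed
qed

text \<open>The field |x| powr (-d) x is divergence free away from 0, so in the shell only the
  derivative of \<open>w\<close> contributes and the shift by \<open>w L\<close> disappears. On the
  inner ball the field is linear.\<close>

lemma zeta_div:
  assumes "0 \<le> r" "r \<noteq> \<epsilon>" "r \<noteq> L"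
  shows "zeta' \<epsilon> L r * r + real d * zeta \<epsilon> L r =
    (if r < \<epsilon> then real d * ((w \<epsilon> - w L) * \<epsilon> powr (- real d)) else if r < L then - (u r powr q) else 0)"
proof -
  consider "r < \<epsilon>" | "\<epsilon> < r" "r < L" | "L < r" using assms by fastforce
  then show ?thesis
  proof cases
    case 2
    then have "r powr (- real d - 1) * r = r powr (- real d)"
      using powr_mult_base[of r "- real d - 1"] eL by (simp add: mult.commute)
    then have e: "real d * (w r - w L) * r powr (- real d - 1) * r = real d * ((w r - w L) * r powr (- real d))"
      by (simp add: mult.assoc)
    have "(- (a / r) - b) * r = - a - b * r" for a b
      using 2 eL by (simp add: left_diff_distrib)
    then have z1: "zeta' \<epsilon> L r * r = - (u r powr q) - real d * (w r - w L) * r powr (- real d - 1) * r"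
      using 2 unfolding zeta'_def by simp
    have z2: "zeta \<epsilon> L r = (w r - w L) * r powr (- real d)" using 2 by (simp add: zeta_mid)
    have "zeta' \<epsilon> L r * r + real d * zeta \<epsilon> L r = - (u r powr q)" unfolding z1 z2 e by simp
    then show ?thesis using 2 by simp
  qed (use eL in \<open>auto simp: zeta'_def zeta_small zeta_large\<close>)
qed

lemma zeta_nonneg: assumes "0 \<le> r" shows "0 \<le> zeta \<epsilon> L r"
proof -
  have "w L \<le> w (min (max r \<epsilon>) L)" using eL assms by (intro w_mono) auto
  then show ?thesis by (simp add: zeta_def)
qed

text \<open>Making the field linear at the centre and shifting it to vanish at \<open>L\<close> only
  lower the flux, so Young's inequality applies to the truncated field without error terms.\<close>

lemma zeta_le_flux: assumes "0 < r" shows "zeta \<epsilon> L r * r \<le> v r powr (p - 1)"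
proof -
  have "w (min (max r \<epsilon>) L) - w L \<le> w r" if "r \<le> L"
  proof -
    have "w (min (max r \<epsilon>) L) \<le> w r" using eL assms that by (intro w_mono) auto
    then show ?thesis using P(9)[of L] eL by simp
  qed
  then have "w (min (max r \<epsilon>) L) - w L \<le> w r"
    using P(9)[of r] assms eL by (cases "r \<le> L") (auto simp: max_absorb1 min_absorb2)
  moreover have "max r \<epsilon> powr (- real d) \<le> r powr (- real d)"
    using assms by (intro powr_mono2') auto
  ultimately have "zeta \<epsilon> L r \<le> w r * r powr (- real d)"
    unfolding zeta_def using P(9)[of r] assms by (intro mult_mono) auto
  then have "zeta \<epsilon> L r * r \<le> w r * r powr (- real d) * r" using assms by (intro mult_right_mono) auto
  also have "\<dots> = w r * r powr (1 - real d)"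
    using powr_mult_base[of r "- real d"] assms by (simp add: mult_ac)
  finally show ?thesis using v_flux[OF assms] by simp
qed

definition H :: "real \<Rightarrow> real" where
  "H r = (if \<epsilon> < r \<and> r < L then u r * u r powr q + v r * (zeta \<epsilon> L r * r) else 0)"

text \<open>The field u zeta x, with \<open>u\<close> frozen on the inner ball, has compact support
  and hence total divergence 0. On the shell its divergence is \<open>- H\<close>; the inner ball
  contributes the right-hand side.\<close>

lemma energy_truncated:
  shows "integrable lebesgue (\<lambda>x::'a. H (norm x))"
    "(LINT x::'a|lebesgue. H (norm x)) = real d * measure lebesgue (ball (0::'a) 1) * (u \<epsilon> * (w \<epsilon> - w L))"
proof -
  define f where "f r = u (max r \<epsilon>) * zeta \<epsilon> L r" for r
  define f' where "f' r = (if \<epsilon> < r \<and> r < L then - v r * zeta \<epsilon> L r + zeta' \<epsilon> L r * u r else 0)" for r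
  define B where "B = (k * \<epsilon> powr (1 - real d)) powr (1 / (p - 1))"
  have vB: "v r \<le> B" if "\<epsilon> < r" for r
    unfolding v_def B_def using that eL d1 p1 P(9)[of r] w_lek[of r] P(1)
    by (intro powr_mono2 mult_mono powr_mono2' mult_nonneg_nonneg) auto
  have zB: "zeta \<epsilon> L r \<le> C\<zeta> * L" if "0 \<le> r" for r
    using radial_field.bounded[OF zeta_field that] by simp
  interpret F: radial_field f f' "Z0 \<union> {\<epsilon>, L}" "B * (C\<zeta> * L) + C\<zeta>" L
  proof
    show "finite (Z0 \<union> {\<epsilon>, L})" using finite_Z0 by simp
    show "continuous_on {0..} f" unfolding f_def
      by (intro continuous_intros zeta_cont continuous_on_compose2[OF P(4)]) auto
    show "0 \<le> B * (C\<zeta> * L) + C\<zeta>" using eL C\<zeta>_nonneg by (simp add: B_def)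
    show "0 \<le> L" using eL by simp
    show "f r = 0" if "L \<le> r" for r using zeta_large[OF that] by (simp add: f_def)
    fix r assume r: "0 < r" "r \<notin> Z0 \<union> {\<epsilon>, L}"
    show "\<bar>f' r\<bar> \<le> B * (C\<zeta> * L) + C\<zeta>"
    proof (cases "\<epsilon> < r \<and> r < L")
      case True
      have "\<bar>f' r\<bar> \<le> \<bar>v r * zeta \<epsilon> L r\<bar> + \<bar>zeta' \<epsilon> L r * u r\<bar>" using True by (simp add: f'_def)
      also have "\<bar>v r * zeta \<epsilon> L r\<bar> \<le> B * (C\<zeta> * L)"
        unfolding abs_mult using True r v_nonneg[of r] zeta_nonneg[of r] vB[of r] zB[of r]
        by (intro mult_mono) auto
      also have "\<bar>zeta' \<epsilon> L r * u r\<bar> \<le> C\<zeta> * 1"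
        unfolding abs_mult using r P(8)[of r] u_le1[of r] zeta'_bound C\<zeta>_nonneg
        by (intro mult_mono) auto
      finally show ?thesis by simp
    next
      case False then have "f' r = 0" by (auto simp: f'_def)
      then show ?thesis using eL C\<zeta>_nonneg by (simp add: B_def)
    qed
    show "(f has_real_derivative f' r) (at r)"
    proof -
      consider "r < \<epsilon>" | "\<epsilon> < r" "r < L" | "L < r" using r(2) by fastforce
      then show ?thesis
      proof cases
        case 1
        have "(f has_real_derivative 0) (at r)"
          by (rule has_field_derivative_transform_within_open[where S = "{..<\<epsilon>}",
                OF DERIV_const[where k = "u \<epsilon> * ((w \<epsilon> - w L) * \<epsilon> powr (- real d))"]])
            (use 1 zeta_small in \<open>auto simp: f_def max_absorb2\<close>)
        then show ?thesis using 1 by (simp add: f'_def)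
      next
        case 2
        from DERIV_mult[OF du[OF r(1)] zeta_deriv[OF r]]
        have "((\<lambda>r. u r * zeta \<epsilon> L r) has_real_derivative f' r) (at r)"
          by (rule DERIV_cong) (use 2 in \<open>simp add: f'_def\<close>)
        then show ?thesis
          by (rule has_field_derivative_transform_within_open[where S = "{\<epsilon><..<L}"])
            (use 2 in \<open>auto simp: f_def max_absorb1\<close>)
      next
        case 3
        have "(f has_real_derivative 0) (at r)"
          by (rule has_field_derivative_transform_within_open[OF DERIV_const, where S = "{L<..}"])
            (use 3 zeta_large in \<open>auto simp: f_def\<close>)
        then show ?thesis using 3 by (simp add: f'_def)
      qed
    qed
  qed
  \<comment> \<open>The constant divergence on the inner ball; its factor \<epsilon> powr (- d) will
    cancel against the volume.\<close>
  define c where "c = real d * (u \<epsilon> * ((w \<epsilon> - w L) * \<epsilon> powr (- real d)))"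
  let ?I = "\<lambda>x::'a. indicator (ball 0 \<epsilon>) x * c"
  have iI: "integrable lebesgue ?I"
    by (intro integrable_mult_left integrable_real_indicator) (auto simp: emeasure_lborel_ball_finite[unfolded infinity_ennreal_def])
  have pw: "H r = (if r < \<epsilon> then c else 0) - (f' r * r + real d * f r)"
    if r: "0 \<le> r" "r \<noteq> \<epsilon>" "r \<noteq> L" for r
  proof -
    consider "r < \<epsilon>" | "\<epsilon> < r" "r < L" | "L < r" using r by fastforce
    then show ?thesis
    proof cases
      case 2
      have z: "zeta' \<epsilon> L r * r + real d * zeta \<epsilon> L r = - (u r powr q)" using zeta_div[OF r] 2 by simp
      have "f' r * r + real d * f r = - (v r * (zeta \<epsilon> L r * r)) + u r * (zeta' \<epsilon> L r * r + real d * zeta \<epsilon> L r)"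
        using 2 by (simp add: f'_def f_def max_absorb1 algebra_simps)
      then show ?thesis unfolding z using 2 by (simp add: H_def)
    qed (use eL in \<open>auto simp: H_def f'_def f_def c_def zeta_small zeta_large max_absorb2\<close>)
  qed
  have ae: "AE x::'a in lebesgue. ?I x - (f' (norm x) * norm x + DIM('a) * f (norm x)) = H (norm x)"
  proof -
    have "AE x::'a in lebesgue. norm x \<notin> {\<epsilon>, L}" by (rule AE_norm_notin) simp
    then show ?thesis by eventually_elim (auto simp: pw d_DIM[symmetric] indicator_def)
  qed
  have i1: "integrable lebesgue (\<lambda>x::'a. ?I x - (f' (norm x) * norm x + DIM('a) * f (norm x)))"
    by (intro Bochner_Integration.integrable_diff iI F.divergence_integral)
  have m: "(\<lambda>x::'a. H (norm x)) \<in> borel_measurable lebesgue"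
    by (rule borel_measurable_AE[OF borel_measurable_integrable[OF i1] ae])
  show "integrable lebesgue (\<lambda>x::'a. H (norm x))"
    using integrable_cong_AE[OF borel_measurable_integrable[OF i1] m ae] i1 by blast
  have "(LINT x::'a|lebesgue. H (norm x)) = (LINT x::'a|lebesgue. ?I x - (f' (norm x) * norm x + DIM('a) * f (norm x)))"
    by (rule integral_cong_AE[OF m borel_measurable_integrable[OF i1]]) (use ae in eventually_elim, simp)
  also have "\<dots> = (LINT x::'a|lebesgue. ?I x)"
    using F.divergence_integral[where 'a='a] iI by (subst Bochner_Integration.integral_diff) auto
  also have "\<dots> = measure lebesgue (ball (0::'a) \<epsilon>) * c" by simp
  also have "measure lebesgue (ball (0::'a) \<epsilon>) = \<epsilon> powr real d * measure lebesgue (ball (0::'a) 1)"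
    using content_ball_conv_unit_ball[of \<epsilon> "0::'a"] eL by (simp add: d_DIM powr_realpow)
  also have "\<epsilon> powr real d * measure lebesgue (ball (0::'a) 1) * c
     = real d * measure lebesgue (ball (0::'a) 1) * (u \<epsilon> * (w \<epsilon> - w L)) * (\<epsilon> powr real d * \<epsilon> powr (- real d))"
    by (simp add: c_def mult_ac)
  also have "\<epsilon> powr real d * \<epsilon> powr (- real d) = 1" using eL by (simp add: powr_add[symmetric])
  finally show "(LINT x::'a|lebesgue. H (norm x)) = real d * measure lebesgue (ball (0::'a) 1) * (u \<epsilon> * (w \<epsilon> - w L))"
    by simp
qed

end

section \<open>The upper bound\<close>

text \<open>\<open>M\<close> is the constant M_c, \<open>A\<close> the gradient energy of the
  extremal function, and \<omega> the volume of the unit ball.\<close>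

definition M :: real where "M = (LINT x::'a|lebesgue. u (norm x) powr (q + 1))"
definition A :: real where "A = (LINT x::'a|lebesgue. v (norm x) powr p)"
definition \<omega> :: real where "\<omega> = measure lebesgue (ball (0::'a) 1)"

lemma \<omega>_pos: "0 < \<omega>" unfolding \<omega>_def by simp

lemma u_cont: "continuous_on UNIV (\<lambda>x::'a. u (norm x))"
  by (rule continuous_on_compose2[OF P(4)]) (auto intro!: continuous_intros)

lemma w_cont: "continuous_on UNIV (\<lambda>x::'a. w (norm x))"
  by (rule continuous_on_compose2[OF P(5)]) (auto intro!: continuous_intros)

lemma u_meas: "(\<lambda>x::'a. u (norm x)) \<in> borel_measurable lebesgue"
  by (rule continuous_lebesgue_measurable[OF u_cont])

lemma norm_meas: "(norm :: 'a \<Rightarrow> real) \<in> borel_measurable lebesgue"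
  by (intro continuous_lebesgue_measurable continuous_intros)

lemma v_meas: "(\<lambda>x::'a. v (norm x)) \<in> borel_measurable lebesgue"
  unfolding v_def using continuous_lebesgue_measurable[OF w_cont] norm_meas by measurable

text \<open>As the inner radius shrinks and the outer one grows, the truncated densities increase to
  the full one, so monotone convergence gives finiteness of both energies together with their sum.
  The identity converts the source strength \<open>k\<close> into the energies.\<close>

lemma energy:
  shows "integrable lebesgue (\<lambda>x::'a. u (norm x) powr (q + 1))"
    "integrable lebesgue (\<lambda>x::'a. v (norm x) powr p)" "A + M = real d * \<omega> * k"
proof -
  \<comment> \<open>The offset 2 ensures \<open>e n < 1 < L n\<close> already for n = 0.\<close>
  define e where "e n = inverse (real (Suc (Suc n)))" for n
  define L where "L n = real (Suc (Suc n))" for n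
  have eL: "0 < e n" "e n < L n" for n
  proof -
    have "e n < 1" by (simp add: e_def inverse_less_1_iff)
    then show "0 < e n" "e n < L n" by (simp_all add: e_def L_def)
  qed
  have e_dec: "e n \<le> e m" and L_inc: "L m \<le> L n" if "m \<le> n" for m n
    using that by (auto simp: e_def L_def intro!: le_imp_inverse_le)
  have elim0: "e \<longlonglongrightarrow> 0" unfolding e_def using LIMSEQ_Suc[OF LIMSEQ_inverse_real_of_nat] by simp
  have Llim: "filterlim L at_top sequentially"
    unfolding L_def using filterlim_compose[OF filterlim_real_sequentially filterlim_Suc[THEN filterlim_compose[OF _ filterlim_Suc]]]
    by (simp add: filterlim_Suc)
  define F where "F n x = H (e n) (L n) (norm x)" for n and x :: 'a
  define T where "T x = u (norm x) powr (q + 1) + v (norm x) powr p" for x :: 'a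
  note E = energy_truncated[OF eL]
  have Hmid: "H (e n) (L n) r = u r * u r powr q + v r * ((w r - w (L n)) * r powr (1 - real d))"
    if "e n < r" "r < L n" for n r
  proof -
    have "0 < r" using that(1) eL(1)[of n] by simp
    then have "zeta (e n) (L n) r * r = (w r - w (L n)) * r powr (1 - real d)"
      using zeta_mid[OF eL, of n r] that powr_mult_base[of r "- real d"] by (simp add: mult_ac)
    then show ?thesis using that by (simp add: H_def[OF eL])
  qed
  have H0: "H (e n) (L n) r = 0" if "\<not> (e n < r \<and> r < L n)" for n r
    unfolding H_def[OF eL] using that by (simp only: if_False)
  have Fpos: "0 \<le> F n x" for n x
  proof (cases "e n < norm x \<and> norm x < L n")
    case True
    then show ?thesis using w_mono[of "norm x" "L n"] P(8)[of "norm x"] v_nonneg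
      by (simp add: F_def Hmid)
  qed (simp add: F_def H0)
  have Fmono: "F m x \<le> F n x" if mn: "m \<le> n" for m n x
  proof (cases "e m < norm x \<and> norm x < L m")
    case True
    then have T2: "e n < norm x" "norm x < L n" using e_dec[OF mn] L_inc[OF mn] by auto
    have "w (L n) \<le> w (L m)" using L_inc[OF mn] by (intro w_mono) (auto simp: L_def)
    then have "v (norm x) * ((w (norm x) - w (L m)) * norm x powr (1 - real d))
      \<le> v (norm x) * ((w (norm x) - w (L n)) * norm x powr (1 - real d))"
      by (intro mult_left_mono mult_right_mono v_nonneg) auto
    then show ?thesis using True T2 by (simp add: F_def Hmid)
  next
    case False then show ?thesis using Fpos[of n x] by (simp add: F_def H0)
  qed
  have Flim: "(\<lambda>n. F n x) \<longlonglongrightarrow> T x" if x: "x \<noteq> 0" for x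
  proof -
    have r: "0 < norm x" using x by simp
    have "\<forall>\<^sub>F n in sequentially. e n < norm x" using order_tendstoD(2)[OF elim0 r] .
    moreover have "\<forall>\<^sub>F n in sequentially. norm x < L n" using Llim by (simp add: filterlim_at_top_dense)
    ultimately have ev: "\<forall>\<^sub>F n in sequentially. u (norm x) * u (norm x) powr q
       + v (norm x) * ((w (norm x) - w (L n)) * norm x powr (1 - real d)) = F n x"
      by eventually_elim (simp add: F_def Hmid)
    have "(\<lambda>n. u (norm x) * u (norm x) powr q
       + v (norm x) * ((w (norm x) - w (L n)) * norm x powr (1 - real d)))
      \<longlonglongrightarrow> u (norm x) * u (norm x) powr q + v (norm x) * ((w (norm x) - 0) * norm x powr (1 - real d))"
      by (intro tendsto_intros filterlim_compose[OF P(11) Llim])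
    also have "u (norm x) * u (norm x) powr q + v (norm x) * ((w (norm x) - 0) * norm x powr (1 - real d)) = T x"
      using v_energy[OF r] powr_mult_base[OF P(8), of "norm x" q] by (simp add: T_def add.commute)
    finally show ?thesis using ev by (rule Lim_transform_eventually)
  qed
  have ae0: "AE x::'a in lebesgue. x \<noteq> 0"
    using AE_norm_notin[of "{0}", where 'a='a] by simp
  have Tm: "T \<in> borel_measurable lebesgue"
    unfolding T_def using u_meas v_meas by measurable
  have Ilim: "(\<lambda>n. LINT x|lebesgue. F n x) \<longlonglongrightarrow> real d * \<omega> * k"
  proof -
    have en: "\<forall>\<^sub>F n in sequentially. e n \<in> {0..}"
      using eL(1) by (intro always_eventually allI) (simp add: less_imp_le)
    have "(\<lambda>n. u (e n)) \<longlonglongrightarrow> u 0" "(\<lambda>n. w (e n)) \<longlonglongrightarrow> w 0"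
      using continuous_on_tendsto_compose[OF P(4) elim0 _ en] continuous_on_tendsto_compose[OF P(5) elim0 _ en] by auto
    then have "(\<lambda>n. real d * \<omega> * (u (e n) * (w (e n) - w (L n)))) \<longlonglongrightarrow> real d * \<omega> * (u 0 * (w 0 - 0))"
      by (intro tendsto_intros filterlim_compose[OF P(11) Llim])
    then show ?thesis using E(2) P(2,3) by (simp add: F_def \<omega>_def)
  qed
  have conv: "integrable lebesgue T" "integral\<^sup>L lebesgue T = real d * \<omega> * k"
  proof -
    have 1: "\<And>n. integrable lebesgue (F n)" unfolding F_def[abs_def] by (rule E(1))
    have 2: "AE x in lebesgue. mono (\<lambda>n. F n x)" using Fmono by (intro AE_I2) (auto intro: monoI)
    have 3: "\<And>n. AE x in lebesgue. 0 \<le> F n x" using Fpos by (intro AE_I2)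
    have 4: "AE x in lebesgue. (\<lambda>n. F n x) \<longlonglongrightarrow> T x" using ae0 by eventually_elim (rule Flim)
    show "integrable lebesgue T" by (rule integral_monotone_convergence_nonneg(1)[OF 1 2 3 4 Ilim Tm])
    show "integral\<^sup>L lebesgue T = real d * \<omega> * k"
      by (rule integral_monotone_convergence_nonneg(2)[OF 1 2 3 4 Ilim Tm])
  qed
  show i1: "integrable lebesgue (\<lambda>x::'a. u (norm x) powr (q + 1))"
  proof (rule Bochner_Integration.integrable_bound[OF conv(1)])
    show "(\<lambda>x::'a. u (norm x) powr (q + 1)) \<in> borel_measurable lebesgue" using u_meas by measurable
  qed (auto simp: T_def)
  show i2: "integrable lebesgue (\<lambda>x::'a. v (norm x) powr p)"
  proof (rule Bochner_Integration.integrable_bound[OF conv(1)])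
    show "(\<lambda>x::'a. v (norm x) powr p) \<in> borel_measurable lebesgue" using v_meas by measurable
  qed (auto simp: T_def)
  show "A + M = real d * \<omega> * k"
    using conv(2) i1 i2 unfolding T_def[abs_def] A_def M_def by simp
qed

lemma M_pos: "0 < M"
  unfolding M_def
proof (rule integral_pos_continuous[where a = 0])
  show "continuous_on UNIV (\<lambda>x::'a. u (norm x) powr (q + 1))"
    by (intro continuous_on_powr' u_cont continuous_intros) (use q P(8) in auto)
qed (use energy(1) P(2) in auto)

lemma A_nonneg: "0 \<le> A" unfolding A_def by (intro Bochner_Integration.integral_nonneg) simp

lemma young_flux:
  assumes "0 \<le> a" "0 < r"
  shows "a * v r powr (p - 1) \<le> a powr p / p + (1 - 1 / p) * v r powr p"
proof -
  define p' where "p' = p / (p - 1)"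
  have p': "1 < p'" "1 / p + 1 / p' = 1" "(p - 1) * p' = p"
    using p1 by (auto simp: p'_def field_simps)
  have "a * v r powr (p - 1) \<le> a powr p / p + (v r powr (p - 1)) powr p' / p'"
    by (rule Youngs_inequality[OF p1 p'(1,2)]) (use assms in auto)
  also have "(v r powr (p - 1)) powr p' = v r powr p" unfolding powr_powr p'(3) ..
  also have "v r powr p / p' = (1 - 1 / p) * v r powr p"
  proof -
    have "1 - 1 / p = 1 / p'" using p'(2) by simp
    then show ?thesis by simp
  qed
  finally show ?thesis .
qed

lemma young_u:
  assumes "0 \<le> a" "0 \<le> r"
  shows "u r powr q * a \<le> a powr (q + 1) / (q + 1) + (1 - 1 / (q + 1)) * u r powr (q + 1)"
proof (cases "q = 0")
  \<comment> \<open>The conjugate exponent is infinite here, so the inequality is read off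
    directly.\<close>
  case True
  then have "u r powr q * a \<le> 1 * a" using assms by (intro mult_right_mono) auto
  then show ?thesis using True assms by simp
next
  case False
  define s where "s = q + 1"
  define s' where "s' = (q + 1) / q"
  have s: "1 < s" "1 < s'" "1 / s + 1 / s' = 1" "q * s' = s"
    using False q by (auto simp: s_def s'_def field_simps)
  have "a * u r powr q \<le> a powr s / s + (u r powr q) powr s' / s'"
    by (rule Youngs_inequality[OF s(1-3)]) (use assms in auto)
  also have "(u r powr q) powr s' = u r powr s" unfolding powr_powr s(4) ..
  also have "u r powr s / s' = (1 - 1 / s) * u r powr s"
  proof -
    have "1 - 1 / s = 1 / s'" using s(3) by simp
    then show ?thesis by simp
  qed
  finally show ?thesis by (simp add: s_def mult.commute)
qed

text \<open>The integrated right-hand sides of the two Young inequalities, for a competitor with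
  energies \<open>Y\<close> and \<open>X\<close>. The case of equality is
  \<open>bound M A = A + M\<close>.\<close>

definition bound :: "real \<Rightarrow> real \<Rightarrow> real" where
  "bound Y X = (Y / (q + 1) + (1 - 1 / (q + 1)) * M) + (X / p + (1 - 1 / p) * A)"

text \<open>The weak gradient of \<open>u0\<close> is tested against the truncated flux. The
  constant divergence on the inner ball produces the left-hand side; everything else is estimated by
  Young's inequality.\<close>

lemma ball_average_truncated:
  fixes u0 :: "'a \<Rightarrow> real"
  assumes wg: "weak_gradient u0 g0" and iu: "integrable lebesgue (\<lambda>x. \<bar>u0 x\<bar> powr (q + 1))"
    and ig: "integrable lebesgue (\<lambda>x. norm (g0 x) powr p)"
    and eL: "0 < \<epsilon>" "\<epsilon> < L"
  shows "real d * ((w \<epsilon> - w L) * \<epsilon> powr (- real d)) * (LINT x|lebesgue. indicator (ball 0 \<epsilon>) x * u0 x)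
    \<le> bound (LINT x|lebesgue. \<bar>u0 x\<bar> powr (q + 1)) (LINT x|lebesgue. norm (g0 x) powr p)"
proof -
  define z where "z = real d * ((w \<epsilon> - w L) * \<epsilon> powr (- real d))"
  define dv where "dv x = zeta' \<epsilon> L (norm x) * norm x + DIM('a) * zeta \<epsilon> L (norm x)" for x :: 'a
  note W = radial_field.weak_divergence[OF zeta_field[OF eL] wg zeta'_cont[OF eL], folded dv_def]
  let ?g = "\<lambda>x. zeta \<epsilon> L (norm x) * (g0 x \<bullet> x)"
  have li: "locally_integrable u0" using wg by (simp add: weak_gradient_def)
  have iB: "integrable lebesgue (\<lambda>x. indicator (ball 0 \<epsilon>) x * u0 x)"
  proof -
    have "set_integrable lebesgue (cball 0 \<epsilon>) u0" using li by (simp add: locally_integrable_def)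
    from set_integrable_subset[OF this, of "ball 0 \<epsilon>"] show ?thesis by (simp add: set_integrable_def ball_subset_cball)
  qed
  \<comment> \<open>The source term minus \<open>u0\<close> times the divergence. Almost everywhere
    this is \<open>u powr q * u0\<close> on the shell and 0 elsewhere.\<close>
  define X where "X x = (indicator (ball 0 \<epsilon>) x * u0 x) * z - u0 x * dv x" for x
  have iX: "integrable lebesgue X" unfolding X_def
    by (intro Bochner_Integration.integrable_diff integrable_mult_left iB W(1))
  have aeX: "AE x in lebesgue. X x \<le> \<bar>u0 x\<bar> powr (q + 1) / (q + 1) + (1 - 1 / (q + 1)) * u (norm x) powr (q + 1)"
  proof -
    have "AE x::'a in lebesgue. norm x \<notin> {\<epsilon>, L}" by (rule AE_norm_notin) simp
    then show ?thesis
    proof eventually_elim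
      case (elim x)
      have dv: "dv x = (if norm x < \<epsilon> then z else if norm x < L then - (u (norm x) powr q) else 0)"
        using zeta_div[OF eL, of "norm x"] elim unfolding dv_def z_def d_DIM[symmetric] by simp
      have nn: "0 \<le> \<bar>u0 x\<bar> powr (q + 1) / (q + 1) + (1 - 1 / (q + 1)) * u (norm x) powr (q + 1)"
        using q by (intro add_nonneg_nonneg mult_nonneg_nonneg) auto
      consider "norm x < \<epsilon>" | "\<epsilon> < norm x" "norm x < L" | "L < norm x" using elim by fastforce
      then show ?case
      proof cases
        case 1
        then have "X x = 0" by (simp add: X_def dv)
        then show ?thesis using nn by simp
      next
        case 2
        then have "X x = u (norm x) powr q * u0 x" by (simp add: X_def dv)
        also have "\<dots> \<le> u (norm x) powr q * \<bar>u0 x\<bar>" by (intro mult_left_mono) auto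
        also have "\<dots> \<le> \<bar>u0 x\<bar> powr (q + 1) / (q + 1) + (1 - 1 / (q + 1)) * u (norm x) powr (q + 1)"
          by (rule young_u) auto
        finally show ?thesis .
      next
        case 3
        then have "X x = 0" using eL by (simp add: X_def dv)
        then show ?thesis using nn by simp
      qed
    qed
  qed
  have bX: "(LINT x|lebesgue. X x) \<le> (LINT x|lebesgue. \<bar>u0 x\<bar> powr (q + 1)) / (q + 1) + (1 - 1 / (q + 1)) * M"
  proof -
    have i: "integrable lebesgue (\<lambda>x::'a. \<bar>u0 x\<bar> powr (q + 1) / (q + 1) + (1 - 1 / (q + 1)) * u (norm x) powr (q + 1))"
      using iu energy(1) by simp
    have "(LINT x|lebesgue. X x) \<le> (LINT x::'a|lebesgue. \<bar>u0 x\<bar> powr (q + 1) / (q + 1) + (1 - 1 / (q + 1)) * u (norm x) powr (q + 1))"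
      by (rule integral_mono_AE[OF iX i aeX])
    also have "\<dots> = (LINT x|lebesgue. \<bar>u0 x\<bar> powr (q + 1)) / (q + 1) + (1 - 1 / (q + 1)) * M"
      using iu energy(1) by (simp add: M_def)
    finally show ?thesis .
  qed
  have bg: "- (LINT x|lebesgue. ?g x) \<le> (LINT x|lebesgue. norm (g0 x) powr p) / p + (1 - 1 / p) * A"
  proof -
    have i: "integrable lebesgue (\<lambda>x::'a. norm (g0 x) powr p / p + (1 - 1 / p) * v (norm x) powr p)"
      using ig energy(2) by simp
    have "(LINT x|lebesgue. - ?g x) \<le> (LINT x::'a|lebesgue. norm (g0 x) powr p / p + (1 - 1 / p) * v (norm x) powr p)"
    proof (rule integral_mono_AE[OF integrable_minus[OF W(2)] i])
      have "AE x::'a in lebesgue. norm x \<notin> {0}" by (rule AE_norm_notin) simp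
      then show "AE x in lebesgue. - ?g x \<le> norm (g0 x) powr p / p + (1 - 1 / p) * v (norm x) powr p"
      proof eventually_elim
        case (elim x)
        have r: "0 < norm x" using elim by simp
        have "- ?g x = zeta \<epsilon> L (norm x) * ((- g0 x) \<bullet> x)" by simp
        also have "\<dots> \<le> zeta \<epsilon> L (norm x) * (norm (- g0 x) * norm x)"
          by (intro mult_left_mono norm_cauchy_schwarz zeta_nonneg[OF eL]) simp
        also have "\<dots> = norm (g0 x) * (zeta \<epsilon> L (norm x) * norm x)" by (simp add: mult_ac)
        also have "\<dots> \<le> norm (g0 x) * v (norm x) powr (p - 1)"
          by (intro mult_left_mono zeta_le_flux[OF eL r]) simp
        also have "\<dots> \<le> norm (g0 x) powr p / p + (1 - 1 / p) * v (norm x) powr p"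
          by (rule young_flux[OF _ r]) simp
        finally show ?case .
      qed
    qed
    also have "\<dots> = (LINT x|lebesgue. norm (g0 x) powr p) / p + (1 - 1 / p) * A"
      using ig energy(2) by (simp add: A_def)
    finally show ?thesis by simp
  qed
  have "z * (LINT x|lebesgue. indicator (ball 0 \<epsilon>) x * u0 x) = (LINT x|lebesgue. X x + u0 x * dv x)"
    by (simp add: X_def mult.commute)
  also have "\<dots> = (LINT x|lebesgue. X x) - (LINT x|lebesgue. ?g x)"
    using iX W by simp
  also have "\<dots> \<le> bound (LINT x|lebesgue. \<bar>u0 x\<bar> powr (q + 1)) (LINT x|lebesgue. norm (g0 x) powr p)"
    using bX bg unfolding bound_def by linarith
  finally show ?thesis unfolding z_def .
qed

lemma AM_pos: "0 < A + M" using A_nonneg M_pos by simp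

lemma w_tendsto_0: "0 < e \<Longrightarrow> \<exists>s>0. \<forall>r. 0 \<le> r \<longrightarrow> r < s \<longrightarrow> \<bar>w r - k\<bar> < e"
proof -
  assume e: "0 < e"
  have "continuous (at 0 within {0..}) w" using P(5) by (auto simp: continuous_on_eq_continuous_within)
  then obtain s where "0 < s" "\<And>r. r \<in> {0..} \<Longrightarrow> dist r 0 < s \<Longrightarrow> dist (w r) (w 0) < e"
    using e unfolding continuous_within_eps_delta by blast
  then show ?thesis using P(3) by (intro exI[of _ s]) (auto simp: dist_real_def)
qed

text \<open>Letting \<open>L\<close> tend to infinity removes the shift. The inner radius stays
  positive, since \<open>u0\<close> need not have a meaningful value at the origin.\<close>

lemma ball_average:
  fixes u0 :: "'a \<Rightarrow> real"
  assumes wg: "weak_gradient u0 g0" and iu: "integrable lebesgue (\<lambda>x. \<bar>u0 x\<bar> powr (q + 1))"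
    and ig: "integrable lebesgue (\<lambda>x. norm (g0 x) powr p)" and e: "0 < \<epsilon>"
  shows "w \<epsilon> * (LINT x|lebesgue. indicator (ball 0 \<epsilon>) x * u0 x)
    \<le> (bound (LINT x|lebesgue. \<bar>u0 x\<bar> powr (q + 1)) (LINT x|lebesgue. norm (g0 x) powr p) / (real d * \<omega>))
       * measure lebesgue (ball (0::'a) \<epsilon>)"
proof -
  let ?I = "LINT x|lebesgue. indicator (ball 0 \<epsilon>) x * u0 x"
  let ?B = "bound (LINT x|lebesgue. \<bar>u0 x\<bar> powr (q + 1)) (LINT x|lebesgue. norm (g0 x) powr p)"
  have "((\<lambda>L. real d * ((w \<epsilon> - w L) * \<epsilon> powr (- real d)) * ?I) \<longlongrightarrow> real d * ((w \<epsilon> - 0) * \<epsilon> powr (- real d)) * ?I) at_top"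
    by (intro tendsto_intros P(11))
  moreover have "\<forall>\<^sub>F L in at_top. real d * ((w \<epsilon> - w L) * \<epsilon> powr (- real d)) * ?I \<le> ?B"
    using eventually_gt_at_top[of \<epsilon>] by eventually_elim (rule ball_average_truncated[OF wg iu ig e])
  ultimately have "real d * ((w \<epsilon> - 0) * \<epsilon> powr (- real d)) * ?I \<le> ?B"
    by (rule tendsto_upperbound) simp
  then have 1: "\<epsilon> powr real d * (real d * (w \<epsilon> * \<epsilon> powr (- real d)) * ?I) \<le> \<epsilon> powr real d * ?B"
    by (intro mult_left_mono) auto
  have one: "\<epsilon> powr real d * \<epsilon> powr (- real d) = 1" using e by (simp add: powr_add[symmetric])
  have "\<epsilon> powr real d * (real d * (w \<epsilon> * \<epsilon> powr (- real d)) * ?I)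
      = (\<epsilon> powr real d * \<epsilon> powr (- real d)) * (real d * (w \<epsilon> * ?I))" by (simp only: mult_ac)
  with 1 one have 2: "real d * (w \<epsilon> * ?I) \<le> \<epsilon> powr real d * ?B" by simp
  have "measure lebesgue (ball (0::'a) \<epsilon>) = \<epsilon> powr real d * \<omega>"
    using content_ball_conv_unit_ball[of \<epsilon> "0::'a"] e by (simp add: d_DIM powr_realpow \<omega>_def)
  then have "(?B / (real d * \<omega>)) * measure lebesgue (ball (0::'a) \<epsilon>) = \<epsilon> powr real d * ?B / real d"
    using \<omega>_pos by simp
  then show ?thesis using 2 d1 by (simp add: le_divide_eq mult_ac)
qed

text \<open>Translating \<open>u0\<close> gives the estimate for balls about any centre. Since
  \<open>w r\<close> tends to \<open>k\<close>, the averages over small balls are at most \<kappa> /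
  k + \<eta>, uniformly in the centre, and \<kappa> / k is the stated quotient by the energy
  identity.\<close>

lemma AE_le_bound:
  fixes u0 :: "'a \<Rightarrow> real"
  assumes wg: "weak_gradient u0 g0" and iu: "integrable lebesgue (\<lambda>x. \<bar>u0 x\<bar> powr (q + 1))"
    and ig: "integrable lebesgue (\<lambda>x. norm (g0 x) powr p)"
  shows "AE x in lebesgue. u0 x \<le> bound (LINT x|lebesgue. \<bar>u0 x\<bar> powr (q + 1)) (LINT x|lebesgue. norm (g0 x) powr p) / (A + M)"
proof -
  let ?Y = "LINT x|lebesgue. \<bar>u0 x\<bar> powr (q + 1)" and ?X = "LINT x|lebesgue. norm (g0 x) powr p"
  define \<kappa> where "\<kappa> = bound ?Y ?X / (real d * \<omega>)"
  have lu: "locally_integrable u0" "locally_integrable g0" using wg by (auto simp: weak_gradient_def)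
  have um: "u0 \<in> borel_measurable lebesgue" "g0 \<in> borel_measurable lebesgue"
    using lu by (auto intro: locally_integrable_measurable)
  have kap: "bound ?Y ?X / (A + M) = \<kappa> / k" unfolding energy(3) \<kappa>_def by simp
  have avg: "w r * (LINT x|lebesgue. indicator (ball x0 r) x * u0 x) \<le> \<kappa> * measure lebesgue (ball x0 r)"
    if r: "0 < r" for x0 r
  proof -
    have 1: "weak_gradient (\<lambda>x. 1 * u0 (x0 + 1 *\<^sub>R x)) (\<lambda>x. (1 * 1) *\<^sub>R g0 (x0 + 1 *\<^sub>R x))"
      by (rule weak_gradient_affine[OF wg]) simp
    have mu: "(\<lambda>x. \<bar>u0 x\<bar> powr (q + 1)) \<in> borel_measurable lebesgue"
      "(\<lambda>x. norm (g0 x) powr p) \<in> borel_measurable lebesgue"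
      using iu ig by auto
    have Y: "integrable lebesgue (\<lambda>x. \<bar>u0 (x0 + 1 *\<^sub>R x)\<bar> powr (q + 1))" "(LINT x|lebesgue. \<bar>u0 (x0 + 1 *\<^sub>R x)\<bar> powr (q + 1)) = ?Y"
      and X: "integrable lebesgue (\<lambda>x. norm (g0 (x0 + 1 *\<^sub>R x)) powr p)" "(LINT x|lebesgue. norm (g0 (x0 + 1 *\<^sub>R x)) powr p) = ?X"
      using lebesgue_integral_affine[OF _ mu(1), of 1 x0] lebesgue_integral_affine[OF _ mu(2), of 1 x0] iu ig by auto
    have li: "(\<lambda>x. indicator (ball x0 r) x * u0 x) \<in> borel_measurable lebesgue"
      by (intro borel_measurable_times um borel_measurable_indicator) simp
    have "(LINT x|lebesgue. indicator (ball x0 r) x * u0 x)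
        = (LINT x|lebesgue. indicator (ball x0 r) (x0 + 1 *\<^sub>R x) * u0 (x0 + 1 *\<^sub>R x))"
      using lebesgue_integral_affine(1)[OF _ li, of 1 x0] by simp
    also have "(\<lambda>x. indicat_real (ball x0 r) (x0 + 1 *\<^sub>R x)) = indicat_real (ball 0 r)"
      by (auto simp: indicator_def dist_norm fun_eq_iff)
    then have "(LINT x|lebesgue. indicator (ball x0 r) (x0 + 1 *\<^sub>R x) * u0 (x0 + 1 *\<^sub>R x))
      = (LINT x|lebesgue. indicator (ball 0 r) x * u0 (x0 + x))" by (simp add: fun_eq_iff)
    finally have I: "(LINT x|lebesgue. indicator (ball x0 r) x * u0 x) = (LINT x|lebesgue. indicator (ball 0 r) x * u0 (x0 + x))" .
    have m: "measure lebesgue (ball x0 r) = measure lebesgue (ball (0::'a) r)"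
      using content_ball_conv_unit_ball[of r x0] content_ball_conv_unit_ball[of r "0::'a"] r by simp
    show ?thesis unfolding I m \<kappa>_def
      using ball_average[OF 1 _ _ r] X Y by simp
  qed
  have main: "AE x in lebesgue. u0 x \<le> \<kappa> / k + \<eta>" if eta: "0 < \<eta>" for \<eta>
  proof -
    define c where "c = \<kappa> / k + \<eta>"
    \<comment> \<open>The first bound keeps \<open>w r\<close> positive; the second makes
      \<open>w r * c\<close> at least \<kappa>.\<close>
    obtain s where s: "0 < s" "\<And>r. 0 \<le> r \<Longrightarrow> r < s \<Longrightarrow> \<bar>w r - k\<bar> < min k (k * \<eta> / (\<bar>c\<bar> + 1))"
      using w_tendsto_0[of "min k (k * \<eta> / (\<bar>c\<bar> + 1))"] P(1) eta by auto
    have wc: "\<kappa> \<le> w r * c" "0 < w r" if r: "0 < r" "r < s" for r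
    proof -
      have a: "\<bar>w r - k\<bar> < k" "\<bar>w r - k\<bar> < k * \<eta> / (\<bar>c\<bar> + 1)" using s(2)[of r] r by auto
      show "0 < w r" using a by linarith
      have "\<bar>(w r - k) * c\<bar> \<le> \<bar>w r - k\<bar> * (\<bar>c\<bar> + 1)" unfolding abs_mult by (intro mult_left_mono) auto
      also have "\<dots> \<le> k * \<eta> / (\<bar>c\<bar> + 1) * (\<bar>c\<bar> + 1)" using a(2) by (intro mult_right_mono) auto
      also have "\<dots> = k * \<eta>" by simp
      finally have "k * c - k * \<eta> \<le> w r * c" by (simp add: abs_le_iff algebra_simps)
      moreover have "k * c - k * \<eta> = \<kappa>" using P(1) by (simp add: c_def distrib_left)
      ultimately show "\<kappa> \<le> w r * c" by simp
    qed
    have lc: "locally_integrable (\<lambda>x. u0 x - c)"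
      unfolding locally_integrable_def
    proof (intro allI impI)
      fix K :: "'a set" assume "compact K"
      moreover from this have "set_integrable lebesgue K (\<lambda>x. c)"
        unfolding set_integrable_def
        by (intro integrable_scaleR_left integrable_real_indicator)
          (auto simp: emeasure_compact_finite[unfolded infinity_ennreal_def] compact_imp_closed borel_closed)
      ultimately show "set_integrable lebesgue K (\<lambda>x. u0 x - c)"
        using lu by (auto simp: locally_integrable_def)
    qed
    have "AE x in lebesgue. u0 x - c \<le> 0"
    proof (rule AE_nonpos_if_ball_integrals_nonpos[OF lc s(1)])
      fix x0 :: 'a and r :: real assume r: "0 < r" "r < s"
      have iu: "integrable lebesgue (\<lambda>x. indicator (ball x0 r) x * u0 x)"
      proof -
        have "set_integrable lebesgue (cball x0 r) u0" using lu by (simp add: locally_integrable_def)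
        from set_integrable_subset[OF this, of "ball x0 r"] show ?thesis by (simp add: set_integrable_def ball_subset_cball)
      qed
      have ic: "integrable lebesgue (\<lambda>x. indicator (ball x0 r) x * c)"
        by (intro integrable_mult_left integrable_real_indicator) (auto simp: emeasure_lborel_ball_finite[unfolded infinity_ennreal_def])
      have "(LINT y|lebesgue. indicator (ball x0 r) y * (u0 y - c))
        = (LINT x|lebesgue. indicator (ball x0 r) x * u0 x) - measure lebesgue (ball x0 r) * c"
        unfolding right_diff_distrib using iu ic by simp
      moreover have "w r * (LINT x|lebesgue. indicator (ball x0 r) x * u0 x) \<le> w r * (measure lebesgue (ball x0 r) * c)"
      proof -
        have "\<kappa> * measure lebesgue (ball x0 r) \<le> (w r * c) * measure lebesgue (ball x0 r)"
          using wc(1)[OF r] by (intro mult_right_mono) auto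
        then show ?thesis using avg[OF r(1), of x0] by (simp add: mult_ac)
      qed
      then have "(LINT x|lebesgue. indicator (ball x0 r) x * u0 x) \<le> measure lebesgue (ball x0 r) * c"
        using wc(2)[OF r] by (simp only: mult_le_cancel_left_pos)
      ultimately show "(LINT y|lebesgue. indicator (ball x0 r) y * (u0 y - c)) \<le> 0" by simp
    qed
    then show ?thesis by eventually_elim (simp add: c_def)
  qed
  have "AE x in lebesgue. \<forall>n. u0 x \<le> \<kappa> / k + inverse (real (Suc n))"
    unfolding AE_all_countable by (intro allI main) simp
  then show ?thesis unfolding kap
  proof eventually_elim
    case (elim x)
    have "(\<lambda>n. \<kappa> / k + inverse (real (Suc n))) \<longlonglongrightarrow> \<kappa> / k + 0"
      by (intro tendsto_intros LIMSEQ_inverse_real_of_nat)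
    then show ?case using elim by (intro LIMSEQ_le_const[of _ "\<kappa> / k"]) auto
  qed
qed

lemma AE_abs_le_bound:
  fixes u0 :: "'a \<Rightarrow> real"
  assumes wg: "weak_gradient u0 g0" and iu: "integrable lebesgue (\<lambda>x. \<bar>u0 x\<bar> powr (q + 1))"
    and ig: "integrable lebesgue (\<lambda>x. norm (g0 x) powr p)"
  shows "AE x in lebesgue. \<bar>u0 x\<bar> \<le> bound (LINT x|lebesgue. \<bar>u0 x\<bar> powr (q + 1)) (LINT x|lebesgue. norm (g0 x) powr p) / (A + M)"
proof -
  have "weak_gradient (\<lambda>x. (-1) * u0 (0 + 1 *\<^sub>R x)) (\<lambda>x. ((-1) * 1) *\<^sub>R g0 (0 + 1 *\<^sub>R x))"
    by (rule weak_gradient_affine[OF wg]) simp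
  then have "weak_gradient (\<lambda>x. - u0 x) (\<lambda>x. - g0 x)" by simp
  from AE_le_bound[OF this] iu ig
  have "AE x in lebesgue. - u0 x \<le> bound (LINT x|lebesgue. \<bar>u0 x\<bar> powr (q + 1)) (LINT x|lebesgue. norm (g0 x) powr p) / (A + M)"
    by simp
  with AE_le_bound[OF assms] show ?thesis by eventually_elim (simp add: abs_le_iff)
qed

end

section \<open>The extremal function\<close>

lemma line_derivative:
  fixes f :: "'a::euclidean_space \<Rightarrow> real"
  assumes "(f has_derivative f') (at x)"
  shows "((\<lambda>h. f (x + h *\<^sub>R b)) has_real_derivative f' b) (at 0)"
proof -
  have "((\<lambda>h. x + h *\<^sub>R b) has_derivative (\<lambda>h. h *\<^sub>R b)) (at 0)" by (auto intro!: derivative_eq_intros)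
  from has_derivative_compose[OF this, of f f'] assms
  have "((\<lambda>h. f (x + h *\<^sub>R b)) has_derivative (\<lambda>h. f' (h *\<^sub>R b))) (at 0)" by simp
  moreover have "(\<lambda>h. f' (h *\<^sub>R b)) = (\<lambda>h. f' b * h)"
    using has_derivative_linear[OF assms] by (auto simp: linear_cmul fun_eq_iff)
  ultimately show ?thesis by (simp add: has_field_derivative_def)
qed

lemma test_function_support:
  fixes \<phi> :: "'a::euclidean_space \<Rightarrow> real"
  assumes "test_function \<phi>"
  shows "\<exists>K\<ge>0. \<forall>x. K < norm x \<longrightarrow> \<phi> x = 0 \<and> (\<forall>b. frechet_derivative \<phi> (at x) b = 0)"
proof -
  have "bounded {x. \<phi> x \<noteq> 0}"
    using assms compact_imp_bounded bounded_subset closure_subset unfolding test_function_def by metis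
  then obtain B where B: "\<And>x. \<phi> x \<noteq> 0 \<Longrightarrow> norm x \<le> B" by (auto simp: bounded_iff)
  define K where "K = max B 0"
  have 0: "\<phi> x = 0" if "K < norm x" for x using B[of x] that by (auto simp: K_def)
  have d0: "frechet_derivative \<phi> (at x) b = 0" if x: "K < norm x" for x b
  proof -
    have "open {x::'a. K < norm x}" by (intro open_Collect_less continuous_intros)
    then have "(\<phi> has_derivative (\<lambda>h. 0)) (at x)"
      by (rule has_derivative_transform_within_open[OF has_derivative_const]) (use 0 x in auto)
    then show ?thesis using frechet_derivative_eqI by metis
  qed
  have "0 \<le> K" by (simp add: K_def)
  then show ?thesis using 0 d0 by blast
qed

lemma test_function_lipschitz:
  fixes \<phi> :: "'a::euclidean_space \<Rightarrow> real"
  assumes t: "test_function \<phi>"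
  shows "\<exists>L\<ge>0. \<forall>x y. \<bar>\<phi> x - \<phi> y\<bar> \<le> L * norm (x - y)"
proof -
  have k: "k_times_cont_diff (Suc 0) \<phi>" using t by (simp only: test_function_def)
  note D = ktcd_SucD(1)[OF k]
  obtain K where "0 \<le> K" "\<And>x. K < norm x \<Longrightarrow> \<phi> x = 0"
    and K: "\<And>x b. K < norm x \<Longrightarrow> frechet_derivative \<phi> (at x) b = 0"
    using test_function_support[OF t] by metis
  have "\<exists>B. \<forall>x. \<bar>frechet_derivative \<phi> (at x) b\<bar> \<le> B" if "b \<in> Basis" for b
    by (rule integrable_continuous_support(2)[OF test_function_continuous(2)[OF t that] K])
  then obtain B where B: "\<And>b x. b \<in> Basis \<Longrightarrow> \<bar>frechet_derivative \<phi> (at x) b\<bar> \<le> B b" by metis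
  define L where "L = sum B Basis"
  have "onorm (frechet_derivative \<phi> (at x)) \<le> L" for x
  proof (rule onorm_le)
    fix h :: 'a
    let ?D = "frechet_derivative \<phi> (at x)"
    have lin: "linear ?D" using has_derivative_linear[OF D] .
    have "?D h = ?D (\<Sum>i\<in>Basis. (h \<bullet> i) *\<^sub>R i)" by (simp add: euclidean_representation)
    also have "\<dots> = (\<Sum>i\<in>Basis. (h \<bullet> i) * ?D i)" by (simp add: linear_sum[OF lin] linear_cmul[OF lin])
    finally have "norm (?D h) \<le> (\<Sum>i\<in>Basis. \<bar>h \<bullet> i\<bar> * \<bar>?D i\<bar>)"
      using sum_abs[of "\<lambda>i. (h \<bullet> i) * ?D i" Basis] by (simp add: abs_mult)
    also have "\<dots> \<le> (\<Sum>i\<in>Basis. norm h * B i)"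
      by (intro sum_mono mult_mono Basis_le_norm B) auto
    finally show "norm (?D h) \<le> L * norm h" unfolding L_def mult.commute[of _ "norm h"] sum_distrib_left .
  qed
  then have "norm (\<phi> x - \<phi> y) \<le> L * norm (x - y)" for x y
    using differentiable_bound[of UNIV \<phi> "\<lambda>x. frechet_derivative \<phi> (at x)" L x y] D by simp
  then have "\<forall>x y. \<bar>\<phi> x - \<phi> y\<bar> \<le> L * norm (x - y)" by simp
  moreover have "0 \<le> L" unfolding L_def by (rule sum_nonneg) (rule order_trans[OF abs_ge_zero B])
  ultimately show ?thesis by (intro exI[of _ L] conjI)
qed

lemma locally_integrable_dominated:
  fixes f :: "'a::euclidean_space \<Rightarrow> 'b::euclidean_space"
  assumes "f \<in> borel_measurable lebesgue" "integrable lebesgue h" "\<And>x. norm (f x) \<le> 1 + h x" "\<And>x. 0 \<le> h x"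
  shows "locally_integrable f"
  unfolding locally_integrable_def set_integrable_def
proof (intro allI impI)
  fix K :: "'a set" assume K: "compact K"
  then have Km: "K \<in> lmeasurable" by (rule lmeasurable_compact)
  then have Ks: "K \<in> sets lebesgue" by (rule fmeasurableD)
  have iK: "integrable lebesgue (indicat_real K)" using Km by (simp only: lmeasurable_iff_integrable)
  show "integrable lebesgue (\<lambda>x. indicat_real K x *\<^sub>R f x)"
  proof (rule Bochner_Integration.integrable_bound[OF Bochner_Integration.integrable_add[OF iK assms(2)]])
    show "(\<lambda>x. indicat_real K x *\<^sub>R f x) \<in> borel_measurable lebesgue"
      using assms(1) Ks by (intro borel_measurable_scaleR borel_measurable_indicator)
    show "AE x in lebesgue. norm (indicat_real K x *\<^sub>R f x) \<le> norm (indicat_real K x + h x)"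
      using assms(3,4) by (intro AE_I2) (auto simp: indicator_def)
  qed
qed

lemma AE_affine:
  fixes t :: "'a::euclidean_space"
  assumes "c \<noteq> 0" "{y. P y} \<in> sets lebesgue" "AE x in lebesgue. P (t + c *\<^sub>R x)"
  shows "AE y in lebesgue. P y"
proof -
  have "AE y in distr lebesgue lebesgue (\<lambda>x. t + c *\<^sub>R x). P y"
    by (subst AE_distr_iff[OF lebesgue_scaleR_translate(2)[OF assms(1)]]) (use assms in auto)
  then have "AE y in density (distr lebesgue lebesgue (\<lambda>x. t + c *\<^sub>R x)) (\<lambda>_. ennreal (\<bar>c\<bar> ^ DIM('a))). P y"
    by (subst AE_density) auto
  then show ?thesis by (subst lebesgue_scaleR_translate(1)[OF assms(1), of t])
qed

context extremal begin

definition Uc :: "'a \<Rightarrow> real" where "Uc x = u (norm x)"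
definition Gc :: "'a \<Rightarrow> 'a" where "Gc x = - (v (norm x) / norm x) *\<^sub>R x"

lemma norm_Gc: "x \<noteq> 0 \<Longrightarrow> norm (Gc x) = v (norm x)"
  using v_nonneg[of "norm x"] by (simp add: Gc_def)

lemma norm_Gc_le: "norm (Gc x) \<le> v (norm x)"
  using norm_Gc[of x] v_nonneg[of "norm x"] by (cases "x = 0") (auto simp: Gc_def)

lemma v_le_powr: "v r \<le> 1 + v r powr p"
proof (cases "v r \<le> 1")
  case True then show ?thesis using powr_ge_zero[of "v r" p] by linarith
next
  case False
  then have "v r powr 1 \<le> v r powr p" using p1 by (intro powr_mono) auto
  then show ?thesis using False by simp
qed

lemma Gc_meas: "Gc \<in> borel_measurable lebesgue"
proof -
  have "(\<lambda>x::'a. x) \<in> borel_measurable lebesgue" by (simp add: measurable_completion)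
  then show ?thesis unfolding Gc_def[abs_def] using v_meas norm_meas by measurable
qed

lemma Gc_integrals:
  "integrable lebesgue (\<lambda>x. norm (Gc x) powr p)" "(LINT x|lebesgue. norm (Gc x) powr p) = A"
proof -
  have "AE x::'a in lebesgue. norm x \<notin> {0}" by (rule AE_norm_notin) simp
  then have ae: "AE x in lebesgue. v (norm x) powr p = norm (Gc x) powr p"
    by eventually_elim (simp add: norm_Gc)
  have m: "(\<lambda>x. norm (Gc x) powr p) \<in> borel_measurable lebesgue" using Gc_meas by measurable
  show "integrable lebesgue (\<lambda>x. norm (Gc x) powr p)"
    using integrable_cong_AE[OF borel_measurable_integrable[OF energy(2)] m ae] energy(2) by blast
  show "(LINT x|lebesgue. norm (Gc x) powr p) = A"
    using integral_cong_AE[OF borel_measurable_integrable[OF energy(2)] m ae] by (simp add: A_def)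
qed

lemma Uc_integrals:
  "integrable lebesgue (\<lambda>x. \<bar>Uc x\<bar> powr (q + 1))" "(LINT x|lebesgue. \<bar>Uc x\<bar> powr (q + 1)) = M"
  using energy(1) P(8) by (simp_all add: Uc_def M_def)

text \<open>For d > 1 the gradient is unbounded at the origin. So \<open>u\<close> is first frozen
  on the ball of radius \<open>e n\<close>; its product with a test function is then Lipschitz, the
  integral of the derivative vanishes, and \<open>e n\<close> tends to 0.\<close>

lemma weak_gradient_Uc: "weak_gradient Uc Gc"
  unfolding weak_gradient_def
proof (intro conjI allI impI ballI)
  have um: "Uc \<in> borel_measurable lebesgue" unfolding Uc_def[abs_def] by (rule u_meas)
  show "locally_integrable Uc"
    by (rule locally_integrable_dominated[OF um, of "\<lambda>_. 0"]) (use P(8) u_le1 in \<open>auto simp: Uc_def\<close>)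
  show "locally_integrable Gc"
    by (rule locally_integrable_dominated[OF Gc_meas energy(2)])
      (use norm_Gc_le v_le_powr order_trans in \<open>blast, simp\<close>)
  fix \<phi> :: "'a \<Rightarrow> real" and b :: 'a assume t: "test_function \<phi>" and b: "b \<in> Basis"
  have k: "k_times_cont_diff (Suc 0) \<phi>" using t by (simp only: test_function_def)
  note Dphi = ktcd_SucD(1)[OF k]
  define g where "g x = frechet_derivative \<phi> (at x) b" for x
  obtain K where K0: "0 \<le> K" "\<And>x. K < norm x \<Longrightarrow> \<phi> x = 0"
    "\<And>x b. K < norm x \<Longrightarrow> frechet_derivative \<phi> (at x) b = 0"
    using test_function_support[OF t] by metis
  have K: "0 \<le> K" "\<And>x. K < norm x \<Longrightarrow> \<phi> x = 0" "\<And>x. K < norm x \<Longrightarrow> g x = 0"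
    using K0 by (simp_all add: g_def)
  obtain Lp where Lp: "0 \<le> Lp" "\<And>x y. \<bar>\<phi> x - \<phi> y\<bar> \<le> Lp * norm (x - y)"
    using test_function_lipschitz[OF t] by metis
  have cphi: "continuous_on UNIV \<phi>" and cg: "continuous_on UNIV g"
    using test_function_continuous[OF t] b by (auto simp: g_def[abs_def])
  obtain B where B: "\<And>x. \<bar>\<phi> x\<bar> \<le> B" using integrable_continuous_support(2)[OF cphi K(2)] by blast
  have B0: "0 \<le> B" using B[of 0] by linarith
  have ig: "integrable lebesgue g" by (rule integrable_continuous_support[OF cg K(3)])
  define h where "h x = v (norm x) * ((x \<bullet> b) / norm x) * \<phi> x" for x
  have hm: "h \<in> borel_measurable lebesgue"
  proof -
    have "(\<lambda>x. x \<bullet> b) \<in> borel_measurable lebesgue" "\<phi> \<in> borel_measurable lebesgue"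
      by (intro continuous_lebesgue_measurable continuous_intros cphi)+
    then show ?thesis unfolding h_def[abs_def] using v_meas norm_meas by measurable
  qed
  have hb: "\<bar>h x\<bar> \<le> v (norm x) * \<bar>\<phi> x\<bar>" for x
  proof -
    have "\<bar>(x \<bullet> b) / norm x\<bar> \<le> 1" using Basis_le_norm[OF b, of x] by (simp add: divide_le_eq)
    then have "v (norm x) * \<bar>(x \<bullet> b) / norm x\<bar> \<le> v (norm x) * 1"
      by (intro mult_left_mono v_nonneg)
    then have "v (norm x) * \<bar>(x \<bullet> b) / norm x\<bar> * \<bar>\<phi> x\<bar> \<le> v (norm x) * 1 * \<bar>\<phi> x\<bar>" by (intro mult_right_mono) auto
    then show ?thesis using v_nonneg[of "norm x"] by (simp add: h_def abs_mult)
  qed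
  \<comment> \<open>The majorant uses \<open>v r \<le> 1 + v r powr p\<close>, because integrability
    is known for the p-th power of the slope.\<close>
  define dom where "dom x = \<bar>\<phi> x\<bar> + B * v (norm x) powr p" for x
  have idom: "integrable lebesgue dom" unfolding dom_def
    using integrable_continuous_support(1)[OF cphi K(2)] energy(2) by simp
  have hdom: "\<bar>h x\<bar> \<le> dom x" for x
  proof -
    have "v (norm x) * \<bar>\<phi> x\<bar> \<le> (1 + v (norm x) powr p) * \<bar>\<phi> x\<bar>"
      by (intro mult_right_mono v_le_powr) simp
    also have "\<dots> = \<bar>\<phi> x\<bar> + \<bar>\<phi> x\<bar> * v (norm x) powr p" by (simp add: algebra_simps)
    also have "\<dots> \<le> dom x" unfolding dom_def by (intro add_left_mono mult_right_mono B) simp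
    finally show ?thesis using hb[of x] by simp
  qed
  define e where "e n = inverse (real (Suc n))" for n
  have e0: "0 < e n" for n by (simp add: e_def)
  have elim0: "e \<longlonglongrightarrow> 0" unfolding e_def by (rule LIMSEQ_inverse_real_of_nat)
  define un where "un n x = u (max (norm x) (e n))" for n and x :: 'a
  define hn where "hn n x = indicator {x. e n < norm x} x * h x" for n and x :: 'a
  have un_c: "continuous_on UNIV (un n)" for n unfolding un_def
    by (rule continuous_on_compose2[OF P(4)]) (auto intro!: continuous_intros simp: le_max_iff_disj)
  have un_b: "\<bar>un n x\<bar> \<le> 1" for n x
  proof -
    have "0 \<le> max (norm x) (e n)" by (simp add: le_max_iff_disj)
    then show ?thesis using P(8) u_le1 by (simp add: un_def)
  qed
  have key: "(LINT x|lebesgue. un n x * g x) = (LINT x|lebesgue. hn n x)" for n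
  proof -
    define V where "V = (k * e n powr (1 - real d)) powr (1 / (p - 1))"
    have V0: "0 \<le> V" by (simp add: V_def)
    have vV: "v r \<le> V" if "e n < r" for r
      unfolding v_def V_def using that e0[of n] d1 p1 P(9)[of r] w_lek[of r] P(1)
      by (intro powr_mono2 mult_mono powr_mono2' mult_nonneg_nonneg) auto
    define f where "f r = u (max r (e n))" for r
    define f' where "f' r = (if e n < r then - v r else 0)" for r
    have fD: "(f has_real_derivative f' r) (at r)" if r: "0 < r" "r \<notin> {e n}" for r
    proof (cases "e n < r")
      case True
      have "(f has_real_derivative - v r) (at r)"
        by (rule has_field_derivative_transform_within_open[OF du[OF r(1)], where S = "{e n<..}"])
          (use True in \<open>auto simp: f_def max_def\<close>)
      then show ?thesis using True by (simp add: f'_def)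
    next
      case False
      have "(f has_real_derivative 0) (at r)"
        by (rule has_field_derivative_transform_within_open[OF DERIV_const[of "u (e n)"], where S = "{..<e n}"])
          (use False r in \<open>auto simp: f_def max_def\<close>)
      then show ?thesis using False by (simp add: f'_def)
    qed
    have fcont: "continuous_on {0..} f" unfolding f_def
      by (rule continuous_on_compose2[OF P(4)]) (auto intro!: continuous_intros simp: le_max_iff_disj)
    have flip: "\<bar>f r - f s\<bar> \<le> V * \<bar>r - s\<bar>" if "0 \<le> r" "0 \<le> s" for r s
      by (rule lipschitz_from_deriv[of "{e n}" f f']) (use fcont fD vV v_nonneg V0 that in \<open>auto simp: f'_def\<close>)
    have un_f: "un n x = f (norm x)" for x by (simp add: un_def f_def)
    define W where "W x = un n x * \<phi> x" for x
    have Wlip: "\<bar>W x - W y\<bar> \<le> (Lp + V * B) * norm (x - y)" for x y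
    proof -
      have "W x - W y = un n x * (\<phi> x - \<phi> y) + (un n x - un n y) * \<phi> y"
        by (simp add: W_def algebra_simps)
      also have "\<bar>\<dots>\<bar> \<le> \<bar>un n x\<bar> * \<bar>\<phi> x - \<phi> y\<bar> + \<bar>un n x - un n y\<bar> * \<bar>\<phi> y\<bar>"
        by (rule order_trans[OF abs_triangle_ineq]) (simp add: abs_mult)
      also have "\<dots> \<le> 1 * (Lp * norm (x - y)) + (V * norm (x - y)) * B"
      proof (intro add_mono mult_mono un_b Lp(2) B)
        have "\<bar>un n x - un n y\<bar> \<le> V * \<bar>norm x - norm y\<bar>" unfolding un_f by (rule flip) auto
        also have "\<dots> \<le> V * norm (x - y)" by (intro mult_left_mono norm_triangle_ineq3 V0)
        finally show "\<bar>un n x - un n y\<bar> \<le> V * norm (x - y)" .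
      qed (use Lp V0 in auto)
      finally show ?thesis by (simp add: algebra_simps)
    qed
    have Wsupp: "W x = 0" if "K < norm x" for x using K(2)[OF that] by (simp add: W_def)
    have "AE x::'a in lebesgue. norm x \<notin> {0, e n}" by (rule AE_norm_notin) simp
    then have WD: "AE x in lebesgue. ((\<lambda>h. W (x + h *\<^sub>R b)) has_real_derivative un n x * g x - hn n x) (at 0)"
    proof eventually_elim
      case (elim x)
      have r: "0 < norm x" "norm x \<notin> {e n}" "x \<noteq> 0" using elim by auto
      have 1: "((\<lambda>h. f (norm (x + h *\<^sub>R b))) has_real_derivative f' (norm x) * ((x \<bullet> b) / norm x)) (at 0)"
        by (rule DERIV_chain2[OF _ DERIV_norm_line[OF r(3)]]) (use fD[OF r(1,2)] in simp)
      from DERIV_mult[OF 1 line_derivative[OF Dphi]]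
      show ?case unfolding W_def un_f
        by (rule DERIV_cong) (simp add: g_def hn_def h_def f'_def indicator_def)
    qed
    note I = integral_partial_derivative_zero[OF Wlip Wsupp WD]
    have i1: "integrable lebesgue (\<lambda>x. un n x * g x)"
      by (rule integrable_continuous_support[where K = K]) (auto intro!: continuous_intros un_c cg simp: K(3))
    have i2: "integrable lebesgue (hn n)"
      using Bochner_Integration.integrable_diff[OF i1 I(1)] by simp
    show ?thesis using I(2) i1 i2 by simp
  qed
  have L1: "(\<lambda>n. LINT x|lebesgue. un n x * g x) \<longlonglongrightarrow> (LINT x|lebesgue. Uc x * g x)"
  proof (rule integral_dominated_convergence[where w = "\<lambda>x. \<bar>g x\<bar>"])
    show "(\<lambda>x. Uc x * g x) \<in> borel_measurable lebesgue"
      by (intro borel_measurable_times um continuous_lebesgue_measurable cg)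
    show "(\<lambda>x. un n x * g x) \<in> borel_measurable lebesgue" for n
      by (intro borel_measurable_times continuous_lebesgue_measurable cg un_c)
    show "integrable lebesgue (\<lambda>x. \<bar>g x\<bar>)" using ig by simp
    show "AE x in lebesgue. (\<lambda>n. un n x * g x) \<longlonglongrightarrow> Uc x * g x"
    proof (intro AE_I2 tendsto_intros)
      fix x :: 'a
      have "(\<lambda>n. max (norm x) (e n)) \<longlonglongrightarrow> max (norm x) 0" by (intro tendsto_intros elim0)
      then have "(\<lambda>n. max (norm x) (e n)) \<longlonglongrightarrow> norm x" by simp
      then show "(\<lambda>n. un n x) \<longlonglongrightarrow> Uc x" unfolding un_def Uc_def
        by (rule continuous_on_tendsto_compose[OF P(4)]) (auto simp: le_max_iff_disj)
    qed
    show "AE x in lebesgue. norm (un n x * g x) \<le> \<bar>g x\<bar>" for n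
      using un_b[of n] by (intro AE_I2) (simp add: abs_mult mult_left_le_one_le)
  qed
  have L2: "(\<lambda>n. LINT x|lebesgue. hn n x) \<longlonglongrightarrow> (LINT x|lebesgue. h x)"
  proof (rule integral_dominated_convergence[where w = dom])
    show "h \<in> borel_measurable lebesgue" by (rule hm)
    have "open {x::'a. e n < norm x}" for n by (intro open_Collect_less continuous_intros)
    then have "{x::'a. e n < norm x} \<in> sets lebesgue" for n
      by (metis borel_open sets_completionI_sets sets_lborel)
    then show "hn n \<in> borel_measurable lebesgue" for n
      unfolding hn_def by (intro borel_measurable_times hm borel_measurable_indicator)
    show "integrable lebesgue dom" by (rule idom)
    have "AE x::'a in lebesgue. norm x \<notin> {0}" by (rule AE_norm_notin) simp
    then show "AE x in lebesgue. (\<lambda>n. hn n x) \<longlonglongrightarrow> h x"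
    proof eventually_elim
      case (elim x)
      have "\<forall>\<^sub>F n in sequentially. e n < norm x" using order_tendstoD(2)[OF elim0, of "norm x"] elim by simp
      then have "\<forall>\<^sub>F n in sequentially. hn n x = h x" by eventually_elim (simp add: hn_def)
      then show ?case by (rule tendsto_eventually)
    qed
    show "AE x in lebesgue. norm (hn n x) \<le> dom x" for n
    proof (intro AE_I2)
      fix x :: 'a
      have "\<bar>hn n x\<bar> \<le> \<bar>h x\<bar>" by (simp add: hn_def indicator_def)
      then show "norm (hn n x) \<le> dom x" using hdom[of x] by simp
    qed
  qed
  have "(LINT x|lebesgue. Uc x * g x) = (LINT x|lebesgue. h x)"
    using LIMSEQ_unique[OF L1[unfolded key] L2] .
  also have "\<dots> = (LINT x|lebesgue. - ((Gc x \<bullet> b) * \<phi> x))"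
    by (rule Bochner_Integration.integral_cong[OF refl]) (simp add: h_def Gc_def)
  also have "\<dots> = - (LINT x|lebesgue. (Gc x \<bullet> b) * \<phi> x)" by (rule Bochner_Integration.integral_minus)
  finally show "(LINT x|lebesgue. Uc x * frechet_derivative \<phi> (at x) b) = - (LINT x|lebesgue. (Gc x \<bullet> b) * \<phi> x)"
    unfolding g_def .
qed

text \<open>Near the origin the flux is close to \<open>k > 0\<close>, so the slope is positive on a
  nonempty open set.\<close>

lemma A_pos: "0 < A"
proof (rule ccontr)
  assume "\<not> 0 < A"
  then have "A = 0" using A_nonneg by linarith
  then have "(LINT x::'a|lebesgue. v (norm x) powr p) = 0" by (simp only: A_def)
  then have ae: "AE x::'a in lebesgue. v (norm x) powr p = 0"
    using integral_nonneg_eq_0_iff_AE[OF energy(2)] by simp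
  obtain s where s: "0 < s" "\<And>r. 0 \<le> r \<Longrightarrow> r < s \<Longrightarrow> \<bar>w r - k\<bar> < k"
    using w_tendsto_0[of k] P(1) by blast
  define S where "S = ball (0::'a) s - {0}"
  have "open S" unfolding S_def by (intro open_Diff) auto
  moreover obtain b :: 'a where b: "b \<in> Basis" using nonempty_Basis by blast
  have "(s / 2) *\<^sub>R b \<in> S" using s(1) b by (auto simp: S_def)
  ultimately obtain x where x: "x \<in> S" "v (norm x) powr p = 0"
    using AE_open_meets[OF ae, of S] by blast
  have "0 < norm x" "norm x < s" using x(1) by (auto simp: S_def)
  then have "0 < w (norm x)" using s(2)[of "norm x"] by (simp add: abs_less_iff)
  then have "0 < v (norm x)" using \<open>0 < norm x\<close> by (simp add: v_def)
  then show False using x(2) by simp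
qed

text \<open>The change of variables contributes t powr (- d), and differentiation one more factor
  \<open>t\<close> in the gradient.\<close>

lemma scaled_integrals:
  fixes u0 :: "'a \<Rightarrow> real" and g0 :: "'a \<Rightarrow> 'a"
  assumes iu: "integrable lebesgue (\<lambda>x. \<bar>u0 x\<bar> powr (q + 1))" and ig: "integrable lebesgue (\<lambda>x. norm (g0 x) powr p)"
    and s: "0 < s" and t: "0 < t"
  shows "integrable lebesgue (\<lambda>x. \<bar>s * u0 (x0 + t *\<^sub>R x)\<bar> powr (q + 1))"
    "(LINT x|lebesgue. \<bar>s * u0 (x0 + t *\<^sub>R x)\<bar> powr (q + 1)) = s powr (q + 1) * t powr (- real d) * (LINT x|lebesgue. \<bar>u0 x\<bar> powr (q + 1))"
    "integrable lebesgue (\<lambda>x. norm ((s * t) *\<^sub>R g0 (x0 + t *\<^sub>R x)) powr p)"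
    "(LINT x|lebesgue. norm ((s * t) *\<^sub>R g0 (x0 + t *\<^sub>R x)) powr p) = s powr p * t powr (p - real d) * (LINT x|lebesgue. norm (g0 x) powr p)"
proof -
  have t0: "t \<noteq> 0" using t by simp
  have td: "t ^ DIM('a) = t powr real d" using t by (simp add: d_DIM powr_realpow)
  have inv: "t powr (- real d) * t powr real d = 1" using t by (simp add: powr_add[symmetric])
  note U = lebesgue_integral_affine[OF t0 borel_measurable_integrable[OF iu], of x0]
  note G = lebesgue_integral_affine[OF t0 borel_measurable_integrable[OF ig], of x0]
  have eu: "\<bar>s * u0 (x0 + t *\<^sub>R x)\<bar> powr (q + 1) = s powr (q + 1) * \<bar>u0 (x0 + t *\<^sub>R x)\<bar> powr (q + 1)" for x
    using s by (simp add: abs_mult powr_mult)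
  have eg: "norm ((s * t) *\<^sub>R g0 (x0 + t *\<^sub>R x)) powr p = (s powr p * t powr p) * norm (g0 (x0 + t *\<^sub>R x)) powr p" for x
    using s t by (simp add: abs_mult powr_mult)
  show "integrable lebesgue (\<lambda>x. \<bar>s * u0 (x0 + t *\<^sub>R x)\<bar> powr (q + 1))"
    unfolding eu using U(2) iu by simp
  show "integrable lebesgue (\<lambda>x. norm ((s * t) *\<^sub>R g0 (x0 + t *\<^sub>R x)) powr p)"
    unfolding eg using G(2) ig by simp
  have "(LINT x|lebesgue. \<bar>u0 (x0 + t *\<^sub>R x)\<bar> powr (q + 1)) = t powr (- real d) * (LINT x|lebesgue. \<bar>u0 x\<bar> powr (q + 1))"
    unfolding U(1) using t inv by (simp add: td mult.assoc[symmetric])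
  then show "(LINT x|lebesgue. \<bar>s * u0 (x0 + t *\<^sub>R x)\<bar> powr (q + 1)) = s powr (q + 1) * t powr (- real d) * (LINT x|lebesgue. \<bar>u0 x\<bar> powr (q + 1))"
    unfolding eu by simp
  have "(LINT x|lebesgue. norm (g0 (x0 + t *\<^sub>R x)) powr p) = t powr (- real d) * (LINT x|lebesgue. norm (g0 x) powr p)"
    unfolding G(1) using t inv by (simp add: td mult.assoc[symmetric])
  moreover have "t powr (p - real d) = t powr p * t powr (- real d)" by (simp add: powr_add[symmetric])
  ultimately show "(LINT x|lebesgue. norm ((s * t) *\<^sub>R g0 (x0 + t *\<^sub>R x)) powr p) = s powr p * t powr (p - real d) * (LINT x|lebesgue. norm (g0 x) powr p)"
    unfolding eg by simp
qed

text \<open>The dilates of the extremal function all have supremum 1, so the bound is minimal at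
  dilation factor 1; its derivative there gives the Pohozaev identity.\<close>

lemma pohozaev: "(p - real d) * A / p = real d * M / (q + 1)"
proof -
  define F where "F t = bound (t powr (- real d) * M) (t powr (p - real d) * A)" for t
  have ge: "A + M \<le> F t" if t: "0 < t" for t
  proof -
    have wg: "weak_gradient (\<lambda>x. 1 * Uc (0 + t *\<^sub>R x)) (\<lambda>x. (1 * t) *\<^sub>R Gc (0 + t *\<^sub>R x))"
      by (rule weak_gradient_affine[OF weak_gradient_Uc]) (use t in simp)
    note S = scaled_integrals[OF Uc_integrals(1) Gc_integrals(1) zero_less_one t, of 0]
    have "AE x in lebesgue. \<bar>1 * Uc (0 + t *\<^sub>R x)\<bar> \<le> F t / (A + M)"
      using AE_abs_le_bound[OF wg S(1,3)] unfolding S(2,4) Uc_integrals Gc_integrals F_def by simp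
    then have ae: "AE x in lebesgue. Uc (t *\<^sub>R x) \<le> F t / (A + M)" by eventually_elim simp
    \<comment> \<open>The dilate is continuous with value 1 at the origin, so a bound valid almost
      everywhere cannot be below 1.\<close>
    have "1 \<le> F t / (A + M)"
    proof (rule ccontr)
      assume "\<not> 1 \<le> F t / (A + M)"
      define S where "S = {x. F t / (A + M) < Uc (t *\<^sub>R x)}"
      have "continuous_on UNIV (\<lambda>x. Uc (t *\<^sub>R x))"
        unfolding Uc_def by (rule continuous_on_compose2[OF u_cont]) (auto intro!: continuous_intros)
      then have "open S" unfolding S_def by (intro open_Collect_less continuous_on_const)
      moreover have "0 \<in> S" using \<open>\<not> 1 \<le> F t / (A + M)\<close> P(2) by (simp add: S_def Uc_def)
      ultimately obtain x where "x \<in> S" "Uc (t *\<^sub>R x) \<le> F t / (A + M)"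
        using AE_open_meets[OF ae, of S] by blast
      then show False by (simp add: S_def)
    qed
    then show ?thesis using AM_pos by (simp add: le_divide_eq)
  qed
  have F1: "F 1 = A + M" by (simp add: F_def bound_def algebra_simps)
  define l where "l = (- real d * M / (q + 1)) + (p - real d) * A / p"
  have D: "(F has_real_derivative l) (at 1)"
  proof -
    have a: "((\<lambda>t. t powr (- real d)) has_real_derivative - real d) (at 1)"
      "((\<lambda>t. t powr (p - real d)) has_real_derivative p - real d) (at 1)"
      using has_real_derivative_powr[of 1 "- real d"] has_real_derivative_powr[of 1 "p - real d"] by simp_all
    show ?thesis unfolding F_def[abs_def] bound_def l_def
      by (rule DERIV_cong, (rule DERIV_add DERIV_const DERIV_cdivide DERIV_cmult_right a)+) simp
  qed
  \<comment> \<open>For positive \<open>t\<close> the values of \<open>F\<close> are at least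
    \<open>A + M = F 1\<close>.\<close>
  have "l = 0"
    by (rule DERIV_local_min[OF D, of 1]) (use ge F1 in auto)
  then show ?thesis by (simp add: l_def)
qed

end

section \<open>The sharp inequality\<close>

lemma Linf_norm_le:
  fixes f :: "'a::euclidean_space \<Rightarrow> real"
  assumes "f \<in> borel_measurable lebesgue" "AE x in lebesgue. \<bar>f x\<bar> \<le> c" "0 \<le> c"
  shows "in_Linf f" "Linf_norm f \<le> c"
proof -
  have m: "(\<lambda>x. ereal (norm (f x))) \<in> borel_measurable lebesgue" using assms(1) by measurable
  have le: "esssup lebesgue (\<lambda>x. ereal (norm (f x))) \<le> ereal c"
    by (rule esssup_I[OF m]) (use assms(2) in simp)
  then have "esssup lebesgue (\<lambda>x. ereal (norm (f x))) < \<infinity>" by (rule le_less_trans) simp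
  then show "in_Linf f" using assms(1) by (simp add: in_Linf_def)
  show "Linf_norm f \<le> c"
    using real_of_ereal_positive_mono[OF _ le] le assms(3) unfolding Linf_norm_def
    by (cases "esssup lebesgue (\<lambda>x. ereal (norm (f x)))") auto
qed

lemma Linf_norm_eq_1:
  fixes f :: "'a::euclidean_space \<Rightarrow> real"
  assumes c: "continuous_on UNIV f" and b: "\<And>x. \<bar>f x\<bar> \<le> 1" and a: "f a = 1"
  shows "Linf_norm f = 1"
proof -
  define E where "E = esssup lebesgue (\<lambda>x. ereal (norm (f x)))"
  have m: "(\<lambda>x. ereal (norm (f x))) \<in> borel_measurable lebesgue"
    using continuous_lebesgue_measurable[OF c] by measurable
  have le: "E \<le> ereal 1" unfolding E_def
    by (rule esssup_I[OF m]) (use b in simp)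
  have ae: "AE x in lebesgue. ereal (norm (f x)) \<le> E" unfolding E_def by (rule esssup_AE)
  have "ereal 1 \<le> E"
  proof (rule ccontr)
    assume "\<not> ereal 1 \<le> E"
    then obtain r where r: "E < ereal r" "ereal r < ereal 1" using ereal_dense2[of E "ereal 1"] by (auto simp: not_le)
    have "open {x. r < f x}" by (intro open_Collect_less continuous_on_const c)
    moreover have "{x. r < f x} \<noteq> {}" using a r(2) by (auto intro!: exI[of _ a])
    ultimately obtain x where x: "x \<in> {x. r < f x}" "ereal (norm (f x)) \<le> E"
      using AE_open_meets[OF ae] by metis
    have "ereal (norm (f x)) < ereal r" using x(2) r(1) by (rule le_less_trans)
    then show False using x(1) by simp
  qed
  then have "E = 1" using le by (simp add: one_ereal_def)
  then show ?thesis by (simp add: Linf_norm_def E_def)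
qed

context extremal begin

text \<open>\<open>a\<close> and \<open>b\<close> are the exponents of the energies \<open>\<integral> \<bar>u\<bar> powr (q + 1)\<close> and \<open>\<integral> \<bar>\<nabla>u\<bar> powr p\<close>, that is
  \<open>(1 - \<theta>) / (q + 1)\<close> and \<open>\<theta> / p\<close>.\<close>

definition D :: real where "D = real d * p + (p - real d) * (q + 1)"
definition a :: real where "a = (p - real d) / D"
definition b :: real where "b = real d / D"

lemma D_pos: "0 < D" unfolding D_def using d1 p1 p_gt q by (intro add_pos_nonneg) auto

lemma a_pos: "0 < a" and b_pos: "0 < b"
  using D_pos p_gt d1 by (simp_all add: a_def b_def)

lemma ab: "(q + 1) * a + p * b = 1" "(p - real d) * b = real d * a"
  using D_pos by (simp_all add: a_def b_def field_simps) (simp add: D_def field_simps)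

text \<open>An amplitude \<open>s\<close> and a dilation \<open>t\<close> are chosen to carry
  \<open>Y\<close> and \<open>X\<close> exactly to \<open>M\<close> and \<open>A\<close>, the
  equality case of \<open>bound\<close>; the rescaled function is then at most 1. Positive upper
  bounds take the place of the energies so that vanishing energies can be approximated.\<close>

lemma AE_abs_le_powr_pos:
  fixes u0 :: "'a \<Rightarrow> real"
  assumes wg: "weak_gradient u0 g0" and iu: "integrable lebesgue (\<lambda>x. \<bar>u0 x\<bar> powr (q + 1))"
    and ig: "integrable lebesgue (\<lambda>x. norm (g0 x) powr p)"
    and Y: "(LINT x|lebesgue. \<bar>u0 x\<bar> powr (q + 1)) \<le> Y" "0 < Y"
    and X: "(LINT x|lebesgue. norm (g0 x) powr p) \<le> X" "0 < X"
  shows "AE x in lebesgue. \<bar>u0 x\<bar> \<le> (Y / M) powr a * (X / A) powr b"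
proof -
  define y x where "y = ln (Y / M)" and "x = ln (X / A)"
  \<comment> \<open>In logarithms the two requirements are the linear equations \<open>e1\<close>
    and \<open>e2\<close>. Eliminating \<eta> from them gives D * \<tau> = (p - d) * y + d *
    x.\<close>
  define \<tau> \<eta> where "\<tau> = a * y + b * x" and "\<eta> = (y - (q + 1) * \<tau>) / real d"
  define s t where "s = exp (- \<tau>)" and "t = exp \<eta>"
  have d0: "real d \<noteq> 0" using d1 by simp
  have "real d * \<eta> = y - (q + 1) * \<tau>" using d0 by (simp add: \<eta>_def)
  then have e1: "- (q + 1) * \<tau> - real d * \<eta> + y = 0" by (simp add: algebra_simps)
  have e2: "- p * \<tau> + (p - real d) * \<eta> + x = 0"
  proof -
    have "D * \<tau> = (p - real d) * y + real d * x"
      using D_pos by (simp add: \<tau>_def a_def b_def field_simps)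
    then have "real d * (- p * \<tau> + (p - real d) * \<eta> + x) = 0"
      using e1 unfolding D_def by algebra
    then show ?thesis using d0 by simp
  qed
  have YM: "Y = exp y * M" and XA: "X = exp x * A"
    using Y X M_pos A_pos by (simp_all add: y_def x_def)
  have st: "0 < s" "0 < t" by (simp_all add: s_def t_def)
  have "s powr (q + 1) * t powr (- real d) * Y = exp (- (q + 1) * \<tau> - real d * \<eta> + y) * M"
    unfolding YM s_def t_def exp_powr_real mult.assoc[symmetric] exp_add[symmetric]
    by (simp add: algebra_simps)
  then have sY: "s powr (q + 1) * t powr (- real d) * Y = M" by (simp only: e1) simp
  have "s powr p * t powr (p - real d) * X = exp (- p * \<tau> + (p - real d) * \<eta> + x) * A"
    unfolding XA s_def t_def exp_powr_real mult.assoc[symmetric] exp_add[symmetric]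
    by (simp add: algebra_simps)
  then have sX: "s powr p * t powr (p - real d) * X = A" by (simp only: e2) simp
  have wg': "weak_gradient (\<lambda>x. s * u0 (0 + t *\<^sub>R x)) (\<lambda>x. (s * t) *\<^sub>R g0 (0 + t *\<^sub>R x))"
    by (rule weak_gradient_affine[OF wg]) (use st in simp)
  note S = scaled_integrals[OF iu ig st, of 0]
  let ?Y = "LINT x|lebesgue. \<bar>s * u0 (0 + t *\<^sub>R x)\<bar> powr (q + 1)"
  let ?X = "LINT x|lebesgue. norm ((s * t) *\<^sub>R g0 (0 + t *\<^sub>R x)) powr p"
  have le: "?Y \<le> M" "?X \<le> A"
    unfolding S(2,4) sY[symmetric] sX[symmetric] by (intro mult_left_mono Y X; simp)+
  have "bound ?Y ?X \<le> bound M A"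
    unfolding bound_def using le p1 q by (intro add_mono divide_right_mono) auto
  also have "bound M A = A + M" by (simp add: bound_def algebra_simps)
  finally have le1: "bound ?Y ?X / (A + M) \<le> 1" using AM_pos by (simp add: divide_le_eq)
  have ae: "AE x in lebesgue. \<bar>s * u0 (0 + t *\<^sub>R x)\<bar> \<le> 1"
    using AE_abs_le_bound[OF wg' S(1,3)] by eventually_elim (rule order_trans[OF _ le1])
  have um: "u0 \<in> borel_measurable lebesgue"
    using wg unfolding weak_gradient_def by (blast intro: locally_integrable_measurable)
  have "AE z in lebesgue. \<bar>s * u0 z\<bar> \<le> 1"
  proof (rule AE_affine[OF _ _ ae])
    have "(\<lambda>z. \<bar>s * u0 z\<bar>) \<in> borel_measurable lebesgue" using um by measurable
    then show "{z. \<bar>s * u0 z\<bar> \<le> 1} \<in> sets lebesgue" by (simp add: borel_measurable_iff_le)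
  qed (use st in simp)
  then have "AE z in lebesgue. \<bar>u0 z\<bar> \<le> exp \<tau>"
    by eventually_elim (simp add: abs_mult s_def exp_minus field_simps)
  moreover have "exp \<tau> = (Y / M) powr a * (X / A) powr b"
    using Y X M_pos A_pos by (simp add: powr_def \<tau>_def x_def y_def exp_add)
  ultimately show ?thesis by simp
qed

text \<open>Both energies are perturbed to positive values, and the bound is continuous in them
  because \<open>a\<close> and \<open>b\<close> are positive.\<close>

lemma AE_abs_le_powr:
  fixes u0 :: "'a \<Rightarrow> real"
  assumes wg: "weak_gradient u0 g0" and iu: "integrable lebesgue (\<lambda>x. \<bar>u0 x\<bar> powr (q + 1))"
    and ig: "integrable lebesgue (\<lambda>x. norm (g0 x) powr p)"
  defines "Y \<equiv> LINT x|lebesgue. \<bar>u0 x\<bar> powr (q + 1)" and "X \<equiv> LINT x|lebesgue. norm (g0 x) powr p"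
  shows "AE x in lebesgue. \<bar>u0 x\<bar> \<le> (Y / M) powr a * (X / A) powr b"
proof -
  define e where "e n = inverse (real (Suc n))" for n
  have e0: "0 < e n" for n by (simp add: e_def)
  have elim0: "e \<longlonglongrightarrow> 0" unfolding e_def by (rule LIMSEQ_inverse_real_of_nat)
  have Y0: "0 \<le> Y" and X0: "0 \<le> X" unfolding Y_def X_def by (rule Bochner_Integration.integral_nonneg, simp)+
  have "AE x in lebesgue. \<bar>u0 x\<bar> \<le> ((Y + e n) / M) powr a * ((X + e n) / A) powr b" for n
    by (rule AE_abs_le_powr_pos[OF wg iu ig]) (use e0[of n] Y0 X0 in \<open>simp_all add: Y_def[symmetric] X_def[symmetric] add_nonneg_pos\<close>)
  then have ae: "AE x in lebesgue. \<forall>n. \<bar>u0 x\<bar> \<le> ((Y + e n) / M) powr a * ((X + e n) / A) powr b"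
    by (subst AE_all_countable) blast
  have "(\<lambda>n. ((Y + e n) / M) powr a * ((X + e n) / A) powr b)
      \<longlonglongrightarrow> ((Y + 0) / M) powr a * ((X + 0) / A) powr b"
    using M_pos A_pos a_pos b_pos e0 X0 Y0
    by (intro tendsto_mult tendsto_powr' tendsto_divide tendsto_add tendsto_const elim0)
      (auto intro!: always_eventually divide_nonneg_nonneg add_nonneg_nonneg simp: less_imp_le)
  then have lim: "(\<lambda>n. ((Y + e n) / M) powr a * ((X + e n) / A) powr b) \<longlonglongrightarrow> (Y / M) powr a * (X / A) powr b"
    by simp
  from ae show ?thesis
  proof eventually_elim
    case (elim x)
    show ?case by (rule LIMSEQ_le_const[OF lim]) (use elim in blast)
  qed
qed

text \<open>In terms of \<theta> the Pohozaev identity reads (1 - \<theta>) * A = \<theta> * M,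
  which eliminates \<open>A\<close> from the constant; the exponents of \<open>M\<close> add up
  because a + b = \<theta> / d.\<close>

lemma const_eq:
  assumes "\<theta> = p * real d / (real d * p + (p - real d) * (q + 1))"
  shows "\<theta> = p * b" "1 - \<theta> = (q + 1) * a"
    "\<theta> powr (- \<theta> / p) * (1 - \<theta>) powr (\<theta> / p) * M powr (- \<theta> / real d) = M powr (- a) * A powr (- b)"
proof -
  show t: "\<theta> = p * b" using assms by (simp add: b_def D_def)
  then show t1: "1 - \<theta> = (q + 1) * a" using ab(1) by simp
  have p: "0 < \<theta>" "0 < 1 - \<theta>" unfolding t1 using a_pos b_pos p1 q by (simp_all add: t)
  have e: "- \<theta> / p = - b" "\<theta> / p = b" using p1 by (simp_all add: t)
  have "- \<theta> / real d = - (a + b)"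
    using ab(2) d1 by (simp add: t field_simps)
  then have Mp: "M powr (- \<theta> / real d) = M powr (- a) * M powr (- b)"
    by (simp add: powr_add[symmetric])
  have "(p - real d) * A * (q + 1) = real d * M * p" using pohozaev p1 q by (simp add: field_simps)
  then have "(1 - \<theta>) * A = \<theta> * M"
    unfolding t1 unfolding t a_def b_def using D_pos by (simp add: field_simps)
  then have AM: "A = \<theta> * M / (1 - \<theta>)" using p by (simp add: field_simps)
  have "A powr (- b) = \<theta> powr (- b) * (1 - \<theta>) powr b * M powr (- b)"
    unfolding AM using p M_pos by (simp add: powr_mult powr_divide powr_minus field_simps)
  then show "\<theta> powr (- \<theta> / p) * (1 - \<theta>) powr (\<theta> / p) * M powr (- \<theta> / real d) = M powr (- a) * A powr (- b)"
    unfolding e Mp by simp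
qed

lemma norms_eq:
  fixes u0 :: "'a \<Rightarrow> real" and g0 :: "'a \<Rightarrow> 'a"
  assumes "\<theta> = p * real d / (real d * p + (p - real d) * (q + 1))"
  shows "Lp_norm (q + 1) u0 powr (1 - \<theta>) = (LINT x|lebesgue. \<bar>u0 x\<bar> powr (q + 1)) powr a"
    "Lp_norm p g0 powr \<theta> = (LINT x|lebesgue. norm (g0 x) powr p) powr b"
  unfolding const_eq(2)[OF assms] unfolding const_eq(1)[OF assms]
  using q p1 by (simp_all add: Lp_norm_def powr_powr)

lemma optimal_bound:
  fixes u0 :: "'a \<Rightarrow> real"
  assumes th: "\<theta> = p * real d / (real d * p + (p - real d) * (q + 1))"
    and "in_Lp (q + 1) u0" "weak_gradient u0 g0" "in_Lp p g0"
  shows "in_Linf u0" "Linf_norm u0 \<le> (\<theta> powr (- \<theta> / p) * (1 - \<theta>) powr (\<theta> / p) * M powr (- \<theta> / real d)) *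
    Lp_norm (q + 1) u0 powr (1 - \<theta>) * Lp_norm p g0 powr \<theta>"
proof -
  let ?Y = "LINT x|lebesgue. \<bar>u0 x\<bar> powr (q + 1)" and ?X = "LINT x|lebesgue. norm (g0 x) powr p"
  have m: "u0 \<in> borel_measurable lebesgue" and iu: "integrable lebesgue (\<lambda>x. \<bar>u0 x\<bar> powr (q + 1))"
    and ig: "integrable lebesgue (\<lambda>x. norm (g0 x) powr p)"
    using assms by (simp_all add: in_Lp_def)
  have nn: "0 \<le> ?Y" "0 \<le> ?X" by (rule Bochner_Integration.integral_nonneg, simp)+
  have eq: "(?Y / M) powr a * (?X / A) powr b = (\<theta> powr (- \<theta> / p) * (1 - \<theta>) powr (\<theta> / p) * M powr (- \<theta> / real d)) *
    Lp_norm (q + 1) u0 powr (1 - \<theta>) * Lp_norm p g0 powr \<theta>"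
    unfolding const_eq(3)[OF th] norms_eq[OF th] using nn M_pos A_pos
    by (simp add: powr_divide powr_minus field_simps)
  have "0 \<le> (?Y / M) powr a * (?X / A) powr b" by simp
  note N = Linf_norm_le[OF m AE_abs_le_powr[OF assms(3) iu ig] this]
  show "in_Linf u0" by (rule N(1))
  show "Linf_norm u0 \<le> (\<theta> powr (- \<theta> / p) * (1 - \<theta>) powr (\<theta> / p) * M powr (- \<theta> / real d)) *
    Lp_norm (q + 1) u0 powr (1 - \<theta>) * Lp_norm p g0 powr \<theta>"
    using N(2) unfolding eq .
qed

text \<open>The dilation factor cancels since (p - d) * b = d * a. What remains is the product of
  energies whose inverse is the constant, in accordance with the supremum 1.\<close>

lemma optimal_equality:
  fixes x0 :: 'a
  assumes th: "\<theta> = p * real d / (real d * p + (p - real d) * (q + 1))" and l: "0 < l"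
  defines "U \<equiv> \<lambda>x. u (l * norm (x - x0))"
  shows "in_Lp (q + 1) U \<and> (\<exists>g. weak_gradient U g \<and> in_Lp p g \<and> Linf_norm U = 1 \<and>
      1 = (\<theta> powr (- \<theta> / p) * (1 - \<theta>) powr (\<theta> / p) * M powr (- \<theta> / real d)) *
        Lp_norm (q + 1) U powr (1 - \<theta>) * Lp_norm p g powr \<theta>)"
proof -
  define y where "y = - (l *\<^sub>R x0)"
  define G where "G x = (1 * l) *\<^sub>R Gc (y + l *\<^sub>R x)" for x
  have Ux: "U x = 1 * Uc (y + l *\<^sub>R x)" for x
  proof -
    have "y + l *\<^sub>R x = l *\<^sub>R (x - x0)" by (simp add: y_def algebra_simps)
    then show "U x = 1 * Uc (y + l *\<^sub>R x)" using l by (simp add: U_def Uc_def)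
  qed
  then have U: "U = (\<lambda>x. 1 * Uc (y + l *\<^sub>R x))" by (rule ext)
  note S = scaled_integrals[OF Uc_integrals(1) Gc_integrals(1) zero_less_one l, of y, folded Ux G_def,
      unfolded Uc_integrals Gc_integrals powr_one_eq_one mult_1_left]
  have wg: "weak_gradient U G" unfolding U G_def[abs_def]
    by (rule weak_gradient_affine[OF weak_gradient_Uc]) (use l in simp)
  have Uc: "continuous_on UNIV U"
    unfolding U_def by (rule continuous_on_compose2[OF P(4)]) (use l in \<open>auto intro!: continuous_intros\<close>)
  have L: "Linf_norm U = 1"
  proof (rule Linf_norm_eq_1[OF Uc, of x0])
    show "\<bar>U x\<bar> \<le> 1" for x using P(8) u_le1 l by (simp add: U_def)
    show "U x0 = 1" using P(2) by (simp add: U_def)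
  qed
  have "(l powr (- real d) * M) powr a * (l powr (p - real d) * A) powr b = l powr (- real d * a + (p - real d) * b) * (M powr a * A powr b)"
    using M_pos A_pos by (simp add: powr_mult powr_powr flip: powr_add)
  also have "- real d * a + (p - real d) * b = 0" using ab(2) by simp
  finally have s: "(l powr (- real d) * M) powr a * (l powr (p - real d) * A) powr b = M powr a * A powr b"
    using l by simp
  have "1 = (M powr (- a) * A powr (- b)) * (M powr a * A powr b)"
    using M_pos A_pos by (simp add: powr_minus field_simps)
  also have "\<dots> = (\<theta> powr (- \<theta> / p) * (1 - \<theta>) powr (\<theta> / p) * M powr (- \<theta> / real d)) *
        Lp_norm (q + 1) U powr (1 - \<theta>) * Lp_norm p G powr \<theta>"
    unfolding const_eq(3)[OF th] norms_eq[OF th] S(2,4) s[symmetric] by (simp only: mult.assoc)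
  finally have e: "1 = (\<theta> powr (- \<theta> / p) * (1 - \<theta>) powr (\<theta> / p) * M powr (- \<theta> / real d)) *
        Lp_norm (q + 1) U powr (1 - \<theta>) * Lp_norm p G powr \<theta>" .
  have Gm: "G \<in> borel_measurable lebesgue"
    by (rule locally_integrable_measurable) (use wg in \<open>simp add: weak_gradient_def\<close>)
  have "in_Lp (q + 1) U" "in_Lp p G"
    using S(1,3) Gm continuous_lebesgue_measurable[OF Uc] by (simp_all add: in_Lp_def)
  then show ?thesis using wg L e by blast
qed

end

theorem theorem4p1:
  fixes d :: nat and p q \<theta> :: real
  assumes "d = CARD('n::finite)"
    and "p > real d" and "q \<ge> 0"
    and "\<theta> = p * real d / (real d * p + (p - real d) * (q + 1))"
  shows "\<exists>uc M C.
    unique_profile d p q uc \<and>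
    integrable lebesgue (\<lambda>x::real^'n. \<bar>uc (norm x)\<bar> powr (q + 1)) \<and>
    M = (LINT x::real^'n|lebesgue. \<bar>uc (norm x)\<bar> powr (q + 1)) \<and>
    C = \<theta> powr (- \<theta> / p) * (1 - \<theta>) powr (\<theta> / p) * M powr (- \<theta> / real d) \<and>
    (\<forall>(u :: real^'n \<Rightarrow> real) g.
       in_Lp (q + 1) u \<and> weak_gradient u g \<and> in_Lp p g \<longrightarrow>
       in_Linf u \<and>
       Linf_norm u \<le> C * Lp_norm (q + 1) u powr (1 - \<theta>) * Lp_norm p g powr \<theta>) \<and>
    (\<forall>C'. (\<forall>(u :: real^'n \<Rightarrow> real) g.
              in_Lp (q + 1) u \<and> weak_gradient u g \<and> in_Lp p g \<longrightarrow>
              Linf_norm u \<le> C' * Lp_norm (q + 1) u powr (1 - \<theta>) * Lp_norm p g powr \<theta>) \<longrightarrow>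
          C \<le> C') \<and>
    (\<forall>l > 0. \<forall>(x\<^sub>0 :: real^'n) u. u = (\<lambda>x. uc (l * norm (x - x\<^sub>0))) \<longrightarrow>
       in_Lp (q + 1) u \<and>
       (\<exists>g. weak_gradient u g \<and> in_Lp p g \<and>
          Linf_norm u = C * Lp_norm (q + 1) u powr (1 - \<theta>) * Lp_norm p g powr \<theta>))"
proof -
  have d: "1 \<le> d" using assms(1) by (simp add: Suc_le_eq)
  obtain k uc w where prof: "profile_on d p q k uc w" using profile_exists[OF d assms(2,3)] by metis
  interpret E: extremal d p q k uc w "TYPE(real^'n)"
    by unfold_locales (use prof assms in simp_all)
  define C where "C = \<theta> powr (- \<theta> / p) * (1 - \<theta>) powr (\<theta> / p) * E.M powr (- \<theta> / real d)"
  have eq: "in_Lp (q + 1) u \<and> (\<exists>g. weak_gradient u g \<and> in_Lp p g \<and> Linf_norm u = 1 \<and>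
      1 = C * Lp_norm (q + 1) u powr (1 - \<theta>) * Lp_norm p g powr \<theta>)"
    if "0 < l" "u = (\<lambda>x. uc (l * norm (x - x0)))" for l u and x0 :: "real^'n"
    unfolding that(2) C_def by (rule E.optimal_equality[OF assms(4) that(1)])
  \<comment> \<open>The profile itself is a competitor with supremum 1, so every valid constant is
    at least 1 / K, and this is \<open>C\<close>.\<close>
  have min: "C \<le> C'"
    if C': "\<forall>(u :: real^'n \<Rightarrow> real) g. in_Lp (q + 1) u \<and> weak_gradient u g \<and> in_Lp p g \<longrightarrow>
              Linf_norm u \<le> C' * Lp_norm (q + 1) u powr (1 - \<theta>) * Lp_norm p g powr \<theta>" for C'
  proof -
    define u :: "real^'n \<Rightarrow> real" where "u = (\<lambda>x. uc (1 * norm (x - 0)))"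
    obtain g where g: "in_Lp (q + 1) u" "weak_gradient u g" "in_Lp p g" "Linf_norm u = 1"
      "1 = C * Lp_norm (q + 1) u powr (1 - \<theta>) * Lp_norm p g powr \<theta>"
      using eq[OF zero_less_one u_def] by metis
    define K where "K = Lp_norm (q + 1) u powr (1 - \<theta>) * Lp_norm p g powr \<theta>"
    have CK: "1 = C * K" using g(5) by (simp add: K_def mult.assoc)
    have "1 \<le> C' * K" using C' g(1-4) unfolding K_def mult.assoc[symmetric] by metis
    then have "C * K \<le> C' * K" using CK by simp
    moreover have "0 \<le> K" by (simp add: K_def)
    then have "0 < K" using CK by (cases "K = 0") auto
    ultimately show ?thesis by simp
  qed
  show ?thesis
  proof (rule exI[of _ uc], rule exI[of _ E.M], rule exI[of _ C], intro conjI allI impI C_def)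
    show "unique_profile d p q uc" by (rule profile_unique[OF prof d E.p1 assms(3)])
    show "integrable lebesgue (\<lambda>x::real^'n. \<bar>uc (norm x)\<bar> powr (q + 1))"
      using E.Uc_integrals(1) by (simp add: E.Uc_def)
    show "E.M = (LINT x::real^'n|lebesgue. \<bar>uc (norm x)\<bar> powr (q + 1))"
      using E.Uc_integrals(2) by (simp add: E.Uc_def)
    fix u :: "real^'n \<Rightarrow> real" and g
    assume "in_Lp (q + 1) u \<and> weak_gradient u g \<and> in_Lp p g"
    then show "in_Linf u" "Linf_norm u \<le> C * Lp_norm (q + 1) u powr (1 - \<theta>) * Lp_norm p g powr \<theta>"
      using E.optimal_bound[OF assms(4), of u g] unfolding C_def by simp_all
  next
    fix C' assume "\<forall>(u :: real^'n \<Rightarrow> real) g. in_Lp (q + 1) u \<and> weak_gradient u g \<and> in_Lp p g \<longrightarrow>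
      Linf_norm u \<le> C' * Lp_norm (q + 1) u powr (1 - \<theta>) * Lp_norm p g powr \<theta>"
    then show "C \<le> C'" by (rule min)
  next
    fix l :: real and x0 :: "real^'n" and u
    assume "0 < l" "u = (\<lambda>x. uc (l * norm (x - x0)))"
    from eq[OF this] show "in_Lp (q + 1) u" "\<exists>g. weak_gradient u g \<and> in_Lp p g \<and>
      Linf_norm u = C * Lp_norm (q + 1) u powr (1 - \<theta>) * Lp_norm p g powr \<theta>"
      by simp_all metis
  qed
qed

end
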